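(* Let $(J,\mathcal{A})$ be a standard Borel space and let $\sigma,\psi$ be finite nonnegative symmetric measures on $\mathcal{A}\times\mathcal{A}$. Then for every $\varepsilon>0$ there is a multicommodity flow $F$ with demand measure $\sigma$ whose overload over $\psi$ is less than $\varepsilon$ if and only if $\mathcal{D}(\sigma)\le\mathcal{D}(\psi)$ for every metrical linear functional $\mathcal{D}$ on the space of finite signed measures on $\mathcal{A}\times\mathcal{A}$.
   Context: For $X\subseteq J\times J$, $X^*=\{(x,y):(y,x)\in X\}$; for a measure $\mu$ on $\mathcal{A}^2=\mathcal{A}\times\mathcal{A}$, $\mu^*(X)=\mu(X^* )$, and $\mu$ is symmetric if $\mu^*=\mu$. For a measure $\kappa$ on $\mathcal{A}^3$, $\kappa^{ij}$ denotes its marginal on coordinates $i,j$. A bounded linear functional $\mathcal{D}$ on the Banach space $\mathcal{M}(\mathcal{A}^2)$ of finite signed measures on $\mathcal{A}^2$ (total variation norm) is metrical if (a) $\mathcal{D}(\mu)=0$ for every $\mu$ concentrated on the diagonal $\{(x,x):x\in J\}$; (b) $\mathcal{D}(\mu)=\mathcal{D}(\mu^* )$ for every $\mu$; (c) $\mathcal{D}(\kappa^{12})+\mathcal{D}(\kappa^{23})\ge\mathcal{D}(\kappa^{13})$ for every finite nonnegative measure $\kappa$ on $\mathcal{A}^3$. For $s,t\in J$, an $s$-$t$ flow of value $1$ is a finite nonnegative measure $\varphi$ on $\mathcal{A}^2$ with $\varphi(A\times J)-\varphi(J\times A)=\delta_s(A)-\delta_t(A)$ for all $A\in\mathcal{A}$.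 A multicommodity flow with demand $\sigma$ is $F=(\sigma;\varphi_{st}:(s,t)\in J\times J)$ where each $\varphi_{st}$ is an $s$-$t$ flow of value $1$ and $(s,t)\mapsto\varphi_{st}(U)$ is measurable for each $U\in\mathcal{A}^2$; its total load is the measure $\varphi_F(S)=\int_{J\times J}\varphi_{xy}(S)\,d\sigma(x,y)$. The overload of $F$ over $\psi$ is $\|(\varphi_F-\psi)_+\|$, the total variation norm of the positive part of $\varphi_F-\psi$. *)

theory Defs
  imports "HOL-Probability.Probability"
begin

text \<open>
  Throughout, a measurable space \<open>(J, \<A>)\<close> is given by a \<open>measure\<close> \<open>M\<close> of which only
  \<open>space M\<close> and \<open>sets M\<close> are used. A finite nonnegative measure on \<open>M\<close> is a \<open>measure\<close> \<open>\<mu>\<close> with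
  \<open>finite_measure \<mu>\<close> and \<open>sets \<mu> = sets M\<close>.
\<close>

definition standard_borel :: "'a measure \<Rightarrow> bool" where
  "standard_borel M \<longleftrightarrow>
     (\<exists>X. completely_metrizable_space X \<and> separable_space X \<and> topspace X = space M \<and>
          sets M = sigma_sets (space M) {U. openin X U})"

definition finite_measure_on :: "'a measure \<Rightarrow> 'a measure \<Rightarrow> bool" where
  "finite_measure_on M \<mu> \<longleftrightarrow> finite_measure \<mu> \<and> sets \<mu> = sets M"

text \<open>
  A finite signed measure is a real-valued set function. The value \<open>0\<close> outside the
  \<open>\<sigma>\<close>-algebra makes the representation unique and agrees with the convention for \<^const>\<open>measure\<close>,
  so that \<open>measure \<mu>\<close> is the signed measure corresponding to a finite measure \<open>\<mu>\<close>.
\<close>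

definition signed_measures :: "'a measure \<Rightarrow> ('a set \<Rightarrow> real) set" where
  "signed_measures M =
     {\<mu>. \<mu> {} = 0 \<and>
         (\<forall>A :: nat \<Rightarrow> 'a set. range A \<subseteq> sets M \<longrightarrow> disjoint_family A \<longrightarrow>
            (\<lambda>i. \<mu> (A i)) sums \<mu> (\<Union>i. A i)) \<and>
         (\<forall>A. A \<notin> sets M \<longrightarrow> \<mu> A = 0)}"

text \<open>
  Total variation and positive part are defined for extended real valued set functions,
  because the total load of a multicommodity flow may be infinite.
\<close>

definition total_variation :: "'a measure \<Rightarrow> ('a set \<Rightarrow> ereal) \<Rightarrow> ereal" where
  "total_variation M \<mu> =
     (SUP P \<in> {P. finite P \<and> P \<subseteq> sets M \<and> partition_on (space M) P}. \<Sum>A\<in>P. \<bar>\<mu> A\<bar>)"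

definition positive_part :: "'a measure \<Rightarrow> ('a set \<Rightarrow> ereal) \<Rightarrow> 'a set \<Rightarrow> ereal" where
  "positive_part M \<mu> S = (SUP T \<in> {T \<in> sets M. T \<subseteq> S}. \<mu> T)"

definition bounded_functional :: "'a measure \<Rightarrow> (('a set \<Rightarrow> real) \<Rightarrow> real) \<Rightarrow> bool" where
  "bounded_functional M D \<longleftrightarrow>
     (\<forall>\<mu>\<in>signed_measures M. \<forall>\<nu>\<in>signed_measures M. D (\<lambda>A. \<mu> A + \<nu> A) = D \<mu> + D \<nu>) \<and>
     (\<forall>\<mu>\<in>signed_measures M. \<forall>c. D (\<lambda>A. c * \<mu> A) = c * D \<mu>) \<and>
     (\<exists>C::real. \<forall>\<mu>\<in>signed_measures M.
        ereal \<bar>D \<mu>\<bar> \<le> ereal C * total_variation M (\<lambda>A. ereal (\<mu> A)))"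

definition symmetric_measure :: "('a \<times> 'a) measure \<Rightarrow> bool" where
  "symmetric_measure \<mu> \<longleftrightarrow> (\<forall>X\<in>sets \<mu>. emeasure \<mu> (X\<inverse>) = emeasure \<mu> X)"

definition metrical :: "'a measure \<Rightarrow> ((('a \<times> 'a) set \<Rightarrow> real) \<Rightarrow> real) \<Rightarrow> bool" where
  "metrical M D \<longleftrightarrow>
     bounded_functional (M \<Otimes>\<^sub>M M) D \<and>
     (\<forall>\<mu>\<in>signed_measures (M \<Otimes>\<^sub>M M).
        (\<forall>X\<in>sets (M \<Otimes>\<^sub>M M). X \<inter> Id = {} \<longrightarrow> \<mu> X = 0) \<longrightarrow> D \<mu> = 0) \<and>
     (\<forall>\<mu>\<in>signed_measures (M \<Otimes>\<^sub>M M). D \<mu> = D (\<lambda>X. \<mu> (X\<inverse>))) \<and>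
     (\<forall>\<kappa>. finite_measure_on (M \<Otimes>\<^sub>M M \<Otimes>\<^sub>M M) \<kappa> \<longrightarrow>
        D (measure (distr \<kappa> (M \<Otimes>\<^sub>M M) (\<lambda>(x, y, z). (x, y)))) +
        D (measure (distr \<kappa> (M \<Otimes>\<^sub>M M) (\<lambda>(x, y, z). (y, z)))) \<ge>
        D (measure (distr \<kappa> (M \<Otimes>\<^sub>M M) (\<lambda>(x, y, z). (x, z)))))"

definition unit_flow :: "'a measure \<Rightarrow> 'a \<Rightarrow> 'a \<Rightarrow> ('a \<times> 'a) measure \<Rightarrow> bool" where
  "unit_flow M s t \<phi> \<longleftrightarrow>
     finite_measure_on (M \<Otimes>\<^sub>M M) \<phi> \<and>
     (\<forall>A\<in>sets M. measure \<phi> (A \<times> space M) - measure \<phi> (space M \<times> A) =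
        measure (return M s) A - measure (return M t) A)"

definition multicommodity_flow ::
  "'a measure \<Rightarrow> ('a \<times> 'a) measure \<Rightarrow> ('a \<times> 'a \<Rightarrow> ('a \<times> 'a) measure) \<Rightarrow> bool" where
  "multicommodity_flow M \<sigma> \<phi> \<longleftrightarrow>
     finite_measure_on (M \<Otimes>\<^sub>M M) \<sigma> \<and>
     (\<forall>s\<in>space M. \<forall>t\<in>space M. unit_flow M s t (\<phi> (s, t))) \<and>
     (\<forall>U\<in>sets (M \<Otimes>\<^sub>M M). (\<lambda>p. emeasure (\<phi> p) U) \<in> borel_measurable (M \<Otimes>\<^sub>M M))"

definition total_load ::
  "('a \<times> 'a) measure \<Rightarrow> ('a \<times> 'a \<Rightarrow> ('a \<times> 'a) measure) \<Rightarrow> ('a \<times> 'a) measure" where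
  "total_load \<sigma> \<phi> =
     measure_of (space \<sigma>) (sets \<sigma>) (\<lambda>S. \<integral>\<^sup>+ p. emeasure (\<phi> p) S \<partial>\<sigma>)"

text \<open>
  The difference below is well defined since \<open>\<psi>\<close> is finite; if the total load is
  infinite, then so is the overload.
\<close>

definition overload ::
  "('a \<times> 'a) measure \<Rightarrow> ('a \<times> 'a \<Rightarrow> ('a \<times> 'a) measure) \<Rightarrow> ('a \<times> 'a) measure \<Rightarrow> ereal" where
  "overload \<sigma> \<phi> \<psi> =
     total_variation \<psi>
       (positive_part \<psi>
         (\<lambda>S. enn2ereal (emeasure (total_load \<sigma> \<phi>) S) - enn2ereal (emeasure \<psi> S)))"

end

theory Submission
  imports Defs
begin

text \<open>
  If \<open>\<D>\<close> is metrical and \<open>F\<close> has demand \<open>\<sigma>\<close>, then the joint law \<open>\<kappa>\<close> of a source and an arc of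
  its flow satisfies \<open>\<kappa>\<^sup>1\<^sup>3 - \<kappa>\<^sup>1\<^sup>2 = \<sigma>\<close> up to the diagonal, so \<open>\<D>(\<sigma>) \<le> \<D>(\<kappa>\<^sup>2\<^sup>3) = \<D>(\<phi>\<^sub>F)\<close>, which
  exceeds \<open>\<D>(\<psi>)\<close> by at most a multiple of the overload.

  Conversely, if every overload is at least \<open>\<epsilon>\<close>, the Hahn-Banach theorem gives a bounded functional
  \<open>D\<close>, monotone on measures, with \<open>D(\<phi>\<^sub>F) \<ge> D(\<psi>) + \<epsilon>\<close> for all flows \<open>F\<close> with demand \<open>\<sigma>\<close>. Replace \<open>D\<close>
  by the infimum of \<open>D\<close> over the loads serving a given demand. This routing cost is additive in
  the demand, vanishes on the diagonal, and satisfies the triangle inequality because flows for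
  \<open>\<kappa>\<^sup>1\<^sup>2\<close> and \<open>\<kappa>\<^sup>2\<^sup>3\<close> can be spliced along a disintegration of \<open>\<kappa>\<close>; its symmetrization is therefore
  metrical, and it separates \<open>\<sigma>\<close> from \<open>\<psi>\<close>.
\<close>

section \<open>Signed measures\<close>

text \<open>The functional that separates the loads of \<sigma> from \<psi> need not respect
  triangles or reversal; it only prices arcs. Minimizing over routings is the passage from arc
  lengths to the shortest-path metric, carried out on demands instead of pairs of points. Additivity
  is not automatic for an infimum: it holds because a flow family serves any part of its demand, and
  because two families can be mixed pointwise in the proportion of their demands. \<psi> carries
  itself along its own arcs, so its routing cost is at most its price, and symmetry of \<sigma> and
  \<psi> keeps the gap under symmetrization. A bound by the one-sided norm \<open>pos_norm\<close>
  gives monotonicity and boundedness at once, and matches the overload, which counts only excess.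
  The standard Borel structure enters twice: to produce the midpoint of a splice as a measurable
  function of the endpoints and independent noise, and to make the diagonal measurable.\<close>

lemma signed_measuresI:
  assumes "\<mu> {} = 0"
    and "\<And>A :: nat \<Rightarrow> 'a set. range A \<subseteq> sets M \<Longrightarrow> disjoint_family A \<Longrightarrow> (\<lambda>i. \<mu> (A i)) sums \<mu> (\<Union>i. A i)"
    and "\<And>A. A \<notin> sets M \<Longrightarrow> \<mu> A = 0"
  shows "\<mu> \<in> signed_measures M"
  using assms by (auto simp: signed_measures_def)

lemma signed_measures_empty: "\<mu> \<in> signed_measures M \<Longrightarrow> \<mu> {} = 0"
  by (simp add: signed_measures_def)

lemma signed_measures_sums:
  "\<mu> \<in> signed_measures M \<Longrightarrow> range A \<subseteq> sets M \<Longrightarrow> disjoint_family A \<Longrightarrow>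
    (\<lambda>i. \<mu> (A i)) sums \<mu> (\<Union>i::nat. A i)"
  by (simp add: signed_measures_def)

lemma signed_measures_outside: "\<mu> \<in> signed_measures M \<Longrightarrow> A \<notin> sets M \<Longrightarrow> \<mu> A = 0"
  by (simp add: signed_measures_def)

lemma signed_measures_add:
  assumes "\<mu> \<in> signed_measures M" "\<nu> \<in> signed_measures M"
  shows "(\<lambda>A. \<mu> A + \<nu> A) \<in> signed_measures M"
  using assms by (auto simp: signed_measures_def intro!: sums_add)

lemma signed_measures_scale:
  assumes "\<mu> \<in> signed_measures M"
  shows "(\<lambda>A. c * \<mu> A) \<in> signed_measures M"
  using assms by (auto simp: signed_measures_def intro!: sums_mult)

lemma signed_measures_diff:
  assumes "\<mu> \<in> signed_measures M" "\<nu> \<in> signed_measures M"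
  shows "(\<lambda>A. \<mu> A - \<nu> A) \<in> signed_measures M"
  using assms by (auto simp: signed_measures_def intro!: sums_diff)

lemma signed_measures_uminus:
  "\<mu> \<in> signed_measures M \<Longrightarrow> (\<lambda>A. - \<mu> A) \<in> signed_measures M"
  using signed_measures_scale[of \<mu> M "-1"] by simp

lemma signed_measures_Un:
  assumes "\<mu> \<in> signed_measures M" "A \<in> sets M" "B \<in> sets M" "A \<inter> B = {}"
  shows "\<mu> (A \<union> B) = \<mu> A + \<mu> B"
proof -
  have "(\<lambda>i. \<mu> (binaryset A B i)) sums \<mu> (\<Union>i. binaryset A B i)"
    using assms by (intro signed_measures_sums[of _ M])
      (auto simp: range_binaryset_eq disjoint_family_on_def binaryset_def)
  moreover have "(\<lambda>i. \<mu> (binaryset A B i)) sums (\<mu> A + \<mu> B)"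
    using assms by (intro binaryset_sums) (auto simp: signed_measures_empty)
  ultimately show ?thesis
    by (metis UN_binaryset_eq sums_unique2)
qed

lemma signed_measures_Diff:
  assumes "\<mu> \<in> signed_measures M" "A \<in> sets M" "B \<in> sets M" "B \<subseteq> A"
  shows "\<mu> (A - B) = \<mu> A - \<mu> B"
proof -
  have "\<mu> (B \<union> (A - B)) = \<mu> B + \<mu> (A - B)"
    using assms by (intro signed_measures_Un[of _ M]) auto
  moreover have "B \<union> (A - B) = A" using assms by auto
  ultimately show ?thesis by simp
qed

lemma measure_in_signed_measures:
  assumes "finite_measure_on M \<mu>"
  shows "measure \<mu> \<in> signed_measures M"
proof (rule signed_measuresI)
  interpret finite_measure \<mu> using assms by (simp add: finite_measure_on_def)
  have S: "sets \<mu> = sets M" using assms by (simp add: finite_measure_on_def)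
  show "measure \<mu> {} = 0" by simp
  show "(\<lambda>i. measure \<mu> (A i)) sums measure \<mu> (\<Union>i. A i)"
    if "range A \<subseteq> sets M" "disjoint_family A" for A :: "nat \<Rightarrow> 'a set"
    using that S by (intro finite_measure_UNION) auto
  show "measure \<mu> A = 0" if "A \<notin> sets M" for A
    using that S by (simp add: measure_notin_sets)
qed

text \<open>Call a set bad if the values on its measurable subsets are unbounded. Whenever a bad set
  is cut in two, one piece is bad. Cutting repeatedly and keeping a bad piece, one discards disjoint
  sets of value at least 1 in modulus, which contradicts summability.\<close>

lemma signed_measure_bounded:
  assumes \<mu>: "\<mu> \<in> signed_measures M"
  obtains B where "\<And>T. T \<in> sets M \<Longrightarrow> \<bar>\<mu> T\<bar> \<le> B"
proof -
  define bad where "bad S \<longleftrightarrow> S \<in> sets M \<and> (\<forall>B. \<exists>T\<in>sets M. T \<subseteq> S \<and> \<bar>\<mu> T\<bar> > B)" for S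
  have not_bad: "\<exists>B. \<forall>T\<in>sets M. T \<subseteq> S \<longrightarrow> \<bar>\<mu> T\<bar> \<le> B" if "\<not> bad S" "S \<in> sets M" for S
    using that unfolding bad_def by (simp add: not_less)
  have split: "bad T \<or> bad (S - T)" if ST: "bad S" "T \<in> sets M" "T \<subseteq> S" for S T
  proof (rule ccontr)
    assume "\<not> ?thesis"
    then have "\<not> bad T" "\<not> bad (S - T)" by auto
    moreover have sS: "S - T \<in> sets M" using ST by (auto simp: bad_def)
    ultimately obtain B C where "\<forall>U\<in>sets M. U \<subseteq> T \<longrightarrow> \<bar>\<mu> U\<bar> \<le> B"
        "\<forall>U\<in>sets M. U \<subseteq> S - T \<longrightarrow> \<bar>\<mu> U\<bar> \<le> C"
      using not_bad[of T] not_bad[of "S - T"] ST(2) sS by blast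
    then have B: "\<And>U. U \<in> sets M \<Longrightarrow> U \<subseteq> T \<Longrightarrow> \<bar>\<mu> U\<bar> \<le> B"
      and C: "\<And>U. U \<in> sets M \<Longrightarrow> U \<subseteq> S - T \<Longrightarrow> \<bar>\<mu> U\<bar> \<le> C"
      by auto
    obtain U where U: "U \<in> sets M" "U \<subseteq> S" "\<bar>\<mu> U\<bar> > B + C"
      using ST(1) unfolding bad_def by metis
    have "\<mu> U = \<mu> ((U \<inter> T) \<union> (U - T))" by (simp add: Un_Diff_Int Un_commute)
    also have "\<dots> = \<mu> (U \<inter> T) + \<mu> (U - T)"
      using U ST sS sets.Int[of U M T]  by (intro signed_measures_Un[OF \<mu>]) auto
    finally have "\<bar>\<mu> U\<bar> \<le> \<bar>\<mu> (U \<inter> T)\<bar> + \<bar>\<mu> (U - T)\<bar>" by simp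
    also have "\<dots> \<le> B + C" using U ST by (intro add_mono B C) auto
    finally have "\<bar>\<mu> U\<bar> \<le> B + C" .
    with U show False by simp
  qed
  have step: "\<exists>S'. bad S' \<and> S' \<subseteq> S \<and> \<bar>\<mu> (S - S')\<bar> \<ge> 1" if S: "bad S" for S
  proof -
    \<comment> \<open>The excess over \<open>\<bar>\<mu> S\<bar> + 1\<close> makes both
      \<open>T\<close> and \<open>S - T\<close> have modulus at least 1, so either of them may be
      the discarded piece.\<close>
    obtain T where T: "T \<in> sets M" "T \<subseteq> S" "\<bar>\<mu> T\<bar> > \<bar>\<mu> S\<bar> + 1"
      using S unfolding bad_def by metis
    have Ss: "S \<in> sets M" using S by (simp add: bad_def)
    have "\<mu> (S - T) = \<mu> S - \<mu> T"
      using signed_measures_Diff[OF \<mu> Ss T(1,2)] .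
    then have 1: "\<bar>\<mu> (S - T)\<bar> \<ge> 1" "\<bar>\<mu> T\<bar> \<ge> 1" using T(3) by linarith+
    have "S - (S - T) = T" using T by auto
    with split[OF S T(1,2)] 1 T(2) show ?thesis
      by (auto intro: exI[of _ T] exI[of _ "S - T"])
  qed
  show thesis
  proof (cases "bad (space M)")
    case True
    have "\<exists>S. \<forall>n::nat. bad (S n) \<and> (S (Suc n) \<subseteq> S n \<and> \<bar>\<mu> (S n - S (Suc n))\<bar> \<ge> 1)"
    proof (rule dependent_nat_choice)
      show "\<exists>S. bad S" using True ..
    qed (rule step)
    then obtain S :: "nat \<Rightarrow> 'a set" where S: "\<And>n. bad (S n)"
      "\<And>n. S (Suc n) \<subseteq> S n \<and> \<bar>\<mu> (S n - S (Suc n))\<bar> \<ge> 1"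
      by auto
    have dec: "S m \<subseteq> S n" if "n \<le> m" for n m
      using lift_Suc_antimono_le[of S] S(2) that by blast
    have dis: "disjoint_family (\<lambda>n. S n - S (Suc n))"
      unfolding disjoint_family_on_def
    proof (intro ballI impI)
      fix m n :: nat assume "m \<noteq> n"
      then have "Suc m \<le> n \<or> Suc n \<le> m" by linarith
      then show "(S m - S (Suc m)) \<inter> (S n - S (Suc n)) = {}"
        using dec[of "Suc m" n] dec[of "Suc n" m] by auto
    qed
    have "summable (\<lambda>n. \<mu> (S n - S (Suc n)))"
      using S(1) by (intro sums_summable[OF signed_measures_sums[OF \<mu> _ dis]]) (auto simp: bad_def)
    then have "(\<lambda>n. \<mu> (S n - S (Suc n))) \<longlonglongrightarrow> 0" by (rule summable_LIMSEQ_zero)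
    from LIMSEQ_D[OF this, of 1] obtain n where "\<bar>\<mu> (S n - S (Suc n))\<bar> < 1" by auto
    with S(2)[of n] show thesis by simp
  next
    case False
    from not_bad[OF False] obtain B where "\<forall>T\<in>sets M. T \<subseteq> space M \<longrightarrow> \<bar>\<mu> T\<bar> \<le> B" by auto
    then show thesis by (intro that[of B]) (auto dest: sets.sets_into_space)
  qed
qed

section \<open>Mass of the positive part and the Jordan decomposition\<close>

definition pos_norm :: "'a measure \<Rightarrow> ('a set \<Rightarrow> real) \<Rightarrow> real" where
  "pos_norm M \<mu> = (SUP T\<in>sets M. \<mu> T)"

lemma signed_measure_bdd_above:
  assumes "\<mu> \<in> signed_measures M" "\<T> \<subseteq> sets M"
  shows "bdd_above (\<mu> ` \<T>)"
proof -
  obtain B where "\<And>T. T \<in> sets M \<Longrightarrow> \<bar>\<mu> T\<bar> \<le> B"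
    by (rule signed_measure_bounded[OF assms(1)]) blast
  then show ?thesis using assms(2) by (intro bdd_aboveI2[of _ _ B]) (auto dest: abs_le_D1)
qed

lemma pos_norm_upper: "\<mu> \<in> signed_measures M \<Longrightarrow> T \<in> sets M \<Longrightarrow> \<mu> T \<le> pos_norm M \<mu>"
  unfolding pos_norm_def by (intro cSUP_upper signed_measure_bdd_above) auto

lemma pos_norm_least: "(\<And>T. T \<in> sets M \<Longrightarrow> \<mu> T \<le> c) \<Longrightarrow> pos_norm M \<mu> \<le> c"
  unfolding pos_norm_def by (intro cSUP_least) auto

lemma pos_norm_nonneg: "\<mu> \<in> signed_measures M \<Longrightarrow> 0 \<le> pos_norm M \<mu>"
  using pos_norm_upper[of \<mu> M "{}"] by (simp add: signed_measures_empty)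

lemma pos_norm_add:
  assumes "\<mu> \<in> signed_measures M" "\<nu> \<in> signed_measures M"
  shows "pos_norm M (\<lambda>A. \<mu> A + \<nu> A) \<le> pos_norm M \<mu> + pos_norm M \<nu>"
  by (intro pos_norm_least add_mono pos_norm_upper assms)

lemma pos_norm_scale:
  assumes "\<mu> \<in> signed_measures M" "0 \<le> c"
  shows "pos_norm M (\<lambda>A. c * \<mu> A) \<le> c * pos_norm M \<mu>"
  by (intro pos_norm_least mult_left_mono pos_norm_upper assms)

lemma nonneg_signed_measure:
  assumes \<mu>: "\<mu> \<in> signed_measures M" and nn: "\<And>A. A \<in> sets M \<Longrightarrow> 0 \<le> \<mu> A"
  obtains \<alpha> where "finite_measure_on M \<alpha>" "measure \<alpha> = \<mu>"
proof -
  define \<alpha> where "\<alpha> = measure_of (space M) (sets M) (\<lambda>A. ennreal (\<mu> A))"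
  have em: "emeasure \<alpha> A = ennreal (\<mu> A)" if "A \<in> sets M" for A
    unfolding \<alpha>_def
  proof (rule emeasure_measure_of_sigma[OF sets.sigma_algebra_axioms _ _ that])
    show "positive (sets M) (\<lambda>A. ennreal (\<mu> A))"
      using signed_measures_empty[OF \<mu>] by (simp add: positive_def)
    show "countably_additive (sets M) (\<lambda>A. ennreal (\<mu> A))"
    proof (rule countably_additiveI)
      fix A :: "nat \<Rightarrow> 'a set" assume A: "range A \<subseteq> sets M" "disjoint_family A"
      have "(\<lambda>i. \<mu> (A i)) sums \<mu> (\<Union>i. A i)" using \<mu> A by (rule signed_measures_sums)
      then show "(\<Sum>i. ennreal (\<mu> (A i))) = ennreal (\<mu> (\<Union>i. A i))"
        using A nn by (subst suminf_ennreal2) (auto simp: sums_iff)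
    qed
  qed
  have sets: "sets \<alpha> = sets M" by (simp add: \<alpha>_def)
  have "measure \<alpha> A = \<mu> A" for A
    using em[of A] nn[of A] signed_measures_outside[OF \<mu>, of A] sets
    by (cases "A \<in> sets M") (auto simp: measure_def emeasure_notin_sets)
  moreover have "finite_measure \<alpha>"
    using em[of "space M"] sets_eq_imp_space_eq[OF sets] by (intro finite_measureI) simp
  ultimately show thesis using that[of \<alpha>] sets by (auto simp: finite_measure_on_def)
qed

text \<open>The positive part \<open>P\<close> of a set is the supremum of \<mu> over its measurable
  subsets. Joining subsets of disjoint sets makes \<open>P\<close> superadditive, which gives one
  half of countable additivity; cutting a subset of a union along the pieces gives the other. The
  negative part is \<open>P - \<mu>\<close>.\<close>

theorem jordan_decomposition:
  assumes \<mu>: "\<mu> \<in> signed_measures M"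
  obtains \<alpha> \<beta> where "finite_measure_on M \<alpha>" "finite_measure_on M \<beta>"
    "\<mu> = (\<lambda>A. measure \<alpha> A - measure \<beta> A)"
    "measure \<alpha> (space M) \<le> pos_norm M \<mu>" "measure \<beta> (space M) \<le> pos_norm M (\<lambda>A. - \<mu> A)"
proof -
  define P where "P S = (if S \<in> sets M then (SUP T\<in>{T\<in>sets M. T \<subseteq> S}. \<mu> T) else 0)" for S
  have upper: "\<mu> T \<le> P S" if "S \<in> sets M" "T \<in> sets M" "T \<subseteq> S" for S T
    using that unfolding P_def by (auto intro!: cSUP_upper signed_measure_bdd_above[OF \<mu>])
  have least: "P S \<le> c" if "S \<in> sets M" "\<And>T. T \<in> sets M \<Longrightarrow> T \<subseteq> S \<Longrightarrow> \<mu> T \<le> c" for S c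
    using that unfolding P_def by (auto intro!: cSUP_least)
  have nn: "0 \<le> P S" if "S \<in> sets M" for S
    using upper[OF that, of "{}"] signed_measures_empty[OF \<mu>] by simp
  have P0: "P {} = 0" using least[of "{}" 0] nn[of "{}"] signed_measures_empty[OF \<mu>] by force
  have mono: "P S \<le> P S'" if "S \<in> sets M" "S' \<in> sets M" "S \<subseteq> S'" for S S'
    using that by (intro least upper) auto
  have super: "P A + P B \<le> P (A \<union> B)" if AB: "A \<in> sets M" "B \<in> sets M" "A \<inter> B = {}" for A B
  proof -
    have "P A \<le> P (A \<union> B) - P B"
    proof (rule least)
      fix T assume T: "T \<in> sets M" "T \<subseteq> A"
      have "P B \<le> P (A \<union> B) - \<mu> T"
      proof (rule least)
        fix T' assume T': "T' \<in> sets M" "T' \<subseteq> B"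
        have "\<mu> T + \<mu> T' = \<mu> (T \<union> T')"
          using T T' AB by (intro signed_measures_Un[OF \<mu>, symmetric]) auto
        also have "\<dots> \<le> P (A \<union> B)" using T T' AB by (intro upper) auto
        finally show "\<mu> T' \<le> P (A \<union> B) - \<mu> T" by simp
      qed (use AB in auto)
      then show "\<mu> T \<le> P (A \<union> B) - P B" by simp
    qed (use AB in auto)
    then show ?thesis by simp
  qed
  have P: "P \<in> signed_measures M"
  proof (rule signed_measuresI)
    fix A :: "nat \<Rightarrow> 'a set" assume A: "range A \<subseteq> sets M" "disjoint_family A"
    have part: "(\<Sum>i<n. P (A i)) \<le> P (\<Union>i<n. A i)" for n
    proof (induction n)
      case (Suc n)
      have "(\<Union>i<n. A i) \<inter> A n = {}"
        using disjoint_family_onD[OF A(2), of _ n] by (blast dest: less_imp_neq)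
      then have "P (\<Union>i<n. A i) + P (A n) \<le> P ((\<Union>i<n. A i) \<union> A n)"
        using A by (intro super) auto
      moreover have "(\<Union>i<n. A i) \<union> A n = (\<Union>i<Suc n. A i)" by (simp add: lessThan_Suc Un_commute)
      ultimately show ?case using Suc by simp
    qed (simp add: P0)
    have part': "(\<Sum>i<n. P (A i)) \<le> P (\<Union>i. A i)" for n
      by (rule order_trans[OF part mono]) (use A in auto)
    have summ: "summable (\<lambda>i. P (A i))"
      using A part' by (intro summableI_nonneg_bounded nn) auto
    have "P (\<Union>i. A i) \<le> (\<Sum>i. P (A i))"
    proof (rule least)
      fix T assume T: "T \<in> sets M" "T \<subseteq> (\<Union>i. A i)"
      have "(\<lambda>i. \<mu> (T \<inter> A i)) sums \<mu> (\<Union>i. T \<inter> A i)"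
        using A T by (intro signed_measures_sums[OF \<mu>]) (auto simp: disjoint_family_on_def)
      moreover have "(\<Union>i. T \<inter> A i) = T" using T by auto
      ultimately have "(\<lambda>i. \<mu> (T \<inter> A i)) sums \<mu> T" by simp
      then show "\<mu> T \<le> (\<Sum>i. P (A i))"
        using T subsetD[OF A(1)]
        by (intro sums_le[OF _ _ summable_sums[OF summ]]) (auto intro!: upper)
    qed (use A in auto)
    moreover have "(\<Sum>i. P (A i)) \<le> P (\<Union>i. A i)"
      using summ part' by (intro suminf_le_const)
    ultimately show "(\<lambda>i. P (A i)) sums P (\<Union>i. A i)" using summ by (simp add: sums_iff)
  qed (simp_all add: P0, simp add: P_def)
  obtain \<alpha> where \<alpha>: "finite_measure_on M \<alpha>" "measure \<alpha> = P"
    using nonneg_signed_measure[OF P nn] by blast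
  have "(\<lambda>A. P A - \<mu> A) \<in> signed_measures M" using P \<mu> by (rule signed_measures_diff)
  then obtain \<beta> where \<beta>: "finite_measure_on M \<beta>" "measure \<beta> = (\<lambda>A. P A - \<mu> A)"
    by (rule nonneg_signed_measure) (use upper in auto)
  show thesis
  proof (rule that[OF \<alpha>(1) \<beta>(1)])
    show "\<mu> = (\<lambda>A. measure \<alpha> A - measure \<beta> A)" by (simp add: \<alpha> \<beta>)
    show "measure \<alpha> (space M) \<le> pos_norm M \<mu>"
      unfolding \<alpha> by (intro least pos_norm_upper \<mu>) auto
    \<comment> \<open>The mass of the negative part is \<open>P (space M) - \<mu> (space M)\<close>;
      passing from \<open>T\<close> to its complement turns it into a supremum of
      \<open>- \<mu>\<close>.\<close>
    have "P (space M) \<le> pos_norm M (\<lambda>A. - \<mu> A) + \<mu> (space M)"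
    proof (rule least)
      fix T assume T: "T \<in> sets M" "T \<subseteq> space M"
      have "\<mu> T - \<mu> (space M) = - \<mu> (space M - T)"
        using signed_measures_Diff[OF \<mu> sets.top T] by simp
      also have "\<dots> \<le> pos_norm M (\<lambda>A. - \<mu> A)"
        using T pos_norm_upper[OF signed_measures_uminus[OF \<mu>], of "space M - T"] by auto
      finally show "\<mu> T \<le> pos_norm M (\<lambda>A. - \<mu> A) + \<mu> (space M)" by simp
    qed simp
    then show "measure \<beta> (space M) \<le> pos_norm M (\<lambda>A. - \<mu> A)" by (simp add: \<beta>)
  qed
qed

lemma pos_norm_le_total_variation:
  assumes \<mu>: "\<mu> \<in> signed_measures M"
  shows "ereal (pos_norm M \<mu>) \<le> total_variation M (\<lambda>A. ereal (\<mu> A))"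
proof -
  have *: "ereal \<bar>\<mu> T\<bar> \<le> total_variation M (\<lambda>A. ereal (\<mu> A))" if T: "T \<in> sets M" for T
  proof -
    \<comment> \<open>Blocks of a partition must be nonempty, so the empty set is removed for the
      cases where \<open>T\<close> is empty or the whole space.\<close>
    let ?P = "{T, space M - T} - {{}}"
    have P: "?P \<in> {P. finite P \<and> P \<subseteq> sets M \<and> partition_on (space M) P}"
      using T sets.sets_into_space[OF T] by (auto simp: partition_on_def disjoint_def)
    have "ereal \<bar>\<mu> T\<bar> \<le> (\<Sum>A\<in>?P. \<bar>ereal (\<mu> A)\<bar>)"
    proof (cases "T = {}")
      case False
      have "(\<Sum>A\<in>{T}. \<bar>ereal (\<mu> A)\<bar>) \<le> (\<Sum>A\<in>?P. \<bar>ereal (\<mu> A)\<bar>)"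
        using False by (intro sum_mono2) auto
      then show ?thesis by simp
    qed (auto simp: signed_measures_empty[OF \<mu>] intro!: sum_nonneg)
    also have "\<dots> \<le> total_variation M (\<lambda>A. ereal (\<mu> A))"
      unfolding total_variation_def using P by (intro SUP_upper)
    finally show ?thesis .
  qed
  have 0: "0 \<le> total_variation M (\<lambda>A. ereal (\<mu> A))"
    using *[of "{}"] by (simp add: signed_measures_empty[OF \<mu>] zero_ereal_def)
  show ?thesis
  proof (cases "total_variation M (\<lambda>A. ereal (\<mu> A))")
    case (real r)
    have "pos_norm M \<mu> \<le> r"
    proof (rule pos_norm_least)
      fix T assume "T \<in> sets M"
      then show "\<mu> T \<le> r" using *[of T] real by simp
    qed
    then show ?thesis using real by simp
  qed (use 0 in auto)
qed

lemma total_variation_measure_le: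
  assumes "finite_measure_on M \<alpha>"
  shows "total_variation M (\<lambda>A. ereal (measure \<alpha> A)) \<le> ereal (measure \<alpha> (space M))"
  unfolding total_variation_def
proof (rule SUP_least, clarify)
  interpret finite_measure \<alpha> using assms by (simp add: finite_measure_on_def)
  fix P assume P: "finite P" "P \<subseteq> sets M" "partition_on (space M) P"
  have "(\<Sum>A\<in>P. \<bar>ereal (measure \<alpha> A)\<bar>) = ereal (\<Sum>A\<in>P. measure \<alpha> A)" by simp
  also have "(\<Sum>A\<in>P. measure \<alpha> A) = measure \<alpha> (\<Union>A\<in>P. A)"
    using P assms by (intro finite_measure_finite_Union[symmetric])
      (auto simp: finite_measure_on_def partition_on_def disjoint_def disjoint_family_on_def)
  also have "(\<Union>A\<in>P. A) = space M" using P by (auto simp: partition_on_def)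
  finally show "(\<Sum>A\<in>P. \<bar>ereal (measure \<alpha> A)\<bar>) \<le> ereal (measure \<alpha> (space M))" by simp
qed

section \<open>The Hahn-Banach theorem for sublinear functionals\<close>

text \<open>Homogeneity is stated as an inequality for positive factors, which is the form that
  passes to infima; on a space closed under scaling, equality follows by using the inverse
  factor.\<close>

definition sublinear_on :: "('i \<Rightarrow> real) set \<Rightarrow> (('i \<Rightarrow> real) \<Rightarrow> real) \<Rightarrow> bool" where
  "sublinear_on V p \<longleftrightarrow>
     (\<forall>u\<in>V. \<forall>v\<in>V. p (\<lambda>i. u i + v i) \<le> p u + p v) \<and>
     (\<forall>v\<in>V. \<forall>c>0. p (\<lambda>i. c * v i) \<le> c * p v)"

lemma sublinear_on_add_le:
  "sublinear_on V p \<Longrightarrow> u \<in> V \<Longrightarrow> v \<in> V \<Longrightarrow> p (\<lambda>i. u i + v i) \<le> p u + p v"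
  by (simp add: sublinear_on_def)

lemma sublinear_on_scale:
  assumes p: "sublinear_on V p" and V: "\<And>v c. v \<in> V \<Longrightarrow> (\<lambda>i. c * v i) \<in> V"
    and "v \<in> V" "0 < c"
  shows "p (\<lambda>i. c * v i) = c * p v"
proof (rule antisym)
  show "p (\<lambda>i. c * v i) \<le> c * p v" using p assms(3,4) by (auto simp: sublinear_on_def)
  have "p (\<lambda>i. inverse c * (c * v i)) \<le> inverse c * p (\<lambda>i. c * v i)"
    using p assms(4) V[OF assms(3), of c] by (simp add: sublinear_on_def)
  then show "c * p v \<le> p (\<lambda>i. c * v i)"
    using assms(4) by (simp add: field_simps)
qed

lemma sublinear_on_zero:
  assumes p: "sublinear_on V p" and V: "\<And>v c. v \<in> V \<Longrightarrow> (\<lambda>i. c * v i) \<in> V" and 0: "(\<lambda>i. 0) \<in> V"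
  shows "p (\<lambda>i. 0) = 0"
  using sublinear_on_scale[OF p V 0, of 2] by simp

text \<open>A pointwise minimal sublinear functional \<open>p\<close> is linear, because
  \<open>v \<mapsto> inf\<^sub>t (p (v + t w) - t p w)\<close> is again sublinear and below \<open>p\<close>.\<close>

theorem hahn_banach_sublinear:
  fixes V :: "('i \<Rightarrow> real) set"
  assumes V0: "(\<lambda>i. 0) \<in> V"
    and Vadd: "\<And>u v. u \<in> V \<Longrightarrow> v \<in> V \<Longrightarrow> (\<lambda>i. u i + v i) \<in> V"
    and Vscale: "\<And>v c. v \<in> V \<Longrightarrow> (\<lambda>i. c * v i) \<in> V"
    and q: "sublinear_on V q"
  shows "\<exists>D. (\<forall>u\<in>V. \<forall>v\<in>V. D (\<lambda>i. u i + v i) = D u + D v) \<and>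
    (\<forall>v\<in>V. \<forall>c. D (\<lambda>i. c * v i) = c * D v) \<and> (\<forall>v\<in>V. D v \<le> q v)"
proof -
  \<comment> \<open>Fixing the value 0 outside \<open>V\<close> makes the pointwise order of total
    functions agree with the order on \<open>V\<close>, so minimality can conclude with an equation
    between functions.\<close>
  define \<S> where "\<S> = {p. sublinear_on V p \<and> (\<forall>v\<in>V. p v \<le> q v) \<and> (\<forall>v. v \<notin> V \<longrightarrow> p v = 0)}"
  have neg: "(\<lambda>i. - v i) \<in> V" if "v \<in> V" for v
    using Vscale[OF that, of "-1"] by simp
  \<comment> \<open>From \<open>0 = p (v - v) \<le> p v + p (- v)\<close>: one lower bound serves
    all members of \<open>\<S>\<close>, so infima over chains are finite.\<close>
  have lower: "- q (\<lambda>i. - v i) \<le> p v" if "p \<in> \<S>" "v \<in> V" for p v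
  proof -
    have p: "sublinear_on V p" "p (\<lambda>i. - v i) \<le> q (\<lambda>i. - v i)"
      using that neg by (auto simp: \<S>_def)
    have "p (\<lambda>i. v i + - v i) \<le> p v + p (\<lambda>i. - v i)"
      using that neg by (intro sublinear_on_add_le[OF p(1)])
    then show ?thesis using p sublinear_on_zero[OF p(1) Vscale V0] by simp
  qed
  \<comment> \<open>Zorn's lemma for the reversed order: every chain has its pointwise infimum as a
    lower bound, and the maximal element obtained is a minimal functional.\<close>
  have "\<exists>p\<in>\<S>. \<forall>p'\<in>\<S>. p' \<le> p \<longrightarrow> p' = p"
  proof (rule predicate_Zorn[of \<S> "\<lambda>p p'. p' \<le> p", THEN bexE])
    show "partial_order_on \<S> (relation_of (\<lambda>p p'. p' \<le> p) \<S>)"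
      by (rule partial_order_on_relation_ofI) auto
    fix C assume C: "C \<in> Chains (relation_of (\<lambda>p p'. p' \<le> p) \<S>)"
    have CS: "C \<subseteq> \<S>" using C by (auto simp: Chains_def relation_of_def)
    show "\<exists>u\<in>\<S>. \<forall>p\<in>C. u \<le> p"
    proof (cases "C = {}")
      case True
      have "(\<lambda>v. if v \<in> V then q v else 0) \<in> \<S>"
        using q Vadd Vscale by (auto simp: \<S>_def sublinear_on_def)
      with True show ?thesis by blast
    next
      case False
      define u where "u v = (if v \<in> V then INF p\<in>C. p v else 0)" for v
      have bdd: "bdd_below ((\<lambda>p. p v) ` C)" if "v \<in> V" for v
        using lower[OF _ that] CS by (intro bdd_belowI2[of _ "- q (\<lambda>i. - v i)"]) auto
      have u_le: "u v \<le> p v" if "p \<in> C" for p v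
        using that CS bdd by (auto simp: u_def \<S>_def intro!: cINF_lower)
      have u_ge: "c \<le> u v" if "\<And>p. p \<in> C \<Longrightarrow> c \<le> p v" "v \<in> V" for c v
        using that False by (auto simp: u_def intro!: cINF_greatest)
      have "u (\<lambda>i. v i + w i) \<le> u v + u w" if vw: "v \<in> V" "w \<in> V" for v w
      proof -
        have "u (\<lambda>i. v i + w i) - p v \<le> u w" if p: "p \<in> C" for p
        proof (rule u_ge)
          fix p' assume p': "p' \<in> C"
          \<comment> \<open>Subadditivity relates values of a single functional, so the two chain
            members are replaced by the smaller of them.\<close>
          have "p \<le> p' \<or> p' \<le> p" using C p p' by (auto simp: Chains_def relation_of_def)
          then obtain r where r: "r \<in> C" "r \<le> p" "r \<le> p'" using p p' by blast
          have "u (\<lambda>i. v i + w i) \<le> r (\<lambda>i. v i + w i)" using r by (intro u_le)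
          also have "\<dots> \<le> r v + r w" using r CS vw by (auto simp: \<S>_def sublinear_on_def)
          also have "\<dots> \<le> p v + p' w" using r by (intro add_mono) (auto dest: le_funD)
          finally show "u (\<lambda>i. v i + w i) - p v \<le> p' w" by simp
        qed fact
        then have "u (\<lambda>i. v i + w i) - u w \<le> u v"
          using vw by (intro u_ge) (auto simp: algebra_simps)
        then show ?thesis by simp
      qed
      moreover have "u (\<lambda>i. c * v i) \<le> c * u v" if vc: "v \<in> V" "c > 0" for v c
      proof -
        have "u (\<lambda>i. c * v i) / c \<le> u v"
        proof (rule u_ge)
          fix p assume p: "p \<in> C"
          have "u (\<lambda>i. c * v i) \<le> p (\<lambda>i. c * v i)" using p by (rule u_le)
          also have "\<dots> \<le> c * p v" using p CS vc by (auto simp: \<S>_def sublinear_on_def)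
          finally show "u (\<lambda>i. c * v i) / c \<le> p v" using vc by (simp add: field_simps)
        qed fact
        then show ?thesis using vc by (simp add: field_simps)
      qed
      moreover have "u v \<le> q v" if "v \<in> V" for v
      proof -
        obtain p where p: "p \<in> C" using False by blast
        then have "u v \<le> p v" by (rule u_le)
        also have "\<dots> \<le> q v" using p CS that by (auto simp: \<S>_def)
        finally show ?thesis .
      qed
      ultimately have "u \<in> \<S>" by (auto simp: \<S>_def sublinear_on_def u_def)
      then show ?thesis using u_le by (auto simp: le_fun_def)
    qed
  qed auto
  then obtain D where D: "D \<in> \<S>" and Dmin: "\<And>p. p \<in> \<S> \<Longrightarrow> p \<le> D \<Longrightarrow> p = D" by blast
  have sub: "sublinear_on V D" and Dq: "\<And>v. v \<in> V \<Longrightarrow> D v \<le> q v" using D by (auto simp: \<S>_def)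
  have Dadd: "D (\<lambda>i. u i + v i) \<le> D u + D v" if "u \<in> V" "v \<in> V" for u v
    using sub that by (auto simp: sublinear_on_def)
  have Dscale: "D (\<lambda>i. c * v i) = c * D v" if "v \<in> V" "0 \<le> c" for v c
    using sublinear_on_scale[OF sub Vscale that(1), of c] sublinear_on_zero[OF sub Vscale V0] that
    by (cases "c = 0") auto
  have super: "D v + D w \<le> D (\<lambda>i. v i + w i)" if v: "v \<in> V" and w: "w \<in> V" for v w
  proof -
    define p where "p u = (if u \<in> V then INF t\<in>{0..}. D (\<lambda>i. u i + t * w i) - t * D w else 0)" for u
    have bdd: "bdd_below ((\<lambda>t. D (\<lambda>i. u i + t * w i) - t * D w) ` {0..})" if u: "u \<in> V" for u
    proof (rule bdd_belowI2)
      fix t :: real assume t: "t \<in> {0..}"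
      have "D (\<lambda>i. (u i + t * w i) + - u i) \<le> D (\<lambda>i. u i + t * w i) + D (\<lambda>i. - u i)"
        using u w by (intro Dadd Vadd Vscale neg)
      then show "- D (\<lambda>i. - u i) \<le> D (\<lambda>i. u i + t * w i) - t * D w"
        using Dscale[OF w, of t] t by simp
    qed
    have p_le: "p u \<le> D (\<lambda>i. u i + t * w i) - t * D w" if "u \<in> V" "0 \<le> t" for u t
      using that bdd by (auto simp: p_def intro!: cINF_lower)
    have p_ge: "c \<le> p u" if "\<And>t. 0 \<le> t \<Longrightarrow> c \<le> D (\<lambda>i. u i + t * w i) - t * D w" "u \<in> V" for c u
      using that by (auto simp: p_def intro!: cINF_greatest)
    have pD: "p u \<le> D u" if "u \<in> V" for u using p_le[OF that, of 0] by simp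
    have "p (\<lambda>i. x i + y i) \<le> p x + p y" if xy: "x \<in> V" "y \<in> V" for x y
    proof -
      have "p (\<lambda>i. x i + y i) - (D (\<lambda>i. x i + s * w i) - s * D w) \<le> p y" if s: "0 \<le> s" for s
      proof (rule p_ge)
        fix t :: real assume t: "0 \<le> t"
        have "p (\<lambda>i. x i + y i) \<le> D (\<lambda>i. (x i + y i) + (s + t) * w i) - (s + t) * D w"
          using xy s t by (intro p_le Vadd) auto
        also have "(\<lambda>i. (x i + y i) + (s + t) * w i) = (\<lambda>i. (x i + s * w i) + (y i + t * w i))"
          by (auto simp: algebra_simps)
        also have "D \<dots> \<le> D (\<lambda>i. x i + s * w i) + D (\<lambda>i. y i + t * w i)"
          using xy w by (intro Dadd Vadd Vscale)
        finally show "p (\<lambda>i. x i + y i) - (D (\<lambda>i. x i + s * w i) - s * D w)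
            \<le> D (\<lambda>i. y i + t * w i) - t * D w" by (simp add: algebra_simps)
      qed fact
      then have "p (\<lambda>i. x i + y i) - p y \<le> p x"
        using xy by (intro p_ge) (auto simp: algebra_simps)
      then show ?thesis by simp
    qed
    moreover have "p (\<lambda>i. c * x i) \<le> c * p x" if xc: "x \<in> V" "c > 0" for x c
    proof -
      have "p (\<lambda>i. c * x i) / c \<le> p x"
      proof (rule p_ge)
        fix t :: real assume t: "0 \<le> t"
        have "p (\<lambda>i. c * x i) \<le> D (\<lambda>i. c * x i + (c * t) * w i) - (c * t) * D w"
          using xc t by (intro p_le Vscale) auto
        also have "(\<lambda>i. c * x i + (c * t) * w i) = (\<lambda>i. c * (x i + t * w i))"
          by (auto simp: algebra_simps)
        also have "D \<dots> = c * D (\<lambda>i. x i + t * w i)"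
          using xc w by (intro Dscale Vadd Vscale) auto
        finally show "p (\<lambda>i. c * x i) / c \<le> D (\<lambda>i. x i + t * w i) - t * D w"
          using xc by (simp add: field_simps)
      qed fact
      then show ?thesis using xc by (simp add: field_simps)
    qed
    moreover have "p u \<le> q u" if "u \<in> V" for u using pD[OF that] Dq[OF that] by simp
    ultimately have "p \<in> \<S>" by (auto simp: \<S>_def sublinear_on_def p_def)
    moreover have "p \<le> D" using pD D by (auto simp: le_fun_def p_def \<S>_def)
    ultimately have "p = D" by (rule Dmin)
    \<comment> \<open>With \<open>t = 1\<close> and \<open>p = D\<close> the bound reads
      \<open>D v \<le> D (v + w) - D w\<close>.\<close>
    with p_le[OF v, of 1] show ?thesis by simp
  qed
  have add: "D (\<lambda>i. u i + v i) = D u + D v" if "u \<in> V" "v \<in> V" for u v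
    using Dadd[OF that] super[OF that] by simp
  have "D (\<lambda>i. c * v i) = c * D v" if v: "v \<in> V" for v c
  proof (cases "0 \<le> c")
    case False
    have "D (\<lambda>i. c * v i + (- c) * v i) = D (\<lambda>i. c * v i) + D (\<lambda>i. (- c) * v i)"
      using v by (intro add Vscale)
    then show ?thesis
      using Dscale[OF v, of "- c"] False sublinear_on_zero[OF sub Vscale V0] by simp
  qed (use Dscale v in auto)
  with add Dq show ?thesis by blast
qed

section \<open>Noise outsourcing on standard Borel spaces\<close>

definition ternary :: "(nat \<Rightarrow> bool) \<Rightarrow> real" where
  "ternary b = (\<Sum>k. of_bool (b k) * (1/3) ^ Suc k)"

definition ternary_digit :: "nat \<Rightarrow> real \<Rightarrow> bool" where
  "ternary_digit k t \<longleftrightarrow> \<lfloor>3 ^ Suc k * t\<rfloor> mod 3 = 1"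

lemma summable_ternary: "summable (\<lambda>k. of_bool (b k) * (1/3 :: real) ^ Suc k)"
proof (rule summable_comparison_test')
  show "summable (\<lambda>k. (1/3 :: real) ^ Suc k)"
    by (subst summable_Suc_iff) (rule summable_geometric, simp)
  show "norm (of_bool (b n) * (1/3 :: real) ^ Suc n) \<le> (1/3) ^ Suc n" for n by simp
qed

text \<open>Using base 3 with digits 0 and 1 only, the series is at most 1/2. A tail therefore never
  carries into the preceding digit, and floors recover the digits without the ambiguity of binary
  expansions.\<close>

lemma ternary_bounds: "0 \<le> ternary b" "ternary b < 1"
proof -
  show "0 \<le> ternary b" unfolding ternary_def by (intro suminf_nonneg summable_ternary) simp
  have s: "(\<lambda>k. 1/3 * (1/3 :: real) ^ k) sums (1/3 * (1 / (1 - 1/3)))"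
    by (intro sums_mult geometric_sums) simp
  have "ternary b \<le> (\<Sum>k. 1/3 * (1/3 :: real) ^ k)" unfolding ternary_def
    by (intro suminf_le summable_ternary sums_summable[OF s]) simp
  also have "\<dots> = 1/2" using sums_unique[OF s] by simp
  finally show "ternary b < 1" by simp
qed

lemma ternary_shift: "3 * ternary b = of_bool (b 0) + ternary (\<lambda>k. b (Suc k))"
proof -
  have "ternary b = (\<Sum>k. of_bool (b (Suc k)) * (1/3) ^ Suc (Suc k)) + of_bool (b 0) * (1/3) ^ Suc 0"
    unfolding ternary_def using suminf_split_head[OF summable_ternary[of b]] by simp
  also have "(\<Sum>k. of_bool (b (Suc k)) * (1/3 :: real) ^ Suc (Suc k)) = 1/3 * ternary (\<lambda>k. b (Suc k))"
    unfolding ternary_def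
    by (subst suminf_mult[OF summable_ternary, symmetric]) (simp add: mult_ac)
  finally show ?thesis by simp
qed

lemma ternary_digit_ternary: "ternary_digit k (ternary b) \<longleftrightarrow> b k"
proof (induction k arbitrary: b)
  case 0
  have "\<lfloor>3 * ternary b\<rfloor> = of_bool (b 0)"
    using ternary_bounds[of "\<lambda>k. b (Suc k)"]
    by (subst ternary_shift, cases "b 0") (simp_all add: floor_eq_iff)
  then show ?case by (simp add: ternary_digit_def)
next
  case (Suc k)
  \<comment> \<open>Removing the leading digit changes the scaled number by an integer multiple of
    3, which is invisible modulo 3.\<close>
  have "3 ^ Suc (Suc k) * ternary b = of_int (3 * (3 ^ k * of_bool (b 0))) + 3 ^ Suc k * ternary (\<lambda>k. b (Suc k))"
    using arg_cong[OF ternary_shift[of b], of "\<lambda>x. 3 ^ Suc k * x"] by (simp add: algebra_simps)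
  then have "\<lfloor>3 ^ Suc (Suc k) * ternary b\<rfloor> mod 3 = \<lfloor>3 ^ Suc k * ternary (\<lambda>k. b (Suc k))\<rfloor> mod 3"
    by (simp only: floor_add_int[symmetric] add.commute[of "of_int _"]) simp
  with Suc[of "\<lambda>k. b (Suc k)"] show ?case by (simp add: ternary_digit_def)
qed

lemma measurable_ternary_digit[measurable]: "ternary_digit k \<in> measurable borel (count_space UNIV)"
  unfolding ternary_digit_def by measurable

text \<open>Lets the distance from a decoded point to a fixed point be written as a limit of real
  functions, which is how its measurability is obtained.\<close>

lemma (in Metric_space) limitin_dist_tendsto:
  assumes l: "limitin mtopology s l sequentially" and s: "\<And>n. s n \<in> M" and a: "a \<in> M"
  shows "(\<lambda>n. d (s n) a) \<longlonglongrightarrow> d l a"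
proof (rule LIM_zero_cancel)
  have lM: "l \<in> M" and 0: "(\<lambda>n. d (s n) l) \<longlonglongrightarrow> 0"
    using l by (auto simp: limitin_metric_dist_null)
  have "\<bar>d (s n) a - d l a\<bar> \<le> d (s n) l" for n
    using triangle[OF s[of n] lM a] triangle[OF lM s[of n] a] commute[of l "s n"] by linarith
  then show "(\<lambda>n. d (s n) a - d l a) \<longlonglongrightarrow> 0"
    by (intro tendsto_rabs_zero_cancel[OF tendsto_sandwich[OF _ _ tendsto_const 0]]) auto
qed

text \<open>A point is coded by the real number whose ternary digits record which of the balls of radius
  \<open>1/(n+1)\<close> around the points of a dense sequence contain it. Completeness makes the decoding a
  total measurable map, so that measurability of the range of the code is never needed.\<close>

theorem standard_borel_retract:
  fixes M :: "'a measure"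
  assumes sb: "standard_borel M" and ne: "space M \<noteq> {}"
  shows "\<exists>(f :: 'a \<Rightarrow> real) g. f \<in> borel_measurable M \<and> g \<in> measurable borel M \<and> (\<forall>x\<in>space M. g (f x) = x)"
proof -
  obtain X where X: "completely_metrizable_space X" "separable_space X" "topspace X = space M"
    and setsM: "sets M = sigma_sets (space M) {U. openin X U}"
    using sb by (auto simp: standard_borel_def)
  obtain S d where "Metric_space S d" and mc: "Metric_space.mcomplete S d"
    and Xd: "X = Metric_space.mtopology S d"
    using X(1) by (auto simp: completely_metrizable_space_def)
  interpret Metric_space S d by fact
  have S: "S = space M" using X(3) Xd by simp
  obtain C where C: "countable C" "C \<subseteq> S" "mtopology closure_of C = S"
    using X(2) Xd by (auto simp: separable_space_def)
  have "C \<noteq> {}" using C(3) ne S by auto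
  define e where "e = from_nat_into C"
  have eS: "e i \<in> S" for i using from_nat_into[OF \<open>C \<noteq> {}\<close>] C(2) by (auto simp: e_def)
  have dense: "\<exists>i. d (e i) x < r" if "x \<in> S" "r > 0" for x r
  proof -
    have "x \<in> mtopology closure_of C" using that C(3) by simp
    then have "\<exists>y\<in>C. y \<in> mball x r" using \<open>r > 0\<close> unfolding metric_closure_of by blast
    then obtain y where "y \<in> C" "d x y < r" by auto
    then show ?thesis using from_nat_into_surj[OF C(1)] by (metis commute e_def)
  qed
  define B where "B n i = mball (e i) (1 / real (Suc n))" for n i
  have openM: "U \<in> sets M" if "openin X U" for U
    unfolding setsM using that by (auto intro: sigma_sets.Basic)
  have B[measurable]: "B n i \<in> sets M" for n i
    unfolding B_def by (intro openM) (simp add: Xd)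
  define f where "f x = ternary (\<lambda>k. x \<in> B (fst (prod_decode k)) (snd (prod_decode k)))" for x
  have f: "f \<in> borel_measurable M"
    unfolding f_def ternary_def of_bool_def by measurable
  \<comment> \<open>The first dense point whose ball of radius \<open>1 / (n + 1)\<close> is
    recorded in \<open>t\<close>. If no digit is set the index is unspecified; \<open>good\<close>
    guards against nonsense sequences.\<close>
  define c where "c n t = (LEAST i. ternary_digit (prod_encode (n, i)) t)" for n t
  have c[measurable]: "c n \<in> measurable borel (count_space UNIV)" for n
    unfolding c_def by measurable
  \<comment> \<open>An explicit Cauchy rate is a countable conjunction of measurable conditions, and
    it is exactly what two balls with a common point guarantee.\<close>
  define good where "good t \<longleftrightarrow> (\<forall>n m. d (e (c n t)) (e (c m t)) \<le> 1 / real (Suc n) + 1 / real (Suc m))" for t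
  have [measurable]: "(\<lambda>t. d (e (c n t)) a) \<in> borel_measurable borel" for n a
    by (rule measurable_compose[OF c]) simp
  have [measurable]: "(\<lambda>t. d (e (c n t)) (e (c m t))) \<in> borel_measurable borel" for n m
    by (rule measurable_compose_countable[OF _ c]) measurable
  have good[measurable]: "good \<in> measurable borel (count_space UNIV)"
    unfolding good_def by measurable
  \<comment> \<open>Codes that fail the test are sent to the fixed point \<open>e 0\<close>, which
    makes decoding total.\<close>
  define g where "g t = (if good t then SOME l. limitin mtopology (\<lambda>n. e (c n t)) l sequentially else e 0)" for t
  have lim: "limitin mtopology (\<lambda>n. e (c n t)) (g t) sequentially" if t: "good t" for t
  proof -
    have "MCauchy (\<lambda>n. e (c n t))"
      unfolding MCauchy_def
    proof (intro conjI allI impI)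
      fix \<epsilon> :: real assume "\<epsilon> > 0"
      then obtain N where N: "1 / real (Suc N) < \<epsilon> / 2" using nat_approx_posE[of "\<epsilon> / 2"] by auto
      have "d (e (c n t)) (e (c m t)) < \<epsilon>" if "N \<le> n" "N \<le> m" for n m
      proof -
        have "1 / real (Suc n) \<le> 1 / real (Suc N)" "1 / real (Suc m) \<le> 1 / real (Suc N)"
          using that by (auto intro!: divide_left_mono)
        moreover have "d (e (c n t)) (e (c m t)) \<le> 1 / real (Suc n) + 1 / real (Suc m)"
          using t by (simp only: good_def)
        ultimately show ?thesis using N by linarith
      qed
      then show "\<exists>N. \<forall>n m. N \<le> n \<longrightarrow> N \<le> m \<longrightarrow> d (e (c n t)) (e (c m t)) < \<epsilon>" by blast
    qed (use eS in auto)
    then have "\<exists>l. limitin mtopology (\<lambda>n. e (c n t)) l sequentially"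
      using mc by (simp add: mcomplete_def)
    then show ?thesis using t by (simp add: g_def) (rule someI_ex)
  qed
  have gS: "g t \<in> S" for t
    using lim[of t] limitin_mspace[of _ "g t"] eS by (cases "good t") (auto simp: g_def)
  \<comment> \<open>The chosen limit is accessible to measurability arguments only through its
    distances to fixed points.\<close>
  have dist: "d (g t) a = (if good t then lim (\<lambda>n. d (e (c n t)) a) else d (e 0) a)" if "a \<in> S" for t a
    using limI[OF limitin_dist_tendsto[OF lim eS that, of t]] by (auto simp: g_def)
  have [measurable]: "(\<lambda>t. d (g t) (e i)) \<in> borel_measurable borel" for i
    unfolding dist[OF eS] by measurable
  have "g -` U \<in> sets borel" if U: "openin X U" for U
  proof -
    \<comment> \<open>Openness is rewritten as a countable disjunction of conditions on distances to
      the dense sequence.\<close>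
    have "g t \<in> U \<longleftrightarrow> (\<exists>n i. B n i \<subseteq> U \<and> d (g t) (e i) < 1 / real (Suc n))" for t
    proof
      assume "g t \<in> U"
      then obtain r where r: "r > 0" "mball (g t) r \<subseteq> U"
        using U by (auto simp: Xd openin_mtopology)
      then obtain n where n: "1 / real (Suc n) < r / 2" using nat_approx_posE[of "r / 2"] by auto
      obtain i where i: "d (e i) (g t) < 1 / real (Suc n)" using dense[OF gS, of "1 / real (Suc n)"] by auto
      have "B n i \<subseteq> mball (g t) r"
      proof
        fix y assume y: "y \<in> B n i"
        then have "d (g t) y \<le> d (g t) (e i) + d (e i) y"
          by (intro triangle) (auto simp: gS B_def)
        then show "y \<in> mball (g t) r" using y i n commute[of "e i"] by (auto simp: B_def gS)
      qed
      then show "\<exists>n i. B n i \<subseteq> U \<and> d (g t) (e i) < 1 / real (Suc n)"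
        using r i commute[of "e i"] by (metis subset_trans)
    next
      assume "\<exists>n i. B n i \<subseteq> U \<and> d (g t) (e i) < 1 / real (Suc n)"
      then show "g t \<in> U" using gS[of t] eS commute[of "g t"] by (force simp: B_def)
    qed
    then have "g -` U = {t. \<exists>n i. B n i \<subseteq> U \<and> d (g t) (e i) < 1 / real (Suc n)}" by auto
    also have "\<dots> \<in> sets borel" by measurable
    finally show ?thesis .
  qed
  moreover have "{U. openin X U} \<subseteq> Pow (space M)"
    unfolding X(3)[symmetric] by (auto dest: openin_subset)
  ultimately have g: "g \<in> measurable borel M"
    using gS by (intro measurable_sigma_sets[OF setsM]) (auto simp: S)
  have "g (f x) = x" if x: "x \<in> space M" for x
  proof -
    have digit: "ternary_digit (prod_encode (n, i)) (f x) \<longleftrightarrow> x \<in> B n i" for n i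
      by (simp add: f_def ternary_digit_ternary)
    have xS: "x \<in> S" using x S by simp
    have close: "d (e (c n (f x))) x < 1 / real (Suc n)" for n
    proof -
      obtain i where "d (e i) x < 1 / real (Suc n)" using dense[OF xS, of "1 / real (Suc n)"] by auto
      then have "x \<in> B n i" using xS eS by (simp add: B_def)
      then have "x \<in> B n (c n (f x))" unfolding c_def digit by (rule LeastI)
      then show ?thesis by (simp add: B_def)
    qed
    have "good (f x)"
      unfolding good_def
    proof (intro allI)
      fix n m
      have "d (e (c n (f x))) (e (c m (f x))) \<le> d (e (c n (f x))) x + d x (e (c m (f x)))"
        using xS eS by (intro triangle) auto
      then show "d (e (c n (f x))) (e (c m (f x))) \<le> 1 / real (Suc n) + 1 / real (Suc m)"
        using close[of n] close[of m] commute[of x] by simp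
    qed
    moreover have "limitin mtopology (\<lambda>n. e (c n (f x))) x sequentially"
      unfolding limitin_metric_dist_null
    proof (intro conjI)
      show "(\<lambda>n. d (e (c n (f x))) x) \<longlonglongrightarrow> 0"
        using close less_imp_le
        by (intro tendsto_sandwich[OF _ _ tendsto_const LIMSEQ_inverse_real_of_nat])
          (auto simp: inverse_eq_divide intro!: always_eventually)
    qed (use xS eS in auto)
    ultimately show ?thesis using limitin_metric_unique lim by force
  qed
  with f g show ?thesis by blast
qed

section \<open>Uniform noise and comparison of densities\<close>

abbreviation unif :: "real measure" where
  "unif \<equiv> uniform_measure lborel {0..<1}"

lemma prob_space_unif: "prob_space unif"
  by (rule prob_space_uniform_measure) auto

lemma sets_unif[measurable_cong]: "sets unif = sets borel"
  by simp

lemma space_unif[simp]: "space unif = UNIV"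
  by simp

text \<open>Converts a threshold for the noise into a probability. The truncation at 1 disappears
  later, because conditional distribution functions are at most 1 almost everywhere.\<close>

lemma emeasure_unif_less: "emeasure unif {w. ennreal w < c} = min 1 c"
proof -
  have "emeasure unif {w. ennreal w < c} = emeasure lborel ({0..<1} \<inter> {w. ennreal w < c})"
    by (subst emeasure_uniform_measure) (auto simp: divide_ennreal_def)
  also have "{0..<1} \<inter> {w. ennreal w < c} = {0..<enn2real (min 1 c)}"
    by (cases c) (auto simp: min_def ennreal_less_iff ennreal_le_1 simp flip: ennreal_1)
  also have "emeasure lborel \<dots> = min 1 c"
    by (cases c) (auto simp: min_def)
  finally show ?thesis .
qed

text \<open>Test the hypothesis on the set where \<open>g < f\<close>: the integral of the positive
  difference \<open>f - g\<close> over it is 0. Finiteness of the integral of \<open>f\<close>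
  justifies subtracting the integrals.\<close>

lemma AE_le_if_nn_integral_le:
  assumes [measurable]: "f \<in> borel_measurable N" "g \<in> borel_measurable N"
    and fin: "(\<integral>\<^sup>+x. f x \<partial>N) < \<infinity>"
    and le: "\<And>A. A \<in> sets N \<Longrightarrow> (\<integral>\<^sup>+x. f x * indicator A x \<partial>N) \<le> (\<integral>\<^sup>+x. g x * indicator A x \<partial>N)"
  shows "AE x in N. f x \<le> g x"
proof -
  let ?A = "{x\<in>space N. g x < f x}"
  have A: "?A \<in> sets N" by measurable
  have fA: "(\<integral>\<^sup>+x. f x * indicator ?A x \<partial>N) < \<infinity>"
    by (rule le_less_trans[OF nn_integral_mono fin]) (auto split: split_indicator)
  have "(\<integral>\<^sup>+x. g x * indicator ?A x \<partial>N) < \<infinity>"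
    by (rule le_less_trans[OF nn_integral_mono fA]) (auto split: split_indicator)
  then have "(\<integral>\<^sup>+x. f x * indicator ?A x - g x * indicator ?A x \<partial>N)
      = (\<integral>\<^sup>+x. f x * indicator ?A x \<partial>N) - (\<integral>\<^sup>+x. g x * indicator ?A x \<partial>N)"
    by (intro nn_integral_diff) (auto split: split_indicator intro!: AE_I2 less_imp_le)
  also have "\<dots> = 0" using le[OF A] fA by (intro diff_eq_0_ennreal) auto
  finally have "AE x in N. f x * indicator ?A x - g x * indicator ?A x = 0"
    by (subst (asm) nn_integral_0_iff_AE) auto
  then show ?thesis using AE_space
  proof eventually_elim
    case (elim x)
    then show ?case by (cases "g x < f x") (auto dest: ennreal_minus_eq_0)
  qed
qed

text \<open>Conditional distributions as a random variable: the conditional distribution function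
  \<open>h\<close> of the second coordinate is a family of Radon-Nikodym densities, and \<open>Y\<close> is its quantile
  function evaluated at an independent uniform variable. Only countably many \<open>h q\<close> are used, so
  no regularization is needed.\<close>

lemma noise_outsourcing_ereal:
  fixes \<kappa> :: "('a \<times> ereal) measure"
  assumes "finite_measure \<kappa>" and sets[measurable_cong]: "sets \<kappa> = sets (N \<Otimes>\<^sub>M borel)"
  obtains Y where "Y \<in> borel_measurable (N \<Otimes>\<^sub>M unif)"
    "distr (distr \<kappa> N fst \<Otimes>\<^sub>M unif) (N \<Otimes>\<^sub>M borel) (\<lambda>(x, w). (x, Y (x, w))) = \<kappa>"
proof -
  interpret finite_measure \<kappa> by fact
  interpret U: prob_space unif by (rule prob_space_unif)
  define \<nu> where "\<nu> = distr \<kappa> N fst"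
  have sets_\<nu>[simp, measurable_cong]: "sets \<nu> = sets N" and space_\<nu>[simp]: "space \<nu> = space N"
    by (simp_all add: \<nu>_def)
  have space_\<kappa>: "space \<kappa> = space N \<times> UNIV"
    using sets_eq_imp_space_eq[OF sets] by (simp add: space_pair_measure)
  have fst\<kappa>[measurable]: "fst \<in> measurable \<kappa> N" by measurable
  interpret \<nu>: finite_measure \<nu>
    unfolding \<nu>_def by (rule finite_measure_distr) measurable
  have em_\<nu>: "emeasure \<nu> A = emeasure \<kappa> (A \<times> UNIV)" if "A \<in> sets N" for A
    using that sets.sets_into_space[OF that] unfolding \<nu>_def
    by (subst emeasure_distr) (auto simp: space_\<kappa> intro!: arg_cong[where f="emeasure \<kappa>"])
  have AB[measurable]: "A \<times> B \<in> sets \<kappa>" if "A \<in> sets N" "B \<in> sets borel" for A B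
    using that by (simp add: sets)
  \<comment> \<open>For a fixed event \<open>B\<close> in the second coordinate,
    \<open>A \<mapsto> \<kappa> (A \<times> B)\<close> is dominated by the first marginal; its
    Radon-Nikodym derivative is the conditional probability of \<open>B\<close>.\<close>
  have density: "\<exists>h\<in>borel_measurable N. \<forall>A\<in>sets N. (\<integral>\<^sup>+x. h x * indicator A x \<partial>\<nu>) = emeasure \<kappa> (A \<times> B)"
    if B[measurable]: "B \<in> sets borel" for B
  proof -
    let ?\<mu> = "distr (density \<kappa> (indicator (space N \<times> B))) N fst"
    have [measurable]: "space N \<times> B \<in> sets \<kappa>" by (rule AB) auto
    have \<mu>: "emeasure ?\<mu> A = emeasure \<kappa> (A \<times> B)" if A[measurable]: "A \<in> sets N" for A
    proof -
      have "emeasure ?\<mu> A = (\<integral>\<^sup>+p. indicator (space N \<times> B) p * indicator (fst -` A \<inter> space \<kappa>) p \<partial>\<kappa>)"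
        by (simp add: emeasure_distr emeasure_density)
      also have "\<dots> = (\<integral>\<^sup>+p. indicator (A \<times> B) p \<partial>\<kappa>)"
        using sets.sets_into_space[OF A] by (intro nn_integral_cong) (auto simp: space_\<kappa> split: split_indicator)
      also have "\<dots> = emeasure \<kappa> (A \<times> B)" using AB[OF A B] by simp
      finally show ?thesis .
    qed
    have "absolutely_continuous \<nu> ?\<mu>"
      unfolding absolutely_continuous_def
    proof
      fix A assume "A \<in> null_sets \<nu>"
      then have A: "A \<in> sets N" "emeasure \<kappa> (A \<times> UNIV) = 0" by (auto simp: null_sets_def em_\<nu>)
      have "emeasure \<kappa> (A \<times> B) \<le> emeasure \<kappa> (A \<times> UNIV)"
        by (rule emeasure_mono[OF _ AB[OF A(1)]]) auto
      then have "emeasure \<kappa> (A \<times> B) = 0" using A(2) by simp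
      then show "A \<in> null_sets ?\<mu>" using A \<mu> by (auto simp: null_sets_def)
    qed
    then obtain h where h: "h \<in> borel_measurable \<nu>" "density \<nu> h = ?\<mu>"
      using \<nu>.Radon_Nikodym[of ?\<mu>] by auto
    have "(\<integral>\<^sup>+x. h x * indicator A x \<partial>\<nu>) = emeasure \<kappa> (A \<times> B)" if "A \<in> sets N" for A
      using that h \<mu>[OF that] by (simp add: emeasure_density[symmetric])
    moreover have "h \<in> borel_measurable N" using h(1) measurable_cong_sets[OF sets_\<nu> refl, of borel] by simp
    ultimately show ?thesis by blast
  qed
  have "\<forall>q::rat. \<exists>h\<in>borel_measurable N.
      \<forall>A\<in>sets N. (\<integral>\<^sup>+x. h x * indicator A x \<partial>\<nu>) = emeasure \<kappa> (A \<times> {..ereal (of_rat q)})"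
    by (intro allI density) simp
  then obtain h where h[measurable]: "\<And>q::rat. h q \<in> borel_measurable N"
    and h_int: "\<And>q A. A \<in> sets N \<Longrightarrow>
      (\<integral>\<^sup>+x. h q x * indicator A x \<partial>\<nu>) = emeasure \<kappa> (A \<times> {..ereal (of_rat q)})"
    by metis
  have h_total: "(\<integral>\<^sup>+x. h q x \<partial>\<nu>) < \<infinity>" for q
  proof -
    have "(\<integral>\<^sup>+x. h q x \<partial>\<nu>) = (\<integral>\<^sup>+x. h q x * indicator (space N) x \<partial>\<nu>)"
      by (intro nn_integral_cong) simp
    also have "\<dots> < \<infinity>" by (subst h_int) (auto simp: less_top[symmetric])
    finally show ?thesis .
  qed
  have "AE x in \<nu>. h q x \<le> 1" for q
  proof (rule AE_le_if_nn_integral_le)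
    fix A assume "A \<in> sets \<nu>"
    then have [measurable]: "A \<in> sets N" by simp
    have "emeasure \<kappa> (A \<times> {..ereal (of_rat q)}) \<le> emeasure \<kappa> (A \<times> UNIV)"
      by (intro emeasure_mono AB) auto
    then show "(\<integral>\<^sup>+x. h q x * indicator A x \<partial>\<nu>) \<le> (\<integral>\<^sup>+x. 1 * indicator A x \<partial>\<nu>)"
      by (simp add: h_int em_\<nu>)
  qed (use h_total in auto)
  then have h_le1: "AE x in \<nu>. \<forall>q. h q x \<le> 1" by (simp add: AE_all_countable)
  have "AE x in \<nu>. q \<le> q' \<longrightarrow> h q x \<le> h q' x" for q q'
  proof (cases "q \<le> q'")
    case True
    have "AE x in \<nu>. h q x \<le> h q' x"
    proof (rule AE_le_if_nn_integral_le)
      fix A assume "A \<in> sets \<nu>"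
    then have [measurable]: "A \<in> sets N" by simp
      show "(\<integral>\<^sup>+x. h q x * indicator A x \<partial>\<nu>) \<le> (\<integral>\<^sup>+x. h q' x * indicator A x \<partial>\<nu>)"
        using True by (auto simp: h_int of_rat_less_eq intro!: emeasure_mono AB elim!: order_trans)
    qed (use h_total in auto)
    then show ?thesis by simp
  qed simp
  then have h_mono: "AE x in \<nu>. \<forall>q q'. q \<le> q' \<longrightarrow> h q x \<le> h q' x" by (simp add: AE_all_countable)
  define Y where "Y p = (INF q::rat. if ennreal (snd p) < h q (fst p) then ereal (of_rat q) else \<infinity>)" for p
  have Y[measurable]: "Y \<in> borel_measurable (N \<Otimes>\<^sub>M unif)"
    unfolding Y_def by measurable
  \<comment> \<open>The infimum lies below \<open>r\<close> exactly when some rational candidate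
    does, so the event is a single threshold condition on the noise at every \<open>x\<close>,
    exceptional null sets included.\<close>
  have Y_less: "Y (x, w) < r \<longleftrightarrow> ennreal w < (SUP q\<in>{q. ereal (of_rat q) < r}. h q x)" for x w r
    unfolding Y_def INF_less_iff less_SUP_iff by (auto split: if_splits)
  let ?L = "distr (\<nu> \<Otimes>\<^sub>M unif) (N \<Otimes>\<^sub>M borel) (\<lambda>(x, w). (x, Y (x, w)))"
  have L: "emeasure ?L (A \<times> B) = (\<integral>\<^sup>+x. emeasure unif {w. Y (x, w) \<in> B} * indicator A x \<partial>\<nu>)"
    if A[measurable]: "A \<in> sets N" and B[measurable]: "B \<in> sets borel" for A B
  proof -
    have "emeasure ?L (A \<times> B) = emeasure (\<nu> \<Otimes>\<^sub>M unif) {p\<in>space (\<nu> \<Otimes>\<^sub>M unif). fst p \<in> A \<and> Y p \<in> B}"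
      by (subst emeasure_distr) (auto intro!: arg_cong[where f="emeasure _"])
    also have "\<dots> = (\<integral>\<^sup>+x. emeasure unif (Pair x -` {p\<in>space (\<nu> \<Otimes>\<^sub>M unif). fst p \<in> A \<and> Y p \<in> B}) \<partial>\<nu>)"
      by (rule U.emeasure_pair_measure_alt) measurable
    also have "\<dots> = (\<integral>\<^sup>+x. emeasure unif {w. Y (x, w) \<in> B} * indicator A x \<partial>\<nu>)"
      by (intro nn_integral_cong) (auto simp: space_pair_measure split: split_indicator)
    finally show ?thesis .
  qed
  have key: "emeasure ?L (A \<times> {..<r}) = emeasure \<kappa> (A \<times> {..<r})" if A[measurable]: "A \<in> sets N" for A r
  proof (cases "r = -\<infinity>")
    case False
    define Q where "Q = {q::rat. ereal (of_rat q) < r}"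
    have "Q \<noteq> {}"
    proof -
      obtain z where z: "ereal z < r" using False ereal_dense2[of "-\<infinity>" r] by auto
      obtain q where "of_rat q < z" using of_rat_dense[of "z - 1" z] by auto
      then have "ereal (of_rat q) < r" using z by (metis ereal_less(1) less_ereal.simps(1) less_trans)
      then show ?thesis by (auto simp: Q_def)
    qed
    \<comment> \<open>Running maxima of an enumeration of \<open>Q\<close> form an increasing
      cofinal sequence, as monotone convergence and continuity from below require.\<close>
    define m where "m n = Max (from_nat_into Q ` {..n})" for n :: nat
    have mQ: "m n \<in> Q" for n
    proof -
      have "m n \<in> from_nat_into Q ` {..n}" unfolding m_def by (rule Max_in) auto
      then show ?thesis using from_nat_into[OF \<open>Q \<noteq> {}\<close>] by auto
    qed
    have m_mono: "m n \<le> m n'" if "n \<le> n'" for n n'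
      using that unfolding m_def by (intro Max_mono) auto
    have m_cof: "\<exists>n. q \<le> m n" if qQ: "q \<in> Q" for q
    proof -
      obtain n where "from_nat_into Q n = q" using from_nat_into_surj[of Q q] qQ by auto
      then have "q \<le> m n" unfolding m_def by (intro Max_ge) auto
      then show ?thesis ..
    qed
    have "emeasure ?L (A \<times> {..<r}) = (\<integral>\<^sup>+x. min 1 (SUP q\<in>Q. h q x) * indicator A x \<partial>\<nu>)"
      by (subst L) (auto simp: Y_less emeasure_unif_less Q_def)
    also have "\<dots> = (\<integral>\<^sup>+x. (SUP n. h (m n) x * indicator A x) \<partial>\<nu>)"
    proof (rule nn_integral_cong_AE)
      show "AE x in \<nu>. min 1 (SUP q\<in>Q. h q x) * indicator A x = (SUP n. h (m n) x * indicator A x)"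
        using h_le1 h_mono
      proof eventually_elim
        case (elim x)
        have "(SUP q\<in>Q. h q x) = (SUP n. h (m n) x)"
          using elim(2) mQ m_cof by (intro antisym SUP_mono) blast+
        moreover have "(SUP q\<in>Q. h q x) \<le> 1" using elim(1) by (intro SUP_least) auto
        ultimately show ?case by (auto simp: min_absorb2 split: split_indicator)
      qed
    qed
    also have "\<dots> = (SUP n. \<integral>\<^sup>+x. h (m n) x * indicator A x \<partial>\<nu>)"
    proof (rule nn_integral_monotone_convergence_SUP_AE)
      show "AE x in \<nu>. h (m n) x * indicator A x \<le> h (m (Suc n)) x * indicator A x" for n
        using h_mono by eventually_elim (auto simp: m_mono split: split_indicator)
    qed measurable
    also have "\<dots> = (SUP n. emeasure \<kappa> (A \<times> {..ereal (of_rat (m n))}))" by (simp add: h_int)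
    also have "\<dots> = emeasure \<kappa> (\<Union>n. A \<times> {..ereal (of_rat (m n))})"
      using m_mono by (intro SUP_emeasure_incseq) (auto simp: incseq_def of_rat_less_eq intro: order_trans)
    also have "(\<Union>n. A \<times> {..ereal (of_rat (m n))}) = A \<times> {..<r}"
    proof -
      have "\<exists>n. y \<le> ereal (of_rat (m n))" if "y < r" for y
      proof -
        obtain z where z: "y < ereal z" "ereal z < r" using ereal_dense2[OF \<open>y < r\<close>] by auto
        obtain z' where z': "y < ereal z'" "ereal z' < ereal z" using ereal_dense2[OF z(1)] by auto
        obtain q where "z' < of_rat q" "of_rat q < z" using of_rat_dense[of z' z] z' by auto
        then have "ereal z' < ereal (of_rat q)" "ereal (of_rat q) < ereal z" by simp_all
        then have q: "y \<le> ereal (of_rat q)" "ereal (of_rat q) < r"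
          using z(2) z'(1) by (blast intro: less_trans less_imp_le)+
        then obtain n where "q \<le> m n" using m_cof[of q] by (auto simp: Q_def)
        then show ?thesis using q(1) by (auto intro!: exI[of _ n] elim!: order_trans simp: of_rat_less_eq)
      qed
      then show ?thesis using mQ by (auto simp: Q_def intro: le_less_trans)
    qed
    finally show ?thesis .
  next
    case True
    then have "{..<r} = {}" by auto
    then show ?thesis by simp
  qed
  have "?L = \<kappa>"
  proof (rule measure_eqI_generator_eq)
    \<comment> \<open>No ray \<open>{..<r}\<close> contains \<infinity>, so \<open>UNIV\<close> is
      added to let one generator cover the whole space.\<close>
    let ?E = "{a \<times> b |a b. a \<in> sets N \<and> b \<in> insert UNIV (range lessThan) \<union> {{}::ereal set}}"
    have "sets (borel :: ereal measure) = sigma_sets UNIV (insert UNIV (range lessThan) \<union> {{}})"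
    proof -
      have "sigma_sets UNIV (insert UNIV (range lessThan) \<union> {{}}) = sigma_sets UNIV (range (lessThan :: ereal \<Rightarrow> _))"
        by (intro sigma_sets_eqI) (auto intro: sigma_sets_top sigma_sets.Empty sigma_sets.Basic)
      then show ?thesis by (simp add: borel_Iio)
    qed
    then have "sets (N \<Otimes>\<^sub>M (borel :: ereal measure)) = sets (sigma (space N \<times> space borel) ?E)"
      using sets.space_closed[of N]
      by (intro sets_pair_eq[where Ca="{space N}" and Cb="{UNIV}"]) (auto simp: sets.sigma_sets_eq)
    also have "\<dots> = sigma_sets (space N \<times> UNIV) ?E"
      using sets.space_closed[of N] by (subst sets_measure_of) auto
    finally show "sets ?L = sigma_sets (space N \<times> UNIV) ?E" "sets \<kappa> = sigma_sets (space N \<times> UNIV) ?E"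
      by (simp_all add: sets)
    show "Int_stable ?E"
    proof (rule Int_stableI)
      fix a b assume "a \<in> ?E" "b \<in> ?E"
      then obtain A B A' B' where *: "a = A \<times> B" "b = A' \<times> B'" "A \<in> sets N" "A' \<in> sets N"
        "B \<in> insert UNIV (range lessThan) \<union> {{}}" "B' \<in> insert UNIV (range lessThan) \<union> {{}}" by blast
      have "a \<inter> b = (A \<inter> A') \<times> (B \<inter> B')" using * by auto
      moreover have "B \<inter> B' \<in> insert UNIV (range lessThan) \<union> {{}}"
      proof -
        have "{..<s} \<inter> {..<t} = {..<min s t}" for s t :: ereal by auto
        then have "{..<s} \<inter> {..<t} \<in> range lessThan" for s t :: ereal by blast
        then show ?thesis using *(5,6) by (elim UnE insertE imageE singletonE) simp_all
      qed
      ultimately show "a \<inter> b \<in> ?E" using * by blast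
    qed
    show "?E \<subseteq> Pow (space N \<times> UNIV)" using sets.space_closed[of N] by auto
    show "emeasure ?L X = emeasure \<kappa> X" if XE: "X \<in> ?E" for X
    proof -
      obtain A B where X: "X = A \<times> B" "A \<in> sets N" "B = UNIV \<or> B = {} \<or> B \<in> range lessThan"
        using XE by blast
      show ?thesis
        using X(3) L[OF X(2), of UNIV] X(2) key[OF X(2)] U.emeasure_space_1
        by (auto simp: X(1) em_\<nu>)
    qed
    show "range (\<lambda>_::nat. space N \<times> UNIV) \<subseteq> ?E" by auto
    show "emeasure ?L (space N \<times> UNIV) \<noteq> \<infinity>"
      using L[of "space N" UNIV] U.emeasure_space_1 by simp
  qed auto
  with Y show thesis by (intro that) (simp_all add: \<nu>_def)
qed

text \<open>Transport the second coordinate into the extended reals by the code \<open>f\<close>,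
  generate it there, and decode by \<open>g\<close>. Since \<open>g\<close> inverts \<open>f\<close>
  on the space, decoding the coded law restores \<kappa>; since \<open>g\<close> is total, every
  value of \<open>Y\<close> can be decoded.\<close>

theorem noise_outsourcing:
  fixes \<kappa> :: "('b \<times> 'a) measure"
  assumes "standard_borel M" "space M \<noteq> {}"
    and "finite_measure \<kappa>" and sets[measurable_cong]: "sets \<kappa> = sets (N \<Otimes>\<^sub>M M)"
  shows "\<exists>Z\<in>measurable (N \<Otimes>\<^sub>M unif) M.
    distr (distr \<kappa> N fst \<Otimes>\<^sub>M unif) (N \<Otimes>\<^sub>M M) (\<lambda>(x, w). (x, Z (x, w))) = \<kappa>"
proof -
  interpret finite_measure \<kappa> by fact
  obtain f :: "'a \<Rightarrow> real" and g where [measurable]: "f \<in> borel_measurable M" "g \<in> measurable borel M"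
    and gf: "\<And>x. x \<in> space M \<Longrightarrow> g (f x) = x"
    using standard_borel_retract[OF assms(1,2)] by blast
  let ?F = "\<lambda>(x, y). (x, ereal (f y))" and ?G = "\<lambda>(x, r). (x, g (real_of_ereal r))"
  let ?\<kappa> = "distr \<kappa> (N \<Otimes>\<^sub>M borel) ?F"
  have F[measurable]: "?F \<in> measurable (N \<Otimes>\<^sub>M M) (N \<Otimes>\<^sub>M borel)" by measurable
  have G[measurable]: "?G \<in> measurable (N \<Otimes>\<^sub>M borel) (N \<Otimes>\<^sub>M M)" by measurable
  have "finite_measure ?\<kappa>" by (rule finite_measure_distr) measurable
  then obtain Y where Y[measurable]: "Y \<in> borel_measurable (N \<Otimes>\<^sub>M unif)"
    and eq: "distr (distr ?\<kappa> N fst \<Otimes>\<^sub>M unif) (N \<Otimes>\<^sub>M borel) (\<lambda>(x, w). (x, Y (x, w))) = ?\<kappa>"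
    by (rule noise_outsourcing_ereal[of ?\<kappa> N]) auto
  have fst: "distr ?\<kappa> N fst = distr \<kappa> N fst"
    by (subst distr_distr) (auto simp: comp_def case_prod_beta')
  let ?Z = "\<lambda>p. g (real_of_ereal (Y p))"
  have "distr (distr \<kappa> N fst \<Otimes>\<^sub>M unif) (N \<Otimes>\<^sub>M M) (\<lambda>(x, w). (x, ?Z (x, w)))
      = distr (distr (distr \<kappa> N fst \<Otimes>\<^sub>M unif) (N \<Otimes>\<^sub>M borel) (\<lambda>(x, w). (x, Y (x, w)))) (N \<Otimes>\<^sub>M M) ?G"
    by (subst distr_distr) (auto simp: comp_def case_prod_beta')
  also have "\<dots> = distr \<kappa> (N \<Otimes>\<^sub>M M) (?G \<circ> ?F)"
    unfolding eq[unfolded fst] by (subst distr_distr) auto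
  also have "\<dots> = distr \<kappa> (N \<Otimes>\<^sub>M M) (\<lambda>p. p)"
    using sets_eq_imp_space_eq[OF sets] by (intro distr_cong) (auto simp: gf space_pair_measure)
  also have "\<dots> = \<kappa>" using sets by (simp add: distr_id2)
  finally show ?thesis by (intro bexI[of _ ?Z]) auto
qed

section \<open>Loads of multicommodity flows\<close>

lemma finite_measure_onD:
  assumes "finite_measure_on N \<mu>"
  shows "finite_measure \<mu>" "sets \<mu> = sets N" "space \<mu> = space N"
  using assms sets_eq_imp_space_eq by (auto simp: finite_measure_on_def)

lemma finite_measure_onI:
  assumes "sets \<mu> = sets N" "emeasure \<mu> (space N) < \<infinity>"
  shows "finite_measure_on N \<mu>"
  using assms sets_eq_imp_space_eq[OF assms(1)]
  by (auto simp: finite_measure_on_def intro!: finite_measureI)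

lemma finite_measure_on_emeasure: "finite_measure_on N \<mu> \<Longrightarrow> emeasure \<mu> A = ennreal (measure \<mu> A)"
  by (simp add: finite_measure_on_def finite_measure.emeasure_eq_measure)

section \<open>Linear combinations and mixtures of measures\<close>

definition lincomb :: "ennreal \<Rightarrow> 'b measure \<Rightarrow> ennreal \<Rightarrow> 'b measure \<Rightarrow> 'b measure" where
  "lincomb a \<mu> b \<nu> = measure_of (space \<mu>) (sets \<mu>) (\<lambda>S. a * emeasure \<mu> S + b * emeasure \<nu> S)"

lemma sets_lincomb[simp]: "sets (lincomb a \<mu> b \<nu>) = sets \<mu>"
  by (simp add: lincomb_def)

lemma emeasure_lincomb:
  assumes "sets \<nu> = sets \<mu>" "S \<in> sets \<mu>"
  shows "emeasure (lincomb a \<mu> b \<nu>) S = a * emeasure \<mu> S + b * emeasure \<nu> S"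
  unfolding lincomb_def
proof (rule emeasure_measure_of_sigma[OF sets.sigma_algebra_axioms])
  show "positive (sets \<mu>) (\<lambda>S. a * emeasure \<mu> S + b * emeasure \<nu> S)" by (simp add: positive_def)
  show "countably_additive (sets \<mu>) (\<lambda>S. a * emeasure \<mu> S + b * emeasure \<nu> S)"
  proof (rule countably_additiveI)
    fix A :: "nat \<Rightarrow> 'a set" assume A: "range A \<subseteq> sets \<mu>" "disjoint_family A"
    have "(\<Sum>i. a * emeasure \<mu> (A i) + b * emeasure \<nu> (A i))
        = a * (\<Sum>i. emeasure \<mu> (A i)) + b * (\<Sum>i. emeasure \<nu> (A i))"
      by (subst suminf_add[symmetric]) (auto simp: ennreal_suminf_cmult)
    also have "\<dots> = a * emeasure \<mu> (\<Union>i. A i) + b * emeasure \<nu> (\<Union>i. A i)"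
      using A assms(1) by (simp add: suminf_emeasure)
    finally show "(\<Sum>i. a * emeasure \<mu> (A i) + b * emeasure \<nu> (A i))
        = a * emeasure \<mu> (\<Union>i. A i) + b * emeasure \<nu> (\<Union>i. A i)" .
  qed
qed fact

text \<open>A kernel integrated against a measure. Total loads, the joint law of a source and an
  arc, and the average of spliced flows over the noise all have this form.\<close>

definition mixture :: "'b measure \<Rightarrow> ('b \<Rightarrow> 'c measure) \<Rightarrow> 'c measure \<Rightarrow> 'c measure" where
  "mixture \<mu> k N = measure_of (space N) (sets N) (\<lambda>S. \<integral>\<^sup>+p. emeasure (k p) S \<partial>\<mu>)"

lemma sets_mixture[simp]: "sets (mixture \<mu> k N) = sets N"
  by (simp add: mixture_def)

lemma emeasure_mixture:
  assumes k: "\<And>p. p \<in> space \<mu> \<Longrightarrow> sets (k p) = sets N"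
    and m: "\<And>S. S \<in> sets N \<Longrightarrow> (\<lambda>p. emeasure (k p) S) \<in> borel_measurable \<mu>"
    and S: "S \<in> sets N"
  shows "emeasure (mixture \<mu> k N) S = (\<integral>\<^sup>+p. emeasure (k p) S \<partial>\<mu>)"
  unfolding mixture_def
proof (rule emeasure_measure_of_sigma[OF sets.sigma_algebra_axioms _ _ S])
  show "positive (sets N) (\<lambda>S. \<integral>\<^sup>+p. emeasure (k p) S \<partial>\<mu>)" by (simp add: positive_def)
  show "countably_additive (sets N) (\<lambda>S. \<integral>\<^sup>+p. emeasure (k p) S \<partial>\<mu>)"
  proof (rule countably_additiveI)
    fix A :: "nat \<Rightarrow> 'b set" assume A: "range A \<subseteq> sets N" "disjoint_family A"
    have "(\<Sum>i. \<integral>\<^sup>+p. emeasure (k p) (A i) \<partial>\<mu>) = (\<integral>\<^sup>+p. (\<Sum>i. emeasure (k p) (A i)) \<partial>\<mu>)"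
      using A m by (intro nn_integral_suminf[symmetric]) auto
    also have "\<dots> = (\<integral>\<^sup>+p. emeasure (k p) (\<Union>i. A i) \<partial>\<mu>)"
      using A k by (intro nn_integral_cong suminf_emeasure) auto
    finally show "(\<Sum>i. \<integral>\<^sup>+p. emeasure (k p) (A i) \<partial>\<mu>) = (\<integral>\<^sup>+p. emeasure (k p) (\<Union>i. A i) \<partial>\<mu>)" .
  qed
qed

lemma total_load_eq_mixture: "total_load \<sigma> \<phi> = mixture \<sigma> \<phi> \<sigma>"
  by (simp add: total_load_def mixture_def)

text \<open>The flow condition rearranged so that no subtraction occurs.\<close>

lemma unit_flow_iff:
  assumes "s \<in> space M" "t \<in> space M"
  shows "unit_flow M s t \<phi> \<longleftrightarrow> finite_measure_on (M \<Otimes>\<^sub>M M) \<phi> \<and>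
    (\<forall>A\<in>sets M. emeasure \<phi> (A \<times> space M) + indicator A t = emeasure \<phi> (space M \<times> A) + indicator A s)"
proof -
  have "measure \<phi> (A \<times> space M) - measure \<phi> (space M \<times> A) = measure (return M s) A - measure (return M t) A
      \<longleftrightarrow> emeasure \<phi> (A \<times> space M) + indicator A t = emeasure \<phi> (space M \<times> A) + indicator A s"
    if fin: "finite_measure_on (M \<Otimes>\<^sub>M M) \<phi>" and A: "A \<in> sets M" for A
  proof -
    have "emeasure \<phi> (A \<times> space M) + indicator A t = ennreal (measure \<phi> (A \<times> space M) + indicator A t)"
      "emeasure \<phi> (space M \<times> A) + indicator A s = ennreal (measure \<phi> (space M \<times> A) + indicator A s)"
      by (simp_all add: finite_measure_on_emeasure[OF fin] ennreal_indicator[symmetric] ennreal_plus[symmetric]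
          del: ennreal_plus)
    then have "emeasure \<phi> (A \<times> space M) + indicator A t = emeasure \<phi> (space M \<times> A) + indicator A s
        \<longleftrightarrow> measure \<phi> (A \<times> space M) + indicator A t = measure \<phi> (space M \<times> A) + indicator A s"
      by (simp add: ennreal_inj del: ennreal_plus)
    then show ?thesis using A assms by (auto simp: measure_return)
  qed
  then show ?thesis by (auto simp: unit_flow_def)
qed

lemma multicommodity_flowD:
  assumes "multicommodity_flow M \<alpha> \<phi>"
  shows "finite_measure_on (M \<Otimes>\<^sub>M M) \<alpha>"
    and "\<And>p. p \<in> space (M \<Otimes>\<^sub>M M) \<Longrightarrow> finite_measure_on (M \<Otimes>\<^sub>M M) (\<phi> p)"
    and "\<And>p. p \<in> space (M \<Otimes>\<^sub>M M) \<Longrightarrow> sets (\<phi> p) = sets (M \<Otimes>\<^sub>M M)"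
    and "\<And>p A. p \<in> space (M \<Otimes>\<^sub>M M) \<Longrightarrow> A \<in> sets M \<Longrightarrow>
      emeasure (\<phi> p) (A \<times> space M) + indicator A (snd p) = emeasure (\<phi> p) (space M \<times> A) + indicator A (fst p)"
    and "\<And>U. U \<in> sets (M \<Otimes>\<^sub>M M) \<Longrightarrow> (\<lambda>p. emeasure (\<phi> p) U) \<in> borel_measurable (M \<Otimes>\<^sub>M M)"
  using assms by (auto simp: multicommodity_flow_def unit_flow_iff space_pair_measure finite_measure_on_def)

lemma multicommodity_flowI:
  assumes "finite_measure_on (M \<Otimes>\<^sub>M M) \<alpha>"
    and "\<And>p. p \<in> space (M \<Otimes>\<^sub>M M) \<Longrightarrow> sets (\<phi> p) = sets (M \<Otimes>\<^sub>M M)"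
    and "\<And>p. p \<in> space (M \<Otimes>\<^sub>M M) \<Longrightarrow> emeasure (\<phi> p) (space (M \<Otimes>\<^sub>M M)) < \<infinity>"
    and "\<And>p A. p \<in> space (M \<Otimes>\<^sub>M M) \<Longrightarrow> A \<in> sets M \<Longrightarrow>
      emeasure (\<phi> p) (A \<times> space M) + indicator A (snd p) = emeasure (\<phi> p) (space M \<times> A) + indicator A (fst p)"
    and "\<And>U. U \<in> sets (M \<Otimes>\<^sub>M M) \<Longrightarrow> (\<lambda>p. emeasure (\<phi> p) U) \<in> borel_measurable (M \<Otimes>\<^sub>M M)"
  shows "multicommodity_flow M \<alpha> \<phi>"
proof -
  have "unit_flow M s t (\<phi> (s, t))" if "s \<in> space M" "t \<in> space M" for s t
  proof -
    have p: "(s, t) \<in> space (M \<Otimes>\<^sub>M M)" using that by (simp add: space_pair_measure)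
    show ?thesis unfolding unit_flow_iff[OF that]
      using assms(4)[OF p] by (auto intro!: finite_measure_onI assms(2,3) p)
  qed
  then show ?thesis using assms(1,5) by (simp add: multicommodity_flow_def)
qed

lemma emeasure_total_load:
  assumes "multicommodity_flow M \<alpha> \<phi>" "S \<in> sets (M \<Otimes>\<^sub>M M)"
  shows "emeasure (total_load \<alpha> \<phi>) S = (\<integral>\<^sup>+p. emeasure (\<phi> p) S \<partial>\<alpha>)"
proof -
  note D = multicommodity_flowD[OF assms(1)]
  note \<alpha> = finite_measure_onD[OF D(1)]
  show ?thesis unfolding total_load_eq_mixture
    using D(3,5) assms(2) \<alpha>(2,3) measurable_cong_sets[OF \<alpha>(2) refl]
    by (intro emeasure_mixture) auto
qed

lemma sets_total_load: "multicommodity_flow M \<alpha> \<phi> \<Longrightarrow> sets (total_load \<alpha> \<phi>) = sets (M \<Otimes>\<^sub>M M)"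
  by (simp add: total_load_eq_mixture multicommodity_flow_def finite_measure_on_def)

text \<open>Loads appear as real set functions so that functionals on signed measures apply to them.
  Infinite loads are left out, which loses nothing for flows of finite overload.\<close>

definition loads :: "'a measure \<Rightarrow> ('a \<times> 'a) measure \<Rightarrow> (('a \<times> 'a) set \<Rightarrow> real) set" where
  "loads M \<alpha> = {measure (total_load \<alpha> \<phi>) |\<phi>. multicommodity_flow M \<alpha> \<phi> \<and> finite_measure (total_load \<alpha> \<phi>)}"

lemma loadsE:
  assumes "\<Lambda> \<in> loads M \<alpha>"
  obtains \<phi> where "multicommodity_flow M \<alpha> \<phi>" "finite_measure_on (M \<Otimes>\<^sub>M M) (total_load \<alpha> \<phi>)"
    "\<Lambda> = measure (total_load \<alpha> \<phi>)"
    "\<And>S. S \<in> sets (M \<Otimes>\<^sub>M M) \<Longrightarrow> (\<integral>\<^sup>+p. emeasure (\<phi> p) S \<partial>\<alpha>) = ennreal (\<Lambda> S)"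
proof -
  obtain \<phi> where \<phi>: "multicommodity_flow M \<alpha> \<phi>" "finite_measure (total_load \<alpha> \<phi>)"
    "\<Lambda> = measure (total_load \<alpha> \<phi>)"
    using assms by (auto simp: loads_def)
  then show thesis
    by (intro that[of \<phi>])
      (auto simp: finite_measure_on_def sets_total_load emeasure_total_load[symmetric]
        finite_measure.emeasure_eq_measure)
qed

lemma loads_in_signed_measures: "\<Lambda> \<in> loads M \<alpha> \<Longrightarrow> \<Lambda> \<in> signed_measures (M \<Otimes>\<^sub>M M)"
  by (auto elim!: loadsE intro!: measure_in_signed_measures)

lemma loads_nonneg: "\<Lambda> \<in> loads M \<alpha> \<Longrightarrow> 0 \<le> \<Lambda> S"
  by (auto simp: loads_def)

lemma loads_outside: "\<Lambda> \<in> loads M \<alpha> \<Longrightarrow> S \<notin> sets (M \<Otimes>\<^sub>M M) \<Longrightarrow> \<Lambda> S = 0"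
  by (rule signed_measures_outside[OF loads_in_signed_measures])

lemma loadsI:
  assumes \<phi>: "multicommodity_flow M \<alpha> \<phi>"
    and eq: "\<And>S. S \<in> sets (M \<Otimes>\<^sub>M M) \<Longrightarrow> (\<integral>\<^sup>+p. emeasure (\<phi> p) S \<partial>\<alpha>) = ennreal (\<Lambda> S)"
    and nn: "\<And>S. 0 \<le> \<Lambda> S" and out: "\<And>S. S \<notin> sets (M \<Otimes>\<^sub>M M) \<Longrightarrow> \<Lambda> S = 0"
  shows "\<Lambda> \<in> loads M \<alpha>"
proof -
  have "finite_measure_on (M \<Otimes>\<^sub>M M) (total_load \<alpha> \<phi>)"
    using eq[OF sets.top] emeasure_total_load[OF \<phi> sets.top]
    by (intro finite_measure_onI sets_total_load[OF \<phi>]) simp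
  moreover have "measure (total_load \<alpha> \<phi>) S = \<Lambda> S" for S
    using eq[of S] emeasure_total_load[OF \<phi>, of S] nn[of S] out[of S] sets_total_load[OF \<phi>]
    by (cases "S \<in> sets (M \<Otimes>\<^sub>M M)") (auto simp: measure_def emeasure_notin_sets)
  then have "\<Lambda> = measure (total_load \<alpha> \<phi>)" by auto
  ultimately show ?thesis using \<phi> by (auto simp: loads_def finite_measure_on_def)
qed

section \<open>Direct routing and linear operations on demands\<close>

lemma return_flow:
  assumes \<alpha>: "finite_measure_on (M \<Otimes>\<^sub>M M) \<alpha>"
  shows "multicommodity_flow M \<alpha> (return (M \<Otimes>\<^sub>M M))"
proof (rule multicommodity_flowI[OF \<alpha>])
  fix p A assume "p \<in> space (M \<Otimes>\<^sub>M M)" "A \<in> sets M"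
  then show "emeasure (return (M \<Otimes>\<^sub>M M) p) (A \<times> space M) + indicator A (snd p)
      = emeasure (return (M \<Otimes>\<^sub>M M) p) (space M \<times> A) + indicator A (fst p)"
    by (auto simp: space_pair_measure split: split_indicator)
qed auto

text \<open>If every pair is served by its own arc, the load is the demand itself. In particular
  every finite demand has a finite load.\<close>

lemma measure_in_loads:
  assumes \<alpha>: "finite_measure_on (M \<Otimes>\<^sub>M M) \<alpha>"
  shows "measure \<alpha> \<in> loads M \<alpha>"
proof (rule loadsI[OF return_flow[OF \<alpha>]])
  show "(\<integral>\<^sup>+p. emeasure (return (M \<Otimes>\<^sub>M M) p) S \<partial>\<alpha>) = ennreal (measure \<alpha> S)"
    if "S \<in> sets (M \<Otimes>\<^sub>M M)" for S
    using that finite_measure_onD[OF \<alpha>] by (simp add: finite_measure_on_emeasure[OF \<alpha>, symmetric])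
qed (auto simp: measure_notin_sets finite_measure_onD[OF \<alpha>])

text \<open>The zero measure is a flow from a point to itself. Pairs off the diagonal are still
  routed, along their own arcs, but the demand does not charge them.\<close>

lemma zero_in_loads:
  assumes \<alpha>: "finite_measure_on (M \<Otimes>\<^sub>M M) \<alpha>" and diag: "emeasure \<alpha> {p\<in>space (M \<Otimes>\<^sub>M M). fst p \<noteq> snd p} = 0"
    and meas: "{p\<in>space (M \<Otimes>\<^sub>M M). fst p \<noteq> snd p} \<in> sets (M \<Otimes>\<^sub>M M)"
  shows "(\<lambda>_. 0) \<in> loads M \<alpha>"
proof (rule loadsI)
  note \<alpha>D = finite_measure_onD[OF \<alpha>]
  let ?\<Delta> = "{p\<in>space (M \<Otimes>\<^sub>M M). fst p \<noteq> snd p}"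
  let ?\<phi> = "\<lambda>p. if fst p = snd p then null_measure (M \<Otimes>\<^sub>M M) else return (M \<Otimes>\<^sub>M M) p"
  have em: "emeasure (?\<phi> p) S = indicator (S \<inter> ?\<Delta>) p" if "S \<in> sets (M \<Otimes>\<^sub>M M)" for S p
    using that sets.sets_into_space[OF that] by (auto split: split_indicator)
  show "multicommodity_flow M \<alpha> ?\<phi>"
  proof (rule multicommodity_flowI[OF \<alpha>])
    fix p A assume "p \<in> space (M \<Otimes>\<^sub>M M)" "A \<in> sets M"
    then show "emeasure (?\<phi> p) (A \<times> space M) + indicator A (snd p)
        = emeasure (?\<phi> p) (space M \<times> A) + indicator A (fst p)"
      by (auto simp: space_pair_measure split: split_indicator)
  next
    show "(\<lambda>p. emeasure (?\<phi> p) U) \<in> borel_measurable (M \<Otimes>\<^sub>M M)" if "U \<in> sets (M \<Otimes>\<^sub>M M)" for U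
      unfolding em[OF that] using that meas by measurable
  qed auto
  show "(\<integral>\<^sup>+p. emeasure (?\<phi> p) S \<partial>\<alpha>) = ennreal 0" if "S \<in> sets (M \<Otimes>\<^sub>M M)" for S
  proof -
    have "(\<integral>\<^sup>+p. emeasure (?\<phi> p) S \<partial>\<alpha>) = emeasure \<alpha> (S \<inter> ?\<Delta>)"
      unfolding em[OF that] using that meas by (intro nn_integral_indicator) (simp add: \<alpha>D)
    also have "\<dots> \<le> emeasure \<alpha> ?\<Delta>" using meas by (intro emeasure_mono) (auto simp: \<alpha>D)
    finally show ?thesis using diag by simp
  qed
qed auto

text \<open>The flows stay the same; only the measure that integrates them is scaled.\<close>

lemma loads_scale:
  assumes \<Lambda>: "\<Lambda> \<in> loads M \<alpha>" and \<gamma>: "finite_measure_on (M \<Otimes>\<^sub>M M) \<gamma>" and c: "0 \<le> c"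
    and eq: "\<And>S. measure \<gamma> S = c * measure \<alpha> S"
  shows "(\<lambda>S. c * \<Lambda> S) \<in> loads M \<gamma>"
proof -
  obtain \<phi> where \<phi>: "multicommodity_flow M \<alpha> \<phi>"
    and int: "\<And>S. S \<in> sets (M \<Otimes>\<^sub>M M) \<Longrightarrow> (\<integral>\<^sup>+p. emeasure (\<phi> p) S \<partial>\<alpha>) = ennreal (\<Lambda> S)"
    using loadsE[OF \<Lambda>] by metis
  note D = multicommodity_flowD[OF \<phi>]
  have \<gamma>_eq: "\<gamma> = scale_measure (ennreal c) \<alpha>"
    using finite_measure_onD[OF D(1)] finite_measure_onD[OF \<gamma>] c
    by (intro measure_eqI)
      (auto simp: finite_measure_on_emeasure[OF \<gamma>] finite_measure_on_emeasure[OF D(1)] eq ennreal_mult)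
  show ?thesis
  proof (rule loadsI)
    show "multicommodity_flow M \<gamma> \<phi>" using \<phi> \<gamma> by (simp add: multicommodity_flow_def)
    fix S assume S: "S \<in> sets (M \<Otimes>\<^sub>M M)"
    have "(\<lambda>p. emeasure (\<phi> p) S) \<in> borel_measurable \<alpha>"
      using D(5)[OF S] measurable_cong_sets[OF finite_measure_onD(2)[OF D(1)] refl] by auto
    then show "(\<integral>\<^sup>+p. emeasure (\<phi> p) S \<partial>\<gamma>) = ennreal (c * \<Lambda> S)"
      using int[OF S] c loads_nonneg[OF \<Lambda>] by (simp add: \<gamma>_eq nn_integral_scale_measure ennreal_mult)
  qed (use c loads_nonneg[OF \<Lambda>] loads_outside[OF \<Lambda>] in auto)
qed

text \<open>Since \<alpha> is dominated by \<gamma>, its Radon-Nikodym derivative is at most 1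
  almost everywhere. Capping it at 1 makes the bound hold everywhere, so that \<open>1 - f\<close>
  is a true complement in \<open>ennreal\<close> at each point.\<close>

lemma sum_density:
  assumes \<alpha>: "finite_measure_on N \<alpha>" and \<beta>: "finite_measure_on N \<beta>" and \<gamma>: "finite_measure_on N \<gamma>"
    and eq: "\<And>S. measure \<gamma> S = measure \<alpha> S + measure \<beta> S"
  obtains f where "f \<in> borel_measurable N" "\<And>x. f x \<le> 1"
    "density \<gamma> f = \<alpha>" "density \<gamma> (\<lambda>x. 1 - f x) = \<beta>"
proof -
  note D = finite_measure_onD[OF \<alpha>] finite_measure_onD[OF \<beta>] finite_measure_onD[OF \<gamma>]
  note em = finite_measure_on_emeasure
  have em_eq: "emeasure \<gamma> S = emeasure \<alpha> S + emeasure \<beta> S" for S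
    by (simp add: em[OF \<alpha>] em[OF \<beta>] em[OF \<gamma>] eq)
  interpret \<gamma>: finite_measure \<gamma> by (rule D)
  have "absolutely_continuous \<gamma> \<alpha>"
    unfolding absolutely_continuous_def
  proof
    fix A assume "A \<in> null_sets \<gamma>"
    then show "A \<in> null_sets \<alpha>" using em_eq[of A] D by (auto simp: null_sets_def)
  qed
  then obtain h where h: "h \<in> borel_measurable \<gamma>" "density \<gamma> h = \<alpha>"
    using \<gamma>.Radon_Nikodym[of \<alpha>] D by auto
  have int: "(\<integral>\<^sup>+x. h x * indicator A x \<partial>\<gamma>) = emeasure \<alpha> A" if "A \<in> sets \<gamma>" for A
    using emeasure_density[OF h(1) that] h(2) by simp
  have "AE x in \<gamma>. h x \<le> 1"
  proof (rule AE_le_if_nn_integral_le[OF h(1)])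
    have "(\<integral>\<^sup>+x. h x \<partial>\<gamma>) = (\<integral>\<^sup>+x. h x * indicator (space \<gamma>) x \<partial>\<gamma>)" by (intro nn_integral_cong) simp
    then show "(\<integral>\<^sup>+x. h x \<partial>\<gamma>) < \<infinity>" using int[OF sets.top] by (simp add: em[OF \<alpha>])
    show "(\<integral>\<^sup>+x. h x * indicator A x \<partial>\<gamma>) \<le> (\<integral>\<^sup>+x. 1 * indicator A x \<partial>\<gamma>)" if "A \<in> sets \<gamma>" for A
      using int[OF that] that em_eq[of A] by simp
  qed simp
  then have ae: "AE x in \<gamma>. min 1 (h x) = h x" by eventually_elim (simp add: min_absorb2)
  define f where "f x = min 1 (h x)" for x
  have f[measurable]: "f \<in> borel_measurable \<gamma>" unfolding f_def using h(1) by measurable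
  have f\<alpha>: "density \<gamma> f = \<alpha>"
    unfolding h(2)[symmetric] using ae h(1) f by (intro density_cong) (auto simp: f_def)
  have f1: "f x \<le> 1" for x by (simp add: f_def)
  have "density \<gamma> (\<lambda>x. 1 - f x) = \<beta>"
  proof (rule measure_eqI)
    fix A assume "A \<in> sets (density \<gamma> (\<lambda>x. 1 - f x))"
    then have A[measurable]: "A \<in> sets \<gamma>" by simp
    have "emeasure \<alpha> A + emeasure (density \<gamma> (\<lambda>x. 1 - f x)) A
        = (\<integral>\<^sup>+x. f x * indicator A x \<partial>\<gamma>) + (\<integral>\<^sup>+x. (1 - f x) * indicator A x \<partial>\<gamma>)"
      unfolding f\<alpha>[symmetric] by (simp add: emeasure_density)
    also have "\<dots> = (\<integral>\<^sup>+x. f x * indicator A x + (1 - f x) * indicator A x \<partial>\<gamma>)"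
      by (intro nn_integral_add[symmetric]) measurable
    also have "\<dots> = (\<integral>\<^sup>+x. indicator A x \<partial>\<gamma>)"
      using f1 by (intro nn_integral_cong) (auto simp: add_diff_inverse_ennreal split: split_indicator)
    also have "\<dots> = emeasure \<alpha> A + emeasure \<beta> A" using em_eq[of A] by simp
    finally show "emeasure (density \<gamma> (\<lambda>x. 1 - f x)) A = emeasure \<beta> A"
      by (simp add: em[OF \<alpha>] ennreal_add_left_cancel)
  qed (simp add: D)
  moreover have "f \<in> borel_measurable N"
    by (subst measurable_cong_sets[OF D(8)[symmetric] refl]) (rule f)
  ultimately show thesis using f1 f\<alpha> by (intro that[of f]) auto
qed

lemma multicommodity_flow_measurable:
  assumes "multicommodity_flow M \<alpha> \<phi>" "sets \<beta> = sets (M \<Otimes>\<^sub>M M)" "U \<in> sets (M \<Otimes>\<^sub>M M)"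
  shows "(\<lambda>p. emeasure (\<phi> p) U) \<in> borel_measurable \<beta>"
  by (subst measurable_cong_sets[OF assms(2) refl]) (rule multicommodity_flowD(5)[OF assms(1,3)])

text \<open>The same flow family is integrated against each summand. The densities of the summands
  add up to 1 at every point, so the two loads add up to \<Lambda>, and each is finite because it
  lies below \<Lambda>.\<close>

lemma loads_split:
  assumes \<Lambda>: "\<Lambda> \<in> loads M \<gamma>"
    and \<alpha>: "finite_measure_on (M \<Otimes>\<^sub>M M) \<alpha>" and \<beta>: "finite_measure_on (M \<Otimes>\<^sub>M M) \<beta>"
    and eq: "\<And>S. measure \<gamma> S = measure \<alpha> S + measure \<beta> S"
  obtains \<Lambda>1 \<Lambda>2 where "\<Lambda>1 \<in> loads M \<alpha>" "\<Lambda>2 \<in> loads M \<beta>" "\<Lambda> = (\<lambda>S. \<Lambda>1 S + \<Lambda>2 S)"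
proof -
  obtain \<phi> where \<phi>: "multicommodity_flow M \<gamma> \<phi>" and load: "\<Lambda> = measure (total_load \<gamma> \<phi>)"
    and int: "\<And>S. S \<in> sets (M \<Otimes>\<^sub>M M) \<Longrightarrow> (\<integral>\<^sup>+p. emeasure (\<phi> p) S \<partial>\<gamma>) = ennreal (\<Lambda> S)"
    using loadsE[OF \<Lambda>] by metis
  note \<gamma> = multicommodity_flowD(1)[OF \<phi>]
  obtain f where f: "f \<in> borel_measurable (M \<Otimes>\<^sub>M M)" "\<And>x. f x \<le> 1"
    "density \<gamma> f = \<alpha>" "density \<gamma> (\<lambda>x. 1 - f x) = \<beta>"
    using sum_density[OF \<alpha> \<beta> \<gamma> eq] by metis
  have f\<gamma>[measurable]: "f \<in> borel_measurable \<gamma>"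
    by (subst measurable_cong_sets[OF finite_measure_onD(2)[OF \<gamma>] refl]) (rule f)
  have sum: "(\<integral>\<^sup>+p. emeasure (\<phi> p) S \<partial>\<alpha>) + (\<integral>\<^sup>+p. emeasure (\<phi> p) S \<partial>\<beta>) = ennreal (\<Lambda> S)"
    if S: "S \<in> sets (M \<Otimes>\<^sub>M M)" for S
  proof -
    have m[measurable]: "(\<lambda>p. emeasure (\<phi> p) S) \<in> borel_measurable \<gamma>"
      by (rule multicommodity_flow_measurable[OF \<phi> finite_measure_onD(2)[OF \<gamma>] S])
    have "(\<integral>\<^sup>+p. emeasure (\<phi> p) S \<partial>\<alpha>) + (\<integral>\<^sup>+p. emeasure (\<phi> p) S \<partial>\<beta>)
        = (\<integral>\<^sup>+p. f p * emeasure (\<phi> p) S + (1 - f p) * emeasure (\<phi> p) S \<partial>\<gamma>)"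
      unfolding f(3,4)[symmetric] by (simp add: nn_integral_density nn_integral_add)
    also have "\<dots> = (\<integral>\<^sup>+p. emeasure (\<phi> p) S \<partial>\<gamma>)"
      using f(2) by (intro nn_integral_cong) (simp add: distrib_right[symmetric] add_diff_inverse_ennreal)
    finally show ?thesis using int[OF S] by simp
  qed
  have part: "\<exists>\<Lambda>'. \<Lambda>' \<in> loads M \<mu> \<and> (\<forall>S\<in>sets (M \<Otimes>\<^sub>M M). (\<integral>\<^sup>+p. emeasure (\<phi> p) S \<partial>\<mu>) = ennreal (\<Lambda>' S))"
    if \<mu>: "finite_measure_on (M \<Otimes>\<^sub>M M) \<mu>"
      and le: "\<And>S. S \<in> sets (M \<Otimes>\<^sub>M M) \<Longrightarrow> (\<integral>\<^sup>+p. emeasure (\<phi> p) S \<partial>\<mu>) \<le> ennreal (\<Lambda> S)" for \<mu>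
  proof -
    have flow: "multicommodity_flow M \<mu> \<phi>" using \<phi> \<mu> by (simp add: multicommodity_flow_def)
    have fin: "finite_measure_on (M \<Otimes>\<^sub>M M) (total_load \<mu> \<phi>)"
      using le[OF sets.top] by (intro finite_measure_onI sets_total_load[OF flow])
        (auto simp: emeasure_total_load[OF flow] intro: le_less_trans)
    then have "measure (total_load \<mu> \<phi>) \<in> loads M \<mu>"
      using flow by (auto simp: loads_def finite_measure_on_def)
    moreover have "\<forall>S\<in>sets (M \<Otimes>\<^sub>M M). (\<integral>\<^sup>+p. emeasure (\<phi> p) S \<partial>\<mu>) = ennreal (measure (total_load \<mu> \<phi>) S)"
      by (simp add: emeasure_total_load[OF flow, symmetric] finite_measure_on_emeasure[OF fin])
    ultimately show ?thesis by blast
  qed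
  obtain \<Lambda>1 where \<Lambda>1: "\<Lambda>1 \<in> loads M \<alpha>"
    "\<And>S. S \<in> sets (M \<Otimes>\<^sub>M M) \<Longrightarrow> (\<integral>\<^sup>+p. emeasure (\<phi> p) S \<partial>\<alpha>) = ennreal (\<Lambda>1 S)"
    using part[OF \<alpha>] sum by (metis le_iff_add)
  obtain \<Lambda>2 where \<Lambda>2: "\<Lambda>2 \<in> loads M \<beta>"
    "\<And>S. S \<in> sets (M \<Otimes>\<^sub>M M) \<Longrightarrow> (\<integral>\<^sup>+p. emeasure (\<phi> p) S \<partial>\<beta>) = ennreal (\<Lambda>2 S)"
    using part[OF \<beta>] sum by (metis le_iff_add add.commute)
  have "\<Lambda> S = \<Lambda>1 S + \<Lambda>2 S" for S
  proof (cases "S \<in> sets (M \<Otimes>\<^sub>M M)")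
    case True
    then have "ennreal (\<Lambda>1 S + \<Lambda>2 S) = ennreal (\<Lambda> S)"
      using sum[OF True] \<Lambda>1(2) \<Lambda>2(2) loads_nonneg[OF \<Lambda>1(1)] loads_nonneg[OF \<Lambda>2(1)] by simp
    then show ?thesis
      using loads_nonneg[OF \<Lambda>1(1), of S] loads_nonneg[OF \<Lambda>2(1), of S] loads_nonneg[OF \<Lambda>, of S]
      by (simp del: ennreal_plus)
  next
    case False
    then show ?thesis
      using \<Lambda>1(1) \<Lambda>2(1) \<Lambda> by (simp add: loads_outside[of _ M])
  qed
  then show thesis using that[OF \<Lambda>1(1) \<Lambda>2(1)] by blast
qed

text \<open>The two families differ, so at each pair they are mixed convexly, weighted by the shares
  \<open>f p\<close> and \<open>1 - f p\<close> of \<alpha> and \<beta> in the combined demand. Unit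
  flows between fixed endpoints are closed under convex combination.\<close>

lemma loads_add:
  assumes \<Lambda>1: "\<Lambda>1 \<in> loads M \<alpha>" and \<Lambda>2: "\<Lambda>2 \<in> loads M \<beta>"
    and \<gamma>: "finite_measure_on (M \<Otimes>\<^sub>M M) \<gamma>"
    and eq: "\<And>S. measure \<gamma> S = measure \<alpha> S + measure \<beta> S"
  shows "(\<lambda>S. \<Lambda>1 S + \<Lambda>2 S) \<in> loads M \<gamma>"
proof -
  obtain \<phi>1 where \<phi>1: "multicommodity_flow M \<alpha> \<phi>1"
    and int1: "\<And>S. S \<in> sets (M \<Otimes>\<^sub>M M) \<Longrightarrow> (\<integral>\<^sup>+p. emeasure (\<phi>1 p) S \<partial>\<alpha>) = ennreal (\<Lambda>1 S)"
    using loadsE[OF \<Lambda>1] by metis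
  obtain \<phi>2 where \<phi>2: "multicommodity_flow M \<beta> \<phi>2"
    and int2: "\<And>S. S \<in> sets (M \<Otimes>\<^sub>M M) \<Longrightarrow> (\<integral>\<^sup>+p. emeasure (\<phi>2 p) S \<partial>\<beta>) = ennreal (\<Lambda>2 S)"
    using loadsE[OF \<Lambda>2] by metis
  note D1 = multicommodity_flowD[OF \<phi>1] and D2 = multicommodity_flowD[OF \<phi>2]
  obtain f where f[measurable]: "f \<in> borel_measurable (M \<Otimes>\<^sub>M M)" and f1: "\<And>x. f x \<le> 1"
    and dens: "density \<gamma> f = \<alpha>" "density \<gamma> (\<lambda>x. 1 - f x) = \<beta>"
    using sum_density[OF D1(1) D2(1) \<gamma> eq] by metis
  note \<gamma>s = finite_measure_onD(2)[OF \<gamma>]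
  have f\<gamma>[measurable]: "f \<in> borel_measurable \<gamma>"
    by (subst measurable_cong_sets[OF \<gamma>s refl]) (rule f)
  let ?\<phi> = "\<lambda>p. lincomb (f p) (\<phi>1 p) (1 - f p) (\<phi>2 p)"
  have em: "emeasure (?\<phi> p) S = f p * emeasure (\<phi>1 p) S + (1 - f p) * emeasure (\<phi>2 p) S"
    if "p \<in> space (M \<Otimes>\<^sub>M M)" "S \<in> sets (M \<Otimes>\<^sub>M M)" for p S
    using that by (intro emeasure_lincomb) (simp_all add: D1(3) D2(3))
  show ?thesis
  proof (rule loadsI)
    show "multicommodity_flow M \<gamma> ?\<phi>"
    proof (rule multicommodity_flowI[OF \<gamma>])
      fix p assume p: "p \<in> space (M \<Otimes>\<^sub>M M)"
      have "f p < \<infinity>" by (rule le_less_trans[OF f1]) simp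
      moreover have "1 - f p < \<infinity>" by (rule le_less_trans[of _ 1]) auto
      ultimately show "emeasure (?\<phi> p) (space (M \<Otimes>\<^sub>M M)) < \<infinity>"
        using finite_measure_on_emeasure[OF D1(2)[OF p]] finite_measure_on_emeasure[OF D2(2)[OF p]]
        by (simp add: em[OF p] ennreal_mult_less_top)
      fix A assume A: "A \<in> sets M"
      \<comment> \<open>The weights sum to 1, so the endpoint terms of the flow condition are
        distributed over the two flows as well.\<close>
      have comb: "f p * a + (1 - f p) * b + i = f p * (a + i) + (1 - f p) * (b + i)" for a b i
      proof -
        have "f p * i + (1 - f p) * i = i"
          using f1[of p] by (simp add: distrib_right[symmetric] add_diff_inverse_ennreal)
        then have "f p * a + (1 - f p) * b + i = f p * a + (1 - f p) * b + (f p * i + (1 - f p) * i)" by simp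
        then show ?thesis by (simp only: distrib_left add.assoc add.commute add.left_commute)
      qed
      have sets: "A \<times> space M \<in> sets (M \<Otimes>\<^sub>M M)" "space M \<times> A \<in> sets (M \<Otimes>\<^sub>M M)" using A by auto
      have "emeasure (?\<phi> p) (A \<times> space M) + indicator A (snd p)
          = f p * (emeasure (\<phi>1 p) (A \<times> space M) + indicator A (snd p))
            + (1 - f p) * (emeasure (\<phi>2 p) (A \<times> space M) + indicator A (snd p))"
        by (simp only: em[OF p sets(1)] comb)
      also have "\<dots> = f p * (emeasure (\<phi>1 p) (space M \<times> A) + indicator A (fst p))
            + (1 - f p) * (emeasure (\<phi>2 p) (space M \<times> A) + indicator A (fst p))"
        using D1(4)[OF p A] D2(4)[OF p A] by simp
      also have "\<dots> = emeasure (?\<phi> p) (space M \<times> A) + indicator A (fst p)"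
        by (simp only: em[OF p sets(2)] comb)
      finally show "emeasure (?\<phi> p) (A \<times> space M) + indicator A (snd p)
          = emeasure (?\<phi> p) (space M \<times> A) + indicator A (fst p)" .
    next
      fix U assume U: "U \<in> sets (M \<Otimes>\<^sub>M M)"
      have "(\<lambda>p. f p * emeasure (\<phi>1 p) U + (1 - f p) * emeasure (\<phi>2 p) U) \<in> borel_measurable (M \<Otimes>\<^sub>M M)"
        using D1(5)[OF U] D2(5)[OF U] by measurable
      then show "(\<lambda>p. emeasure (?\<phi> p) U) \<in> borel_measurable (M \<Otimes>\<^sub>M M)"
        by (rule measurable_cong[THEN iffD1, rotated]) (simp add: em U)
    qed (simp add: D1(3))
    fix S assume S: "S \<in> sets (M \<Otimes>\<^sub>M M)"
    have [measurable]: "(\<lambda>p. emeasure (\<phi>1 p) S) \<in> borel_measurable \<gamma>" "(\<lambda>p. emeasure (\<phi>2 p) S) \<in> borel_measurable \<gamma>"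
      by (rule multicommodity_flow_measurable[OF \<phi>1 \<gamma>s S] multicommodity_flow_measurable[OF \<phi>2 \<gamma>s S])+
    have "(\<integral>\<^sup>+p. emeasure (?\<phi> p) S \<partial>\<gamma>) = (\<integral>\<^sup>+p. f p * emeasure (\<phi>1 p) S + (1 - f p) * emeasure (\<phi>2 p) S \<partial>\<gamma>)"
      using S by (intro nn_integral_cong em) (simp_all add: finite_measure_onD(3)[OF \<gamma>])
    also have "\<dots> = (\<integral>\<^sup>+p. emeasure (\<phi>1 p) S \<partial>\<alpha>) + (\<integral>\<^sup>+p. emeasure (\<phi>2 p) S \<partial>\<beta>)"
      unfolding dens[symmetric] by (simp add: nn_integral_density nn_integral_add)
    also have "\<dots> = ennreal (\<Lambda>1 S + \<Lambda>2 S)"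
      using int1[OF S] int2[OF S] loads_nonneg[OF \<Lambda>1] loads_nonneg[OF \<Lambda>2] by simp
    finally show "(\<integral>\<^sup>+p. emeasure (?\<phi> p) S \<partial>\<gamma>) = ennreal (\<Lambda>1 S + \<Lambda>2 S)" .
  qed (use loads_nonneg[OF \<Lambda>1] loads_nonneg[OF \<Lambda>2] loads_outside[OF \<Lambda>1] loads_outside[OF \<Lambda>2] in auto)
qed

text \<open>Dynkin induction: on a rectangle the expression is an indicator times a measurable
  function, and finiteness of the kernel turns complements into differences.\<close>

lemma measurable_emeasure_section:
  assumes k: "\<And>p. p \<in> space X \<Longrightarrow> finite_measure_on N (k p)"
    and m: "\<And>U. U \<in> sets N \<Longrightarrow> (\<lambda>p. emeasure (k p) U) \<in> borel_measurable X"
    and T: "T \<in> sets (X \<Otimes>\<^sub>M N)"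
  shows "(\<lambda>p. emeasure (k p) (Pair p -` T)) \<in> borel_measurable X"
proof -
  have T': "T \<in> sigma_sets (space X \<times> space N) {a \<times> b |a b. a \<in> sets X \<and> b \<in> sets N}"
    using T unfolding sets_pair_measure .
  note sets_eq = sets_pair_measure[of X N, symmetric]
  show ?thesis
    using Int_stable_pair_measure_generator pair_measure_closed T'
  proof (induct rule: sigma_sets_induct_disjoint)
    case (basic A)
    then obtain a b where A: "A = a \<times> b" "a \<in> sets X" "b \<in> sets N" by auto
    have "emeasure (k p) (Pair p -` A) = indicator a p * emeasure (k p) b" for p
      by (auto simp: A(1) split: split_indicator)
    then show ?case using A m by simp
  next
    case empty
    show ?case by simp
  next
    case (compl A)
    have A: "A \<in> sets (X \<Otimes>\<^sub>M N)" using compl(1) by (simp add: sets_eq)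
    have "emeasure (k p) (Pair p -` (space X \<times> space N - A))
        = emeasure (k p) (space N) - emeasure (k p) (Pair p -` A)" if p: "p \<in> space X" for p
    proof -
      have "Pair p -` (space X \<times> space N - A) = space (k p) - Pair p -` A"
        using p finite_measure_onD(3)[OF k[OF p]] by auto
      then show ?thesis
        using emeasure_compl[of "Pair p -` A" "k p"] sets_Pair1[OF A, of p] finite_measure_onD[OF k[OF p]]
          finite_measure_on_emeasure[OF k[OF p]] by simp
    qed
    then show ?case
      using m[OF sets.top] compl(2)
      by (subst measurable_cong[where g="\<lambda>p. emeasure (k p) (space N) - emeasure (k p) (Pair p -` A)"]) auto
  next
    case (union F)
    have F: "F i \<in> sets (X \<Otimes>\<^sub>M N)" for i using union(2) by (auto simp: sets_eq)
    have "emeasure (k p) (Pair p -` (\<Union>i. F i)) = (\<Sum>i. emeasure (k p) (Pair p -` F i))"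
      if p: "p \<in> space X" for p
      unfolding vimage_UN using union(1) sets_Pair1[OF F, of p] finite_measure_onD(2)[OF k[OF p]]
      by (intro suminf_emeasure[symmetric] disjoint_family_on_vimageI) auto
    then show ?case
      using union(3) by (subst measurable_cong[where g="\<lambda>p. \<Sum>i. emeasure (k p) (Pair p -` F i)"]) auto
  qed
qed

section \<open>Pushforwards and reversal of arcs\<close>

lemma finite_measure_on_distr:
  assumes "finite_measure_on N \<mu>" "f \<in> measurable N L"
  shows "finite_measure_on L (distr \<mu> L f)"
proof -
  have "f \<in> measurable \<mu> L"
    by (subst measurable_cong_sets[OF finite_measure_onD(2)[OF assms(1)] refl]) fact
  then show ?thesis
    using finite_measure.finite_measure_distr[OF finite_measure_onD(1)[OF assms(1)]]
    by (simp add: finite_measure_on_def)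
qed

lemma sets_Collect_mem:
  assumes "f \<in> measurable X N" "S \<in> sets N"
  shows "{x\<in>space X. f x \<in> S} \<in> sets X"
  using measurable_sets[OF assms] by (simp add: vimage_def Int_def conj_commute)

lemma emeasure_distr_Collect:
  assumes "f \<in> measurable X N" "S \<in> sets N"
  shows "emeasure (distr X N f) S = emeasure X {x\<in>space X. f x \<in> S}"
  unfolding emeasure_distr[OF assms] by (simp add: vimage_def Int_def conj_commute)

lemma swap_vimage:
  assumes "X \<in> sets (M \<Otimes>\<^sub>M M)"
  shows "(\<lambda>(x, y). (y, x)) -` X \<inter> space (M \<Otimes>\<^sub>M M) = X\<inverse>"
  using sets.sets_into_space[OF assms] by (auto simp: space_pair_measure)

lemma sets_converse_iff: "X\<inverse> \<in> sets (M \<Otimes>\<^sub>M M) \<longleftrightarrow> X \<in> sets (M \<Otimes>\<^sub>M M)"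
proof -
  have "X\<inverse> \<in> sets (M \<Otimes>\<^sub>M M)" if "X \<in> sets (M \<Otimes>\<^sub>M M)" for X
    using measurable_sets[OF measurable_pair_swap' that] by (simp only: swap_vimage[OF that])
  from this[of X] this[of "X\<inverse>", unfolded converse_converse] show ?thesis by blast
qed

lemma measure_converse:
  assumes \<mu>: "finite_measure_on (M \<Otimes>\<^sub>M M) \<mu>"
  shows "(\<lambda>X. measure \<mu> (X\<inverse>)) = measure (distr \<mu> (M \<Otimes>\<^sub>M M) (\<lambda>(x, y). (y, x)))"
proof
  fix X
  have swap: "(\<lambda>(x, y). (y, x)) \<in> measurable \<mu> (M \<Otimes>\<^sub>M M)"
    by (subst measurable_cong_sets[OF finite_measure_onD(2)[OF \<mu>] refl]) (rule measurable_pair_swap')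
  show "measure \<mu> (X\<inverse>) = measure (distr \<mu> (M \<Otimes>\<^sub>M M) (\<lambda>(x, y). (y, x))) X"
  proof (cases "X \<in> sets (M \<Otimes>\<^sub>M M)")
    case True
    then show ?thesis
      by (simp only: measure_distr[OF swap True] finite_measure_onD(3)[OF \<mu>] swap_vimage)
  next
    case False
    then show ?thesis by (simp add: measure_notin_sets finite_measure_onD(2)[OF \<mu>] sets_converse_iff)
  qed
qed

section \<open>Metrical functionals evaluated on loads\<close>

context
  fixes M :: "'a measure" and D :: "(('a \<times> 'a) set \<Rightarrow> real) \<Rightarrow> real"
  assumes D: "metrical M D"
begin

lemma metrical_add:
  "\<mu> \<in> signed_measures (M \<Otimes>\<^sub>M M) \<Longrightarrow> \<nu> \<in> signed_measures (M \<Otimes>\<^sub>M M) \<Longrightarrow> D (\<lambda>A. \<mu> A + \<nu> A) = D \<mu> + D \<nu>"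
  using D by (auto simp: metrical_def bounded_functional_def)

lemma metrical_diag:
  "\<mu> \<in> signed_measures (M \<Otimes>\<^sub>M M) \<Longrightarrow> (\<And>X. X \<in> sets (M \<Otimes>\<^sub>M M) \<Longrightarrow> X \<inter> Id = {} \<Longrightarrow> \<mu> X = 0) \<Longrightarrow> D \<mu> = 0"
  using D by (auto simp: metrical_def)

lemma metrical_triangle:
  "finite_measure_on (M \<Otimes>\<^sub>M M \<Otimes>\<^sub>M M) \<kappa> \<Longrightarrow>
    D (measure (distr \<kappa> (M \<Otimes>\<^sub>M M) (\<lambda>(x, y, z). (x, z)))) \<le>
    D (measure (distr \<kappa> (M \<Otimes>\<^sub>M M) (\<lambda>(x, y, z). (x, y)))) +
    D (measure (distr \<kappa> (M \<Otimes>\<^sub>M M) (\<lambda>(x, y, z). (y, z))))"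
  using D unfolding metrical_def by blast

text \<open>The triangle inequality for the law of \<open>(x, y, x)\<close>: its outer marginal sits
  on the diagonal, and the other two are \<mu> and its reversal, so
  \<open>0 \<le> 2 * D (measure \<mu>)\<close>.\<close>

lemma metrical_nonneg:
  assumes \<mu>: "finite_measure_on (M \<Otimes>\<^sub>M M) \<mu>"
  shows "0 \<le> D (measure \<mu>)"
proof -
  note [measurable_cong] = finite_measure_onD(2)[OF \<mu>]
  let ?f = "\<lambda>(x, y). (x, y, x)"
  let ?\<kappa> = "distr \<mu> (M \<Otimes>\<^sub>M M \<Otimes>\<^sub>M M) ?f"
  have \<kappa>: "finite_measure_on (M \<Otimes>\<^sub>M M \<Otimes>\<^sub>M M) ?\<kappa>"
    by (rule finite_measure_on_distr[OF \<mu>]) measurable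
  have 12: "distr ?\<kappa> (M \<Otimes>\<^sub>M M) (\<lambda>(x, y, z). (x, y)) = \<mu>"
    by (subst distr_distr) (auto simp: comp_def case_prod_beta' finite_measure_onD(2)[OF \<mu>] intro!: distr_id2)
  have "distr ?\<kappa> (M \<Otimes>\<^sub>M M) (\<lambda>(x, y, z). (y, z)) = distr \<mu> (M \<Otimes>\<^sub>M M) (\<lambda>(x, y). (y, x))"
    by (subst distr_distr) (auto simp: comp_def case_prod_beta')
  then have 23: "measure (distr ?\<kappa> (M \<Otimes>\<^sub>M M) (\<lambda>(x, y, z). (y, z))) = (\<lambda>X. measure \<mu> (X\<inverse>))"
    unfolding measure_converse[OF \<mu>] by simp
  have "measure (distr ?\<kappa> (M \<Otimes>\<^sub>M M) (\<lambda>(x, y, z). (x, z))) X = 0"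
    if "X \<in> sets (M \<Otimes>\<^sub>M M)" "X \<inter> Id = {}" for X
  proof -
    have "(\<lambda>(x, y, z). (x, z)) \<circ> ?f = (\<lambda>(x, y). (x, x :: 'a))" by auto
    then have eq: "distr ?\<kappa> (M \<Otimes>\<^sub>M M) (\<lambda>(x, y, z). (x, z)) = distr \<mu> (M \<Otimes>\<^sub>M M) (\<lambda>(x, y). (x, x))"
      by (subst distr_distr) (auto simp: comp_def case_prod_beta')
    have "(\<lambda>(x, y). (x, x)) -` X \<inter> space \<mu> = {}" using that by auto
    then show ?thesis unfolding eq using that(1) by (subst measure_distr) auto
  qed
  then have "D (measure (distr ?\<kappa> (M \<Otimes>\<^sub>M M) (\<lambda>(x, y, z). (x, z)))) = 0"
    by (intro metrical_diag measure_in_signed_measures finite_measure_on_distr[OF \<kappa>]) auto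
  moreover have "D (\<lambda>X. measure \<mu> (X\<inverse>)) = D (measure \<mu>)"
    using D measure_in_signed_measures[OF \<mu>] by (auto simp: metrical_def)
  ultimately show ?thesis using metrical_triangle[OF \<kappa>] unfolding 12 23 by simp
qed

text \<open>Let \<open>\<kappa>\<close> be the law of \<open>(x, u, v)\<close> where \<open>(x, y)\<close> is a demand and \<open>(u, v)\<close> an arc of its flow.
  By the flow condition \<open>\<kappa>\<^sup>1\<^sup>3 - \<kappa>\<^sup>1\<^sup>2\<close> is \<open>\<sigma>\<close> up to a measure on the diagonal, and \<open>\<kappa>\<^sup>2\<^sup>3\<close> is
  the load.\<close>

lemma metrical_demand_le_load:
  assumes \<Lambda>: "\<Lambda> \<in> loads M \<sigma>"
  shows "D (measure \<sigma>) \<le> D \<Lambda>"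
proof -
  let ?A3 = "M \<Otimes>\<^sub>M M \<Otimes>\<^sub>M M"
  obtain \<phi> where \<phi>: "multicommodity_flow M \<sigma> \<phi>"
    and fin: "finite_measure_on (M \<Otimes>\<^sub>M M) (total_load \<sigma> \<phi>)" and load: "\<Lambda> = measure (total_load \<sigma> \<phi>)"
    using loadsE[OF \<Lambda>] by metis
  note F = multicommodity_flowD[OF \<phi>]
  note \<sigma> = finite_measure_onD[OF F(1)]
  note [measurable_cong] = \<sigma>(2)
  let ?f = "\<lambda>p (u, v). (fst p, u, v)"
  let ?k = "\<lambda>p. distr (\<phi> p) ?A3 (?f p)"
  \<comment> \<open>The source of the demand enters the set that \<open>\<phi> p\<close> measures.
    Measurability for fixed sets is therefore not enough, and the section lemma is used.\<close>
  have sec: "(\<lambda>p. emeasure (\<phi> p) {q\<in>space (M \<Otimes>\<^sub>M M). (fst p, fst q, snd q) \<in> S}) \<in> borel_measurable \<sigma>"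
    if S[measurable]: "S \<in> sets ?A3" for S
  proof -
    let ?T = "{r\<in>space ((M \<Otimes>\<^sub>M M) \<Otimes>\<^sub>M (M \<Otimes>\<^sub>M M)). (fst (fst r), fst (snd r), snd (snd r)) \<in> S}"
    have "?T \<in> sets ((M \<Otimes>\<^sub>M M) \<Otimes>\<^sub>M (M \<Otimes>\<^sub>M M))"
      by (rule sets_Collect_mem[OF _ S]) measurable
    then have "(\<lambda>p. emeasure (\<phi> p) (Pair p -` ?T)) \<in> borel_measurable (M \<Otimes>\<^sub>M M)"
      by (rule measurable_emeasure_section[rotated 2]) (rule F(2,5), assumption)+
    also have "?this \<longleftrightarrow> (\<lambda>p. emeasure (\<phi> p) {q\<in>space (M \<Otimes>\<^sub>M M). (fst p, fst q, snd q) \<in> S}) \<in> borel_measurable (M \<Otimes>\<^sub>M M)"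
      by (intro measurable_cong arg_cong2[where f=emeasure]) (auto simp: space_pair_measure)
    finally show ?thesis by simp
  qed
  have k: "emeasure (?k p) S = emeasure (\<phi> p) {q\<in>space (M \<Otimes>\<^sub>M M). (fst p, fst q, snd q) \<in> S}"
    if p: "p \<in> space \<sigma>" and S: "S \<in> sets ?A3" for p S
  proof -
    have p': "p \<in> space (M \<Otimes>\<^sub>M M)" using p \<sigma>(3) by simp
    have "fst p \<in> space M" using p' by (auto simp: space_pair_measure)
    then have "?f p \<in> measurable (M \<Otimes>\<^sub>M M) ?A3" by measurable
    then have "?f p \<in> measurable (\<phi> p) ?A3"
      by (subst measurable_cong_sets[OF F(3)[OF p'] refl])
    then have "emeasure (?k p) S = emeasure (\<phi> p) (?f p -` S \<inter> space (\<phi> p))"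
      using S by (rule emeasure_distr)
    also have "?f p -` S \<inter> space (\<phi> p) = {q\<in>space (M \<Otimes>\<^sub>M M). (fst p, fst q, snd q) \<in> S}"
      unfolding finite_measure_onD(3)[OF F(2)[OF p']] by auto
    finally show ?thesis .
  qed
  define \<kappa> where "\<kappa> = mixture \<sigma> ?k ?A3"
  have \<kappa>: "emeasure \<kappa> S = (\<integral>\<^sup>+p. emeasure (\<phi> p) {q\<in>space (M \<Otimes>\<^sub>M M). (fst p, fst q, snd q) \<in> S} \<partial>\<sigma>)"
    if S: "S \<in> sets ?A3" for S
  proof -
    have "emeasure \<kappa> S = (\<integral>\<^sup>+p. emeasure (?k p) S \<partial>\<sigma>)"
      unfolding \<kappa>_def
    proof (rule emeasure_mixture[OF _ _ S])
      show "(\<lambda>p. emeasure (?k p) S) \<in> borel_measurable \<sigma>" if "S \<in> sets ?A3" for S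
        using sec[OF that] by (rule measurable_cong[THEN iffD2, rotated]) (rule k[OF _ that])
    qed simp
    also have "\<dots> = (\<integral>\<^sup>+p. emeasure (\<phi> p) {q\<in>space (M \<Otimes>\<^sub>M M). (fst p, fst q, snd q) \<in> S} \<partial>\<sigma>)"
      by (intro nn_integral_cong k S)
    finally show ?thesis .
  qed
  have sets_\<kappa>[measurable_cong]: "sets \<kappa> = sets ?A3" by (simp add: \<kappa>_def)
  have space_\<kappa>: "space \<kappa> = space M \<times> space M \<times> space M"
    using sets_eq_imp_space_eq[OF sets_\<kappa>] by (simp add: space_pair_measure)
  have "emeasure \<kappa> (space ?A3) = emeasure (total_load \<sigma> \<phi>) (space (M \<Otimes>\<^sub>M M))"
    unfolding \<kappa>[OF sets.top] emeasure_total_load[OF \<phi> sets.top]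
    by (intro nn_integral_cong arg_cong2[where f=emeasure]) (auto simp: \<sigma>(3) space_pair_measure)
  then have \<kappa>_fin: "finite_measure_on ?A3 \<kappa>"
    using finite_measure_on_emeasure[OF fin] by (intro finite_measure_onI sets_\<kappa>) simp
  let ?\<kappa>12 = "distr \<kappa> (M \<Otimes>\<^sub>M M) (\<lambda>(x, y, z). (x, y))"
  let ?\<kappa>13 = "distr \<kappa> (M \<Otimes>\<^sub>M M) (\<lambda>(x, y, z). (x, z))"
  let ?\<kappa>23 = "distr \<kappa> (M \<Otimes>\<^sub>M M) (\<lambda>(x, y, z). (y, z))"
  let ?d = "distr \<sigma> (M \<Otimes>\<^sub>M M) (\<lambda>(x, y). (x, x))"
  have m: "(\<lambda>(x, y, z). (x, y)) \<in> measurable \<kappa> (M \<Otimes>\<^sub>M M)" "(\<lambda>(x, y, z). (x, z)) \<in> measurable \<kappa> (M \<Otimes>\<^sub>M M)"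
    "(\<lambda>(x, y, z). (y, z)) \<in> measurable \<kappa> (M \<Otimes>\<^sub>M M)" by measurable
  have space_eq: "space \<kappa> = space ?A3" using sets_\<kappa> by (rule sets_eq_imp_space_eq)
  have fins: "finite_measure_on (M \<Otimes>\<^sub>M M) ?\<kappa>12" "finite_measure_on (M \<Otimes>\<^sub>M M) ?\<kappa>13"
    "finite_measure_on (M \<Otimes>\<^sub>M M) ?\<kappa>23" "finite_measure_on (M \<Otimes>\<^sub>M M) ?d"
    by (rule finite_measure_on_distr[OF \<kappa>_fin] finite_measure_on_distr[OF F(1)]; measurable)+
  have "?\<kappa>23 = total_load \<sigma> \<phi>"
  proof (rule measure_eqI)
    fix S assume "S \<in> sets ?\<kappa>23"
    then have S[measurable]: "S \<in> sets (M \<Otimes>\<^sub>M M)" by simp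
    have "emeasure ?\<kappa>23 S = emeasure \<kappa> {r\<in>space ?A3. (fst (snd r), snd (snd r)) \<in> S}"
      unfolding emeasure_distr_Collect[OF m(3) S] by (simp add: case_prod_beta' space_eq)
    also have "\<dots> = (\<integral>\<^sup>+p. emeasure (\<phi> p) S \<partial>\<sigma>)"
    proof (subst \<kappa>)
      show "{r\<in>space ?A3. (fst (snd r), snd (snd r)) \<in> S} \<in> sets ?A3"
        by (rule sets_Collect_mem[OF _ S]) measurable
      have "{q\<in>space (M \<Otimes>\<^sub>M M). (fst p, fst q, snd q) \<in> {r\<in>space ?A3. (fst (snd r), snd (snd r)) \<in> S}} = S"
        if "p \<in> space \<sigma>" for p
        using sets.sets_into_space[OF S] that by (auto simp: \<sigma>(3) space_pair_measure)
      then show "(\<integral>\<^sup>+p. emeasure (\<phi> p) {q\<in>space (M \<Otimes>\<^sub>M M). (fst p, fst q, snd q) \<in>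
          {r\<in>space ?A3. (fst (snd r), snd (snd r)) \<in> S}} \<partial>\<sigma>) = (\<integral>\<^sup>+p. emeasure (\<phi> p) S \<partial>\<sigma>)"
        by (intro nn_integral_cong) simp
    qed
    finally show "emeasure ?\<kappa>23 S = emeasure (total_load \<sigma> \<phi>) S"
      by (simp add: emeasure_total_load[OF \<phi> S])
  qed (simp add: sets_total_load[OF \<phi>])
  then have 23: "measure ?\<kappa>23 = \<Lambda>" by (simp add: load)
  \<comment> \<open>The flow condition for the section of \<open>S\<close> at the source, integrated
    over all demands. The sink terms add up to \<sigma>, and the source terms to \<open>?d\<close>,
    the law of \<open>(x, x)\<close>, which lives on the diagonal.\<close>
  have "emeasure ?\<kappa>13 S + emeasure ?d S = emeasure ?\<kappa>12 S + emeasure \<sigma> S" if S[measurable]: "S \<in> sets (M \<Otimes>\<^sub>M M)" for S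
  proof -
    let ?A = "\<lambda>p. Pair (fst p) -` S"
    let ?S12 = "{r\<in>space ?A3. (fst r, fst (snd r)) \<in> S}" and ?S13 = "{r\<in>space ?A3. (fst r, snd (snd r)) \<in> S}"
    let ?B12 = "\<lambda>p. {q\<in>space (M \<Otimes>\<^sub>M M). (fst p, fst q, snd q) \<in> ?S12}"
    let ?B13 = "\<lambda>p. {q\<in>space (M \<Otimes>\<^sub>M M). (fst p, fst q, snd q) \<in> ?S13}"
    have Ssub: "S \<subseteq> space M \<times> space M" using sets.sets_into_space[OF S] by (simp add: space_pair_measure)
    have S12: "?S12 \<in> sets ?A3" and S13: "?S13 \<in> sets ?A3"
      by (rule sets_Collect_mem[OF _ S]; measurable)+
    have "emeasure ?\<kappa>12 S = emeasure \<kappa> ?S12"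
      unfolding emeasure_distr_Collect[OF m(1) S] by (simp add: case_prod_beta' space_eq)
    moreover have "emeasure ?\<kappa>13 S = emeasure \<kappa> ?S13"
      unfolding emeasure_distr_Collect[OF m(2) S] by (simp add: case_prod_beta' space_eq)
    moreover have "emeasure ?d S = (\<integral>\<^sup>+p. indicator (?A p) (fst p) \<partial>\<sigma>)"
    proof -
      have "emeasure ?d S = (\<integral>\<^sup>+p. indicator ((\<lambda>(x, y). (x, x)) -` S \<inter> space \<sigma>) p \<partial>\<sigma>)"
        by (subst emeasure_distr) auto
      also have "\<dots> = (\<integral>\<^sup>+p. indicator (?A p) (fst p) \<partial>\<sigma>)"
        by (intro nn_integral_cong) (auto split: split_indicator)
      finally show ?thesis .
    qed
    moreover have "emeasure \<sigma> S = (\<integral>\<^sup>+p. indicator (?A p) (snd p) \<partial>\<sigma>)"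
    proof -
      have "emeasure \<sigma> S = (\<integral>\<^sup>+p. indicator S p \<partial>\<sigma>)" using S \<sigma>(2) by simp
      also have "\<dots> = (\<integral>\<^sup>+p. indicator (?A p) (snd p) \<partial>\<sigma>)"
        by (intro nn_integral_cong) (auto split: split_indicator)
      finally show ?thesis .
    qed
    moreover have "(\<integral>\<^sup>+p. emeasure (\<phi> p) (?B13 p) \<partial>\<sigma>) + (\<integral>\<^sup>+p. indicator (?A p) (fst p) \<partial>\<sigma>)
        = (\<integral>\<^sup>+p. emeasure (\<phi> p) (?B12 p) \<partial>\<sigma>) + (\<integral>\<^sup>+p. indicator (?A p) (snd p) \<partial>\<sigma>)"
    proof -
      have i: "(\<lambda>p. indicator (?A p) (fst p) :: ennreal) \<in> borel_measurable \<sigma>"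
        "(\<lambda>p. indicator (?A p) (snd p) :: ennreal) \<in> borel_measurable \<sigma>"
        by (simp_all add: indicator_def)
      have "emeasure (\<phi> p) (?B13 p) + indicator (?A p) (fst p)
          = emeasure (\<phi> p) (?B12 p) + indicator (?A p) (snd p)" if p: "p \<in> space \<sigma>" for p
      proof -
        have p': "p \<in> space (M \<Otimes>\<^sub>M M)" using p \<sigma>(3) by simp
        have "?B12 p = ?A p \<times> space M" "?B13 p = space M \<times> ?A p"
          using p' Ssub by (auto simp: space_pair_measure)
        then show ?thesis using F(4)[OF p' sets_Pair1[OF S]] by simp
      qed
      then have "(\<integral>\<^sup>+p. emeasure (\<phi> p) (?B13 p) + indicator (?A p) (fst p) \<partial>\<sigma>)
          = (\<integral>\<^sup>+p. emeasure (\<phi> p) (?B12 p) + indicator (?A p) (snd p) \<partial>\<sigma>)"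
        by (rule nn_integral_cong)
      then show ?thesis by (simp only: nn_integral_add[OF sec[OF S13] i(1)] nn_integral_add[OF sec[OF S12] i(2)])
    qed
    ultimately show ?thesis by (simp only: \<kappa>[OF S12] \<kappa>[OF S13])
  qed
  then have "measure ?\<kappa>13 S + measure ?d S = measure ?\<kappa>12 S + measure \<sigma> S" for S
  proof (cases "S \<in> sets (M \<Otimes>\<^sub>M M)")
    case True
    then have "ennreal (measure ?\<kappa>13 S + measure ?d S) = ennreal (measure ?\<kappa>12 S + measure \<sigma> S)"
      using \<open>\<And>S. S \<in> sets (M \<Otimes>\<^sub>M M) \<Longrightarrow> emeasure ?\<kappa>13 S + emeasure ?d S = emeasure ?\<kappa>12 S + emeasure \<sigma> S\<close>[OF True]
      by (simp add: finite_measure_on_emeasure[OF fins(1)] finite_measure_on_emeasure[OF fins(2)]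
          finite_measure_on_emeasure[OF fins(4)] finite_measure_on_emeasure[OF F(1)])
    then show ?thesis by (simp del: ennreal_plus)
  qed (simp add: measure_notin_sets \<sigma>(2))
  then have "(\<lambda>S. measure ?\<kappa>13 S + measure ?d S) = (\<lambda>S. measure ?\<kappa>12 S + measure \<sigma> S)" by blast
  then have "D (measure ?\<kappa>13) + D (measure ?d) = D (measure ?\<kappa>12) + D (measure \<sigma>)"
    using fins F(1) by (simp add: metrical_add[symmetric] measure_in_signed_measures)
  moreover have "D (measure ?d) = 0"
  proof (rule metrical_diag[OF measure_in_signed_measures[OF fins(4)]])
    fix X assume X: "X \<in> sets (M \<Otimes>\<^sub>M M)" "X \<inter> Id = {}"
    have "(\<lambda>(x, y). (x, x)) -` X \<inter> space \<sigma> = {}" using X(2) by auto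
    then show "measure ?d X = 0" using X(1) by (subst measure_distr) auto
  qed
  ultimately show ?thesis using metrical_triangle[OF \<kappa>_fin] unfolding 23 by simp
qed

end

text \<open>Splicing: by noise outsourcing, an arc \<open>(x, z)\<close> of \<open>\<kappa>\<^sup>1\<^sup>3\<close> is sent through a random midpoint
  \<open>Z ((x, z), w)\<close>, first along the flow for \<open>\<kappa>\<^sup>1\<^sup>2\<close> and then along the flow for \<open>\<kappa>\<^sup>2\<^sup>3\<close>. The
  resulting measure is infinite only for a negligible set of \<open>(x, z)\<close>, which are routed directly.\<close>

lemma loads_triangle:
  assumes sb: "standard_borel M" and ne: "space M \<noteq> {}"
    and \<kappa>: "finite_measure_on (M \<Otimes>\<^sub>M M \<Otimes>\<^sub>M M) \<kappa>"
    and \<Lambda>1: "\<Lambda>1 \<in> loads M (distr \<kappa> (M \<Otimes>\<^sub>M M) (\<lambda>(x, y, z). (x, y)))"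
    and \<Lambda>2: "\<Lambda>2 \<in> loads M (distr \<kappa> (M \<Otimes>\<^sub>M M) (\<lambda>(x, y, z). (y, z)))"
  shows "(\<lambda>S. \<Lambda>1 S + \<Lambda>2 S) \<in> loads M (distr \<kappa> (M \<Otimes>\<^sub>M M) (\<lambda>(x, y, z). (x, z)))"
proof -
  note [measurable_cong] = finite_measure_onD(2)[OF \<kappa>]
  let ?A2 = "M \<Otimes>\<^sub>M M"
  let ?\<kappa>12 = "distr \<kappa> ?A2 (\<lambda>(x, y, z). (x, y))"
  let ?\<kappa>23 = "distr \<kappa> ?A2 (\<lambda>(x, y, z). (y, z))"
  define \<nu> where "\<nu> = distr \<kappa> ?A2 (\<lambda>(x, y, z). (x, z))"
  have \<nu>: "finite_measure_on ?A2 \<nu>"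
    unfolding \<nu>_def by (rule finite_measure_on_distr[OF \<kappa>]) measurable
  note [measurable_cong] = finite_measure_onD(2)[OF \<nu>]
  note space_\<nu> = finite_measure_onD(3)[OF \<nu>]
  interpret U: prob_space unif by (rule prob_space_unif)
  obtain \<phi>1 where \<phi>1: "multicommodity_flow M ?\<kappa>12 \<phi>1"
    and int1: "\<And>S. S \<in> sets ?A2 \<Longrightarrow> (\<integral>\<^sup>+p. emeasure (\<phi>1 p) S \<partial>?\<kappa>12) = ennreal (\<Lambda>1 S)"
    using loadsE[OF \<Lambda>1] by metis
  obtain \<phi>2 where \<phi>2: "multicommodity_flow M ?\<kappa>23 \<phi>2"
    and int2: "\<And>S. S \<in> sets ?A2 \<Longrightarrow> (\<integral>\<^sup>+p. emeasure (\<phi>2 p) S \<partial>?\<kappa>23) = ennreal (\<Lambda>2 S)"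
    using loadsE[OF \<Lambda>2] by metis
  note D1 = multicommodity_flowD[OF \<phi>1] and D2 = multicommodity_flowD[OF \<phi>2]
  have m12: "(\<lambda>(x, y, z). (x, y)) \<in> measurable \<kappa> ?A2" and m23: "(\<lambda>(x, y, z). (y, z)) \<in> measurable \<kappa> ?A2"
    by measurable
  \<comment> \<open>The endpoints form the given coordinate and the midpoint comes last, because the
    last coordinate is the one generated from noise.\<close>
  let ?swap = "\<lambda>(x, y, z). ((x, z), y)"
  let ?\<kappa>' = "distr \<kappa> (?A2 \<Otimes>\<^sub>M M) ?swap"
  have swap: "?swap \<in> measurable \<kappa> (?A2 \<Otimes>\<^sub>M M)" by measurable
  have fin': "finite_measure ?\<kappa>'"
    by (rule finite_measure.finite_measure_distr[OF finite_measure_onD(1)[OF \<kappa>] swap])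
  have fst': "distr ?\<kappa>' ?A2 fst = \<nu>"
    unfolding \<nu>_def by (subst distr_distr[OF _ swap]) (auto simp: comp_def case_prod_beta')
  have sets': "sets ?\<kappa>' = sets (?A2 \<Otimes>\<^sub>M M)" by simp
  from noise_outsourcing[OF sb ne fin' sets', unfolded fst'] obtain Z where Z[measurable]: "Z \<in> measurable (?A2 \<Otimes>\<^sub>M unif) M"
    and Z_distr: "distr (\<nu> \<Otimes>\<^sub>M unif) (?A2 \<Otimes>\<^sub>M M) (\<lambda>(p, w). (p, Z (p, w))) = ?\<kappa>'"
    by blast
  have Z_space: "Z (p, w) \<in> space M" if "p \<in> space ?A2" for p w
    using measurable_space[OF Z, of "(p, w)"] that by (simp add: space_pair_measure)
  have integral: "(\<integral>\<^sup>+p. (\<integral>\<^sup>+w. h (p, Z (p, w)) \<partial>unif) \<partial>\<nu>) = (\<integral>\<^sup>+r. h (?swap r) \<partial>\<kappa>)"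
    if h[measurable]: "h \<in> borel_measurable (?A2 \<Otimes>\<^sub>M M)" for h :: "_ \<Rightarrow> ennreal"
  proof -
    have m: "(\<lambda>(p, w). (p, Z (p, w))) \<in> measurable (\<nu> \<Otimes>\<^sub>M unif) (?A2 \<Otimes>\<^sub>M M)" by measurable
    have "(\<integral>\<^sup>+r. h (?swap r) \<partial>\<kappa>) = (\<integral>\<^sup>+q. h q \<partial>?\<kappa>')"
      by (rule nn_integral_distr[OF swap, symmetric]) measurable
    also have "\<dots> = (\<integral>\<^sup>+q. h ((\<lambda>(p, w). (p, Z (p, w))) q) \<partial>(\<nu> \<Otimes>\<^sub>M unif))"
      unfolding Z_distr[symmetric] by (rule nn_integral_distr[OF m]) measurable
    also have "\<dots> = (\<integral>\<^sup>+p. (\<integral>\<^sup>+w. h (p, Z (p, w)) \<partial>unif) \<partial>\<nu>)"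
      by (subst U.nn_integral_fst[symmetric]) auto
    finally show ?thesis by simp
  qed
  have e1: "(\<lambda>q. emeasure (\<phi>1 (fst (fst q), snd q)) S) \<in> borel_measurable (?A2 \<Otimes>\<^sub>M M)"
    and e2: "(\<lambda>q. emeasure (\<phi>2 (snd q, snd (fst q))) S) \<in> borel_measurable (?A2 \<Otimes>\<^sub>M M)"
    if "S \<in> sets ?A2" for S
    by (rule measurable_compose[OF _ D1(5)[OF that]] measurable_compose[OF _ D2(5)[OF that]]; measurable)+
  let ?g = "\<lambda>S p w. emeasure (\<phi>1 (fst p, Z (p, w))) S + emeasure (\<phi>2 (Z (p, w), snd p)) S"
  have g_meas: "(\<lambda>(p, w). ?g S p w) \<in> borel_measurable (?A2 \<Otimes>\<^sub>M unif)" if S: "S \<in> sets ?A2" for S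
  proof -
    have "(\<lambda>q. (fst q, Z q)) \<in> measurable (?A2 \<Otimes>\<^sub>M unif) (?A2 \<Otimes>\<^sub>M M)" by measurable
    from measurable_compose[OF this borel_measurable_add[OF e1[OF S] e2[OF S]]]
    show ?thesis by (simp add: case_prod_beta')
  qed
  have g_int: "(\<lambda>p. \<integral>\<^sup>+w. ?g S p w \<partial>unif) \<in> borel_measurable ?A2" if S: "S \<in> sets ?A2" for S
    using U.borel_measurable_nn_integral_fst[OF g_meas[OF S]] by simp
  have g_total: "(\<integral>\<^sup>+p. (\<integral>\<^sup>+w. ?g S p w \<partial>unif) \<partial>\<nu>) = ennreal (\<Lambda>1 S + \<Lambda>2 S)" if S: "S \<in> sets ?A2" for S
  proof -
    have "(\<integral>\<^sup>+p. (\<integral>\<^sup>+w. ?g S p w \<partial>unif) \<partial>\<nu>)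
        = (\<integral>\<^sup>+r. emeasure (\<phi>1 ((\<lambda>(x, y, z). (x, y)) r)) S + emeasure (\<phi>2 ((\<lambda>(x, y, z). (y, z)) r)) S \<partial>\<kappa>)"
      using integral[OF borel_measurable_add[OF e1[OF S] e2[OF S]]] by (simp add: case_prod_beta')
    also have "\<dots> = (\<integral>\<^sup>+r. emeasure (\<phi>1 ((\<lambda>(x, y, z). (x, y)) r)) S \<partial>\<kappa>)
        + (\<integral>\<^sup>+r. emeasure (\<phi>2 ((\<lambda>(x, y, z). (y, z)) r)) S \<partial>\<kappa>)"
      by (rule nn_integral_add; rule measurable_compose[OF _ D1(5)[OF S]] measurable_compose[OF _ D2(5)[OF S]]; measurable)
    also have "(\<integral>\<^sup>+r. emeasure (\<phi>1 ((\<lambda>(x, y, z). (x, y)) r)) S \<partial>\<kappa>) = (\<integral>\<^sup>+p. emeasure (\<phi>1 p) S \<partial>?\<kappa>12)"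
      by (rule nn_integral_distr[OF m12 multicommodity_flow_measurable[OF \<phi>1 sets_distr S], symmetric])
    also have "(\<integral>\<^sup>+r. emeasure (\<phi>2 ((\<lambda>(x, y, z). (y, z)) r)) S \<partial>\<kappa>) = (\<integral>\<^sup>+p. emeasure (\<phi>2 p) S \<partial>?\<kappa>23)"
      by (rule nn_integral_distr[OF m23 multicommodity_flow_measurable[OF \<phi>2 sets_distr S], symmetric])
    finally show ?thesis
      using loads_nonneg[OF \<Lambda>1] loads_nonneg[OF \<Lambda>2] unfolding int1[OF S] int2[OF S] by simp
  qed
  define \<phi>' where "\<phi>' p = mixture unif (\<lambda>w. lincomb 1 (\<phi>1 (fst p, Z (p, w))) 1 (\<phi>2 (Z (p, w), snd p))) ?A2" for p
  have \<phi>': "emeasure (\<phi>' p) S = (\<integral>\<^sup>+w. ?g S p w \<partial>unif)" if p: "p \<in> space ?A2" and S: "S \<in> sets ?A2" for p S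
  proof -
    have sp: "(fst p, Z (p, w)) \<in> space ?A2" "(Z (p, w), snd p) \<in> space ?A2" for w
      using p Z_space[OF p, of w] by (auto simp: space_pair_measure)
    have em: "emeasure (lincomb 1 (\<phi>1 (fst p, Z (p, w))) 1 (\<phi>2 (Z (p, w), snd p))) S = ?g S p w"
      if "S \<in> sets ?A2" for S w
      using that by (subst emeasure_lincomb) (simp_all add: D1(3)[OF sp(1)] D2(3)[OF sp(2)])
    have "(\<lambda>w. ?g S p w) \<in> borel_measurable unif" if "S \<in> sets ?A2" for S
      using measurable_compose[OF measurable_Pair1'[OF p, of unif] g_meas[OF that]] by simp
    then show ?thesis
      unfolding \<phi>'_def by (subst emeasure_mixture[OF _ _ S]) (simp_all add: em S D1(3)[OF sp(1)])
  qed
  let ?good = "\<lambda>p. emeasure (\<phi>' p) (space ?A2) < \<infinity>"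
  define \<phi> where "\<phi> p = (if ?good p then \<phi>' p else return ?A2 p)" for p
  have \<phi>'_meas: "(\<lambda>p. emeasure (\<phi>' p) S) \<in> borel_measurable ?A2" if S: "S \<in> sets ?A2" for S
    using g_int[OF S] by (rule measurable_cong[THEN iffD2, rotated]) (rule \<phi>'[OF _ S])
  have ae: "AE p in \<nu>. ?good p"
  proof -
    have m: "(\<lambda>p. emeasure (\<phi>' p) (space ?A2)) \<in> borel_measurable \<nu>"
      by (subst measurable_cong_sets[OF finite_measure_onD(2)[OF \<nu>] refl]) (rule \<phi>'_meas[OF sets.top])
    have "(\<integral>\<^sup>+p. emeasure (\<phi>' p) (space ?A2) \<partial>\<nu>) = (\<integral>\<^sup>+p. (\<integral>\<^sup>+w. ?g (space ?A2) p w \<partial>unif) \<partial>\<nu>)"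
      by (intro nn_integral_cong \<phi>') (simp_all add: space_\<nu>)
    then have "(\<integral>\<^sup>+p. emeasure (\<phi>' p) (space ?A2) \<partial>\<nu>) \<noteq> \<infinity>"
      by (simp only: g_total[OF sets.top]) simp
    from nn_integral_PInf_AE[OF m this] show ?thesis by (simp add: less_top)
  qed
  have "(\<lambda>S. \<Lambda>1 S + \<Lambda>2 S) \<in> loads M \<nu>"
  proof (rule loadsI)
    show "multicommodity_flow M \<nu> \<phi>"
    proof (rule multicommodity_flowI[OF \<nu>])
      fix p assume p: "p \<in> space ?A2"
      show "sets (\<phi> p) = sets ?A2" by (simp add: \<phi>_def \<phi>'_def)
      show "emeasure (\<phi> p) (space ?A2) < \<infinity>" using p by (simp add: \<phi>_def)
      fix A assume A: "A \<in> sets M"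
      have sets: "A \<times> space M \<in> sets ?A2" "space M \<times> A \<in> sets ?A2" using A by auto
      have "emeasure (\<phi>' p) (A \<times> space M) + indicator A (snd p) = emeasure (\<phi>' p) (space M \<times> A) + indicator A (fst p)"
      proof -
        have m: "(\<lambda>w. ?g S p w) \<in> borel_measurable unif" if "S \<in> sets ?A2" for S
          using measurable_compose[OF measurable_Pair1'[OF p, of unif] g_meas[OF that]] by simp
        have "?g (A \<times> space M) p w + indicator A (snd p) = ?g (space M \<times> A) p w + indicator A (fst p)" for w
        proof -
          have sp: "(fst p, Z (p, w)) \<in> space ?A2" "(Z (p, w), snd p) \<in> space ?A2"
            using p Z_space[OF p, of w] by (auto simp: space_pair_measure)
          \<comment> \<open>The midpoint is the sink of the first flow and the source of the second.
            Its term is added to both sides and then cancelled, which is legitimate because it is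
            finite.\<close>
          let ?i = "indicator A (Z (p, w)) :: ennreal"
          have "?i + (?g (A \<times> space M) p w + indicator A (snd p))
              = (emeasure (\<phi>1 (fst p, Z (p, w))) (A \<times> space M) + ?i)
                + (emeasure (\<phi>2 (Z (p, w), snd p)) (A \<times> space M) + indicator A (snd p))"
            by (simp only: ac_simps)
          also have "\<dots> = (emeasure (\<phi>1 (fst p, Z (p, w))) (space M \<times> A) + indicator A (fst p))
                + (emeasure (\<phi>2 (Z (p, w), snd p)) (space M \<times> A) + ?i)"
            using D1(4)[OF sp(1) A] D2(4)[OF sp(2) A] by simp
          also have "\<dots> = ?i + (?g (space M \<times> A) p w + indicator A (fst p))" by (simp only: ac_simps)
          finally have "?i = \<infinity> \<or> ?thesis" by (simp only: ennreal_add_left_cancel infinity_ennreal_def)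
          moreover have "?i \<noteq> \<infinity>" by (simp add: indicator_def)
          ultimately show ?thesis by blast
        qed
        then have "(\<integral>\<^sup>+w. ?g (A \<times> space M) p w + indicator A (snd p) \<partial>unif)
            = (\<integral>\<^sup>+w. ?g (space M \<times> A) p w + indicator A (fst p) \<partial>unif)" by simp
        then show ?thesis
          using U.emeasure_space_1
          by (simp add: \<phi>'[OF p sets(1)] \<phi>'[OF p sets(2)] nn_integral_add[OF m[OF sets(1)]] nn_integral_add[OF m[OF sets(2)]])
      qed
      then show "emeasure (\<phi> p) (A \<times> space M) + indicator A (snd p) = emeasure (\<phi> p) (space M \<times> A) + indicator A (fst p)"
        using multicommodity_flowD(4)[OF return_flow[OF \<nu>] p A] by (simp add: \<phi>_def)
    next
      fix S assume S[measurable]: "S \<in> sets ?A2"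
      note [measurable] = \<phi>'_meas[OF S] \<phi>'_meas[OF sets.top]
      have "(\<lambda>p. if ?good p then emeasure (\<phi>' p) S else indicator S p) \<in> borel_measurable ?A2" by measurable
      then show "(\<lambda>p. emeasure (\<phi> p) S) \<in> borel_measurable ?A2"
        by (simp add: \<phi>_def if_distrib[of "\<lambda>m. emeasure m S"] cong: if_cong)
    qed
    fix S assume S: "S \<in> sets ?A2"
    have "(\<integral>\<^sup>+p. emeasure (\<phi> p) S \<partial>\<nu>) = (\<integral>\<^sup>+p. emeasure (\<phi>' p) S \<partial>\<nu>)"
      using ae by (intro nn_integral_cong_AE) (auto simp: \<phi>_def)
    also have "\<dots> = (\<integral>\<^sup>+p. (\<integral>\<^sup>+w. ?g S p w \<partial>unif) \<partial>\<nu>)"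
      by (intro nn_integral_cong \<phi>' S) (simp add: space_\<nu>)
    finally show "(\<integral>\<^sup>+p. emeasure (\<phi> p) S \<partial>\<nu>) = ennreal (\<Lambda>1 S + \<Lambda>2 S)" by (simp only: g_total[OF S])
  qed (use loads_nonneg[OF \<Lambda>1] loads_nonneg[OF \<Lambda>2] loads_outside[OF \<Lambda>1] loads_outside[OF \<Lambda>2] in auto)
  then show ?thesis by (simp add: \<nu>_def)
qed

section \<open>Overload and separation\<close>

text \<open>The one-block partition already bounds the supremum of the excess over all measurable
  sets; nonemptiness of the space makes that block admissible. The excess on the whole space shows
  that the load is finite.\<close>

lemma bounded_overload_imp:
  assumes \<phi>: "multicommodity_flow M \<sigma> \<phi>" and \<psi>: "finite_measure_on (M \<Otimes>\<^sub>M M) \<psi>"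
    and ne: "space M \<noteq> {}" and less: "overload \<sigma> \<phi> \<psi> < ereal \<epsilon>"
  shows "measure (total_load \<sigma> \<phi>) \<in> loads M \<sigma>"
    "pos_norm (M \<Otimes>\<^sub>M M) (\<lambda>A. measure (total_load \<sigma> \<phi>) A - measure \<psi> A) \<le> \<epsilon>"
proof -
  let ?A2 = "M \<Otimes>\<^sub>M M"
  let ?\<eta> = "\<lambda>S. enn2ereal (emeasure (total_load \<sigma> \<phi>) S) - enn2ereal (emeasure \<psi> S)"
  have ne': "space \<psi> \<noteq> {}" using ne finite_measure_onD(3)[OF \<psi>] by (simp add: space_pair_measure)
  have le: "?\<eta> T \<le> ereal \<epsilon>" if T: "T \<in> sets ?A2" for T
  proof -
    have "?\<eta> T \<le> positive_part \<psi> ?\<eta> (space \<psi>)"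
      unfolding positive_part_def using T finite_measure_onD[OF \<psi>] sets.sets_into_space[OF T]
      by (intro SUP_upper) auto
    also have "\<dots> \<le> (\<Sum>A\<in>{space \<psi>}. \<bar>positive_part \<psi> ?\<eta> A\<bar>)"
    proof -
      have "x \<le> \<bar>x\<bar>" for x :: ereal by (cases x) auto
      then show ?thesis by simp
    qed
    also have "\<dots> \<le> overload \<sigma> \<phi> \<psi>"
      unfolding overload_def total_variation_def
      using ne' by (intro SUP_upper) (auto simp: partition_on_def)
    finally show ?thesis using less by simp
  qed
  have "emeasure (total_load \<sigma> \<phi>) (space ?A2) < \<infinity>"
    using le[OF sets.top] unfolding finite_measure_on_emeasure[OF \<psi>]
    by (cases "emeasure (total_load \<sigma> \<phi>) (space ?A2)") (auto simp: enn2ereal_ennreal)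
  then have fin: "finite_measure_on ?A2 (total_load \<sigma> \<phi>)"
    by (intro finite_measure_onI sets_total_load[OF \<phi>])
  then show "measure (total_load \<sigma> \<phi>) \<in> loads M \<sigma>" using \<phi> by (auto simp: loads_def finite_measure_on_def)
  show "pos_norm ?A2 (\<lambda>A. measure (total_load \<sigma> \<phi>) A - measure \<psi> A) \<le> \<epsilon>"
    using le by (intro pos_norm_least)
      (simp add: finite_measure_on_emeasure[OF \<psi>] finite_measure_on_emeasure[OF fin] enn2ereal_ennreal)
qed

text \<open>The positive Jordan part of load minus \<psi> dominates \<open>positive_part\<close> on
  every set, and its total variation is at most its mass.\<close>

lemma overload_le_pos_norm:
  assumes fin: "finite_measure_on (M \<Otimes>\<^sub>M M) (total_load \<sigma> \<phi>)" and \<psi>: "finite_measure_on (M \<Otimes>\<^sub>M M) \<psi>"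
  shows "overload \<sigma> \<phi> \<psi> \<le> ereal (pos_norm (M \<Otimes>\<^sub>M M) (\<lambda>A. measure (total_load \<sigma> \<phi>) A - measure \<psi> A))"
proof -
  let ?A2 = "M \<Otimes>\<^sub>M M"
  let ?\<eta> = "\<lambda>A. measure (total_load \<sigma> \<phi>) A - measure \<psi> A"
  have "?\<eta> \<in> signed_measures ?A2"
    using fin \<psi> by (intro signed_measures_diff measure_in_signed_measures)
  then obtain \<alpha> \<beta> where \<alpha>: "finite_measure_on ?A2 \<alpha>" and \<beta>: "finite_measure_on ?A2 \<beta>"
    and eq: "?\<eta> = (\<lambda>A. measure \<alpha> A - measure \<beta> A)" and le: "measure \<alpha> (space ?A2) \<le> pos_norm ?A2 ?\<eta>"
    by (rule jordan_decomposition)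
  interpret \<alpha>: finite_measure \<alpha> by (rule finite_measure_onD[OF \<alpha>])
  have \<eta>_eq: "enn2ereal (emeasure (total_load \<sigma> \<phi>) S) - enn2ereal (emeasure \<psi> S) = ereal (?\<eta> S)" for S
    by (simp add: finite_measure_on_emeasure[OF \<psi>] finite_measure_on_emeasure[OF fin] enn2ereal_ennreal)
  have pp: "\<bar>positive_part \<psi> (\<lambda>S. ereal (?\<eta> S)) S\<bar> \<le> ereal (measure \<alpha> S)" if S: "S \<in> sets ?A2" for S
  proof -
    have "ereal (?\<eta> {}) \<le> positive_part \<psi> (\<lambda>S. ereal (?\<eta> S)) S"
      unfolding positive_part_def by (intro SUP_upper) auto
    moreover have "positive_part \<psi> (\<lambda>S. ereal (?\<eta> S)) S \<le> ereal (measure \<alpha> S)"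
      unfolding positive_part_def
    proof (rule SUP_least)
      fix T assume "T \<in> {T \<in> sets \<psi>. T \<subseteq> S}"
      then have "measure \<alpha> T \<le> measure \<alpha> S"
        using S finite_measure_onD(2)[OF \<alpha>] by (intro \<alpha>.finite_measure_mono) auto
      moreover have "?\<eta> T = measure \<alpha> T - measure \<beta> T" by (rule fun_cong[OF eq])
      ultimately have "?\<eta> T \<le> measure \<alpha> S" using measure_nonneg[of \<beta> T] by linarith
      then show "ereal (?\<eta> T) \<le> ereal (measure \<alpha> S)" by simp
    qed
    ultimately show ?thesis by (simp add: zero_ereal_def[symmetric])
  qed
  have "overload \<sigma> \<phi> \<psi> \<le> ereal (measure \<alpha> (space ?A2))"
    unfolding overload_def \<eta>_eq total_variation_def
  proof (rule SUP_least, clarify)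
    fix P assume P: "finite P" "P \<subseteq> sets \<psi>" "partition_on (space \<psi>) P"
    have "(\<Sum>A\<in>P. \<bar>positive_part \<psi> (\<lambda>S. ereal (?\<eta> S)) A\<bar>) \<le> (\<Sum>A\<in>P. ereal (measure \<alpha> A))"
      using P finite_measure_onD(2)[OF \<psi>] by (intro sum_mono pp) auto
    also have "\<dots> = (\<Sum>A\<in>P. \<bar>ereal (measure \<alpha> A)\<bar>)" by simp
    also have "\<dots> \<le> total_variation ?A2 (\<lambda>A. ereal (measure \<alpha> A))"
      unfolding total_variation_def using P finite_measure_onD[OF \<psi>] by (intro SUP_upper) auto
    also have "\<dots> \<le> ereal (measure \<alpha> (space ?A2))" by (rule total_variation_measure_le[OF \<alpha>])
    finally show "(\<Sum>A\<in>P. \<bar>positive_part \<psi> (\<lambda>S. ereal (?\<eta> S)) A\<bar>) \<le> ereal (measure \<alpha> (space ?A2))" .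
  qed
  also have "\<dots> \<le> ereal (pos_norm ?A2 ?\<eta>)" using le by simp
  finally show ?thesis .
qed

text \<open>Write \<open>\<Lambda> - \<psi> = \<alpha> - \<beta>\<close> by Jordan decomposition, so
  that \<open>D \<Lambda> = D \<psi> + D \<alpha> - D \<beta>\<close>. The last term is nonnegative
  and is dropped; the mass of \<alpha> is at most \<epsilon>, so boundedness makes
  \<open>D \<alpha>\<close> small.\<close>

lemma metrical_le_of_flows:
  assumes D: "metrical M D" and ne: "space M \<noteq> {}" and \<psi>: "finite_measure_on (M \<Otimes>\<^sub>M M) \<psi>"
    and flows: "\<And>\<epsilon>::real. \<epsilon> > 0 \<Longrightarrow> \<exists>\<phi>. multicommodity_flow M \<sigma> \<phi> \<and> overload \<sigma> \<phi> \<psi> < ereal \<epsilon>"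
  shows "D (measure \<sigma>) \<le> D (measure \<psi>)"
proof -
  let ?A2 = "M \<Otimes>\<^sub>M M"
  have "\<exists>C::real. \<forall>\<mu>\<in>signed_measures ?A2.
      ereal \<bar>D \<mu>\<bar> \<le> ereal C * total_variation ?A2 (\<lambda>A. ereal (\<mu> A))"
    using D unfolding metrical_def bounded_functional_def by (elim conjE)
  then obtain C :: real where C: "\<And>\<mu>. \<mu> \<in> signed_measures ?A2 \<Longrightarrow>
      ereal \<bar>D \<mu>\<bar> \<le> ereal C * total_variation ?A2 (\<lambda>A. ereal (\<mu> A))" by auto
  have bound: "D (measure \<sigma>) \<le> D (measure \<psi>) + \<bar>C\<bar> * \<epsilon>" if \<epsilon>: "\<epsilon> > 0" for \<epsilon>
  proof -
    obtain \<phi> where \<phi>: "multicommodity_flow M \<sigma> \<phi>" "overload \<sigma> \<phi> \<psi> < ereal \<epsilon>" using flows[OF \<epsilon>] by auto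
    define \<Lambda> where "\<Lambda> = measure (total_load \<sigma> \<phi>)"
    have \<Lambda>: "\<Lambda> \<in> loads M \<sigma>" and le: "pos_norm ?A2 (\<lambda>A. \<Lambda> A - measure \<psi> A) \<le> \<epsilon>"
      using bounded_overload_imp[OF \<phi>(1) \<psi> ne \<phi>(2)] by (simp_all add: \<Lambda>_def)
    have "(\<lambda>A. \<Lambda> A - measure \<psi> A) \<in> signed_measures ?A2"
      using \<Lambda> \<psi> by (intro signed_measures_diff measure_in_signed_measures loads_in_signed_measures)
    then obtain \<alpha> \<beta> where \<alpha>: "finite_measure_on ?A2 \<alpha>" and \<beta>: "finite_measure_on ?A2 \<beta>"
      and eq: "(\<lambda>A. \<Lambda> A - measure \<psi> A) = (\<lambda>A. measure \<alpha> A - measure \<beta> A)"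
      and \<alpha>_le: "measure \<alpha> (space ?A2) \<le> pos_norm ?A2 (\<lambda>A. \<Lambda> A - measure \<psi> A)"
      by (rule jordan_decomposition)
    have "\<Lambda> A + measure \<beta> A = measure \<psi> A + measure \<alpha> A" for A
      using fun_cong[OF eq, of A] by simp
    then have "(\<lambda>A. \<Lambda> A + measure \<beta> A) = (\<lambda>A. measure \<psi> A + measure \<alpha> A)" by blast
    then have "D \<Lambda> + D (measure \<beta>) = D (measure \<psi>) + D (measure \<alpha>)"
      using \<Lambda> \<psi> \<alpha> \<beta> by (simp add: metrical_add[OF D, symmetric] measure_in_signed_measures loads_in_signed_measures)
    moreover have "D (measure \<sigma>) \<le> D \<Lambda>" by (rule metrical_demand_le_load[OF D \<Lambda>])
    moreover have "0 \<le> D (measure \<beta>)" by (rule metrical_nonneg[OF D \<beta>])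
    moreover have "D (measure \<alpha>) \<le> \<bar>C\<bar> * \<epsilon>"
    proof -
      \<comment> \<open>The constant \<open>C\<close> may be negative. Replacing it by its absolute
        value is monotone because the total variation is nonnegative.\<close>
      have tv0: "0 \<le> total_variation ?A2 (\<lambda>A. ereal (measure \<alpha> A))"
      proof -
        have "space ?A2 \<noteq> {}" using ne by (simp add: space_pair_measure)
        then show ?thesis
          unfolding total_variation_def by (intro SUP_upper2[of "{space ?A2}"]) (auto simp: partition_on_def)
      qed
      have "ereal (D (measure \<alpha>)) \<le> ereal \<bar>D (measure \<alpha>)\<bar>" by simp
      also have "\<dots> \<le> ereal C * total_variation ?A2 (\<lambda>A. ereal (measure \<alpha> A))"
        using \<alpha> by (intro C measure_in_signed_measures)
      also have "\<dots> \<le> ereal \<bar>C\<bar> * total_variation ?A2 (\<lambda>A. ereal (measure \<alpha> A))"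
        using tv0 by (intro ereal_mult_right_mono) auto
      also have "\<dots> \<le> ereal \<bar>C\<bar> * ereal (measure \<alpha> (space ?A2))"
        by (intro ereal_mult_left_mono total_variation_measure_le \<alpha>) simp
      finally have "D (measure \<alpha>) \<le> \<bar>C\<bar> * measure \<alpha> (space ?A2)" by simp
      also have "\<dots> \<le> \<bar>C\<bar> * \<epsilon>" using \<alpha>_le le by (intro mult_left_mono) auto
      finally show ?thesis .
    qed
    ultimately show ?thesis by linarith
  qed
  show ?thesis
  proof (rule field_le_epsilon)
    fix e :: real assume "e > 0"
    \<comment> \<open>The summand 1 in the denominator covers \<open>C = 0\<close> and keeps the
      error below \<open>e\<close>.\<close>
    then have "D (measure \<sigma>) \<le> D (measure \<psi>) + \<bar>C\<bar> * (e / (\<bar>C\<bar> + 1))"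
      by (intro bound) (simp add: add_nonneg_pos)
    also have "\<bar>C\<bar> * (e / (\<bar>C\<bar> + 1)) \<le> e"
      using \<open>e > 0\<close> by (simp add: field_simps)
    finally show "D (measure \<sigma>) \<le> D (measure \<psi>) + e" by simp
  qed
qed

lemma finite_measure_on_scale:
  assumes "finite_measure_on N \<mu>" "0 \<le> t"
  shows "finite_measure_on N (scale_measure (ennreal t) \<mu>)" "measure (scale_measure (ennreal t) \<mu>) S = t * measure \<mu> S"
  using assms finite_measure_on_emeasure[OF assms(1)] finite_measure_onD[OF assms(1)]
  by (auto intro!: finite_measure_onI simp: measure_scale_measure ennreal_mult_less_top)

text \<open>The loads are homogenized: \<open>K\<close> is the convex cone of pairs of a factor
  \<open>t\<close> and a load of \<open>t\<close> times \<sigma>. The functional \<open>q\<close>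
  minimizes, over this cone, the norm of \<open>\<eta>\<close> shifted by
  \<open>\<Lambda> - t * \<psi>\<close>, with a reward of \<epsilon> per unit of \<open>t\<close>.
  Closure of loads under sums and scaling makes \<open>q\<close> sublinear, and the gap keeps the
  infimum finite.\<close>

lemma separating_functional:
  assumes \<sigma>: "finite_measure_on (M \<Otimes>\<^sub>M M) \<sigma>" and \<psi>: "finite_measure_on (M \<Otimes>\<^sub>M M) \<psi>"
    and gap: "\<And>\<Lambda>. \<Lambda> \<in> loads M \<sigma> \<Longrightarrow> \<epsilon> \<le> pos_norm (M \<Otimes>\<^sub>M M) (\<lambda>A. \<Lambda> A - measure \<psi> A)"
  shows "\<exists>D. (\<forall>u\<in>signed_measures (M \<Otimes>\<^sub>M M). \<forall>v\<in>signed_measures (M \<Otimes>\<^sub>M M). D (\<lambda>i. u i + v i) = D u + D v) \<and>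
    (\<forall>v\<in>signed_measures (M \<Otimes>\<^sub>M M). \<forall>c. D (\<lambda>i. c * v i) = c * D v) \<and>
    (\<forall>v\<in>signed_measures (M \<Otimes>\<^sub>M M). D v \<le> pos_norm (M \<Otimes>\<^sub>M M) v) \<and>
    (\<forall>\<Lambda>\<in>loads M \<sigma>. D (measure \<psi>) + \<epsilon> \<le> D \<Lambda>)"
proof -
  let ?A2 = "M \<Otimes>\<^sub>M M"
  let ?V = "signed_measures ?A2"
  let ?N = "pos_norm ?A2"
  define K where "K = {(t, \<Lambda>). 0 \<le> t \<and> \<Lambda> \<in> loads M (scale_measure (ennreal t) \<sigma>)}"
  let ?c = "\<lambda>\<eta> (t, \<Lambda>). ?N (\<lambda>A. \<eta> A + (\<Lambda> A - t * measure \<psi> A)) - t * \<epsilon>"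
  define q where "q \<eta> = (INF k\<in>K. ?c \<eta> k)" for \<eta>
  have \<psi>V: "measure \<psi> \<in> ?V" using \<psi> by (rule measure_in_signed_measures)
  have KV: "(\<lambda>A. \<Lambda> A - t * measure \<psi> A) \<in> ?V" if "(t, \<Lambda>) \<in> K" for t \<Lambda>
    using that loads_in_signed_measures
    by (intro signed_measures_diff signed_measures_scale[OF \<psi>V]) (auto simp: K_def)
  \<comment> \<open>For positive \<open>t\<close>, dividing by \<open>t\<close> gives a load of
    \<sigma>, to which the gap applies; for \<open>t = 0\<close> only nonnegativity of the norm is
    at stake.\<close>
  have K_gap: "t * \<epsilon> \<le> ?N (\<lambda>A. \<Lambda> A - t * measure \<psi> A)" if k: "(t, \<Lambda>) \<in> K" for t \<Lambda>
  proof (cases "t = 0")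
    case False
    with k have t: "t > 0" by (auto simp: K_def)
    have "(\<lambda>A. inverse t * \<Lambda> A) \<in> loads M \<sigma>"
      using k t \<sigma> by (intro loads_scale[of \<Lambda>]) (auto simp: K_def finite_measure_on_scale)
    then have "\<epsilon> \<le> ?N (\<lambda>A. inverse t * \<Lambda> A - measure \<psi> A)" by (rule gap)
    also have "(\<lambda>A. inverse t * \<Lambda> A - measure \<psi> A) = (\<lambda>A. inverse t * (\<Lambda> A - t * measure \<psi> A))"
      using t by (auto simp: field_simps)
    also have "?N \<dots> \<le> inverse t * ?N (\<lambda>A. \<Lambda> A - t * measure \<psi> A)"
      using t by (intro pos_norm_scale KV k) simp
    finally show ?thesis using t by (simp add: field_simps)
  qed (use pos_norm_nonneg[OF KV[OF k]] in simp)
  have bdd: "bdd_below (?c \<eta> ` K)" if \<eta>: "\<eta> \<in> ?V" for \<eta>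
  proof (rule bdd_belowI2)
    fix k assume k: "k \<in> K"
    obtain t \<Lambda> where k': "k = (t, \<Lambda>)" by (cases k)
    note k = k[unfolded k']
    have "?N (\<lambda>A. \<Lambda> A - t * measure \<psi> A)
        = ?N (\<lambda>A. (\<eta> A + (\<Lambda> A - t * measure \<psi> A)) + - \<eta> A)" by simp
    also have "\<dots> \<le> ?N (\<lambda>A. \<eta> A + (\<Lambda> A - t * measure \<psi> A)) + ?N (\<lambda>A. - \<eta> A)"
      by (intro pos_norm_add signed_measures_add signed_measures_uminus \<eta> KV k)
    finally show "- ?N (\<lambda>A. - \<eta> A) \<le> ?c \<eta> k" using K_gap[OF k] by (simp add: k')
  qed
  have q_le: "q \<eta> \<le> ?N (\<lambda>A. \<eta> A + (\<Lambda> A - t * measure \<psi> A)) - t * \<epsilon>" if "\<eta> \<in> ?V" "(t, \<Lambda>) \<in> K" for \<eta> t \<Lambda>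
    using cINF_lower[OF bdd[OF that(1)] that(2)] by (simp add: q_def)
  \<comment> \<open>The apex of the cone: no shift and no reward, hence \<open>q\<close> lies below
    \<open>pos_norm\<close>.\<close>
  have K0: "(0, measure (scale_measure (ennreal 0) \<sigma>)) \<in> K"
    using finite_measure_on_scale(1)[OF \<sigma>, of 0] by (auto simp: K_def intro: measure_in_loads)
  have q_ge: "c \<le> q \<eta>"
    if "\<And>t \<Lambda>. (t, \<Lambda>) \<in> K \<Longrightarrow> c \<le> ?N (\<lambda>A. \<eta> A + (\<Lambda> A - t * measure \<psi> A)) - t * \<epsilon>" for c \<eta>
    unfolding q_def using K0 that by (intro cINF_greatest) auto
  have sub: "sublinear_on ?V q"
    unfolding sublinear_on_def
  proof (intro conjI ballI allI impI)
    fix u v assume u: "u \<in> ?V" and v: "v \<in> ?V"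
    have *: "q (\<lambda>i. u i + v i) - (?N (\<lambda>A. u A + (\<Lambda> A - t * measure \<psi> A)) - t * \<epsilon>) \<le> q v"
      if k: "(t, \<Lambda>) \<in> K" for t \<Lambda>
    proof (rule q_ge)
      fix t' \<Lambda>' assume k': "(t', \<Lambda>') \<in> K"
      have "(\<lambda>A. \<Lambda> A + \<Lambda>' A) \<in> loads M (scale_measure (ennreal (t + t')) \<sigma>)"
        using k k' \<sigma> by (intro loads_add[of \<Lambda> M "scale_measure (ennreal t) \<sigma>" \<Lambda>' "scale_measure (ennreal t') \<sigma>"])
          (auto simp: K_def finite_measure_on_scale algebra_simps simp del: ennreal_plus)
      then have "(t + t', \<lambda>A. \<Lambda> A + \<Lambda>' A) \<in> K" using k k' by (simp add: K_def)
      then have "q (\<lambda>i. u i + v i)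
          \<le> ?N (\<lambda>A. (u A + v A) + ((\<Lambda> A + \<Lambda>' A) - (t + t') * measure \<psi> A)) - (t + t') * \<epsilon>"
        using u v by (intro q_le signed_measures_add)
      also have "(\<lambda>A. (u A + v A) + ((\<Lambda> A + \<Lambda>' A) - (t + t') * measure \<psi> A))
          = (\<lambda>A. (u A + (\<Lambda> A - t * measure \<psi> A)) + (v A + (\<Lambda>' A - t' * measure \<psi> A)))"
        by (auto simp: algebra_simps)
      also have "?N \<dots> \<le> ?N (\<lambda>A. u A + (\<Lambda> A - t * measure \<psi> A)) + ?N (\<lambda>A. v A + (\<Lambda>' A - t' * measure \<psi> A))"
        using u v k k' by (intro pos_norm_add signed_measures_add KV)
      finally show "q (\<lambda>i. u i + v i) - (?N (\<lambda>A. u A + (\<Lambda> A - t * measure \<psi> A)) - t * \<epsilon>)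
          \<le> ?N (\<lambda>A. v A + (\<Lambda>' A - t' * measure \<psi> A)) - t' * \<epsilon>" by (simp add: algebra_simps)
    qed
    have "q (\<lambda>i. u i + v i) - q v \<le> q u"
    proof (rule q_ge)
      fix t \<Lambda> assume "(t, \<Lambda>) \<in> K"
      from *[OF this] show "q (\<lambda>i. u i + v i) - q v \<le> ?N (\<lambda>A. u A + (\<Lambda> A - t * measure \<psi> A)) - t * \<epsilon>"
        by linarith
    qed
    then show "q (\<lambda>i. u i + v i) \<le> q u + q v" by simp
  next
    fix v and c :: real assume v: "v \<in> ?V" and c: "c > 0"
    have "q (\<lambda>i. c * v i) / c \<le> q v"
    proof (rule q_ge)
      fix t \<Lambda> assume k: "(t, \<Lambda>) \<in> K"
      have "(\<lambda>A. c * \<Lambda> A) \<in> loads M (scale_measure (ennreal (c * t)) \<sigma>)"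
        using k c \<sigma> by (intro loads_scale[of \<Lambda> M "scale_measure (ennreal t) \<sigma>"])
          (auto simp: K_def finite_measure_on_scale)
      then have "(c * t, \<lambda>A. c * \<Lambda> A) \<in> K" using k c by (simp add: K_def)
      then have "q (\<lambda>i. c * v i) \<le> ?N (\<lambda>A. c * v A + (c * \<Lambda> A - (c * t) * measure \<psi> A)) - (c * t) * \<epsilon>"
        using v by (intro q_le signed_measures_scale)
      also have "(\<lambda>A. c * v A + (c * \<Lambda> A - (c * t) * measure \<psi> A)) = (\<lambda>A. c * (v A + (\<Lambda> A - t * measure \<psi> A)))"
        by (auto simp: algebra_simps)
      also have "?N \<dots> \<le> c * ?N (\<lambda>A. v A + (\<Lambda> A - t * measure \<psi> A))"
        using v k c by (intro pos_norm_scale signed_measures_add KV) auto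
      finally show "q (\<lambda>i. c * v i) / c \<le> ?N (\<lambda>A. v A + (\<Lambda> A - t * measure \<psi> A)) - t * \<epsilon>"
        using c by (simp add: field_simps)
    qed
    then show "q (\<lambda>i. c * v i) \<le> c * q v" using c by (simp add: field_simps)
  qed
  have zero: "(\<lambda>i. 0) \<in> ?V" using signed_measures_scale[OF \<psi>V, of 0] by simp
  have "\<exists>D. (\<forall>u\<in>?V. \<forall>v\<in>?V. D (\<lambda>i. u i + v i) = D u + D v) \<and>
      (\<forall>v\<in>?V. \<forall>c. D (\<lambda>i. c * v i) = c * D v) \<and> (\<forall>v\<in>?V. D v \<le> q v)"
    by (rule hahn_banach_sublinear[OF zero signed_measures_add signed_measures_scale sub])
  then obtain D where D: "\<forall>u\<in>?V. \<forall>v\<in>?V. D (\<lambda>i. u i + v i) = D u + D v"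
      "\<forall>v\<in>?V. \<forall>c. D (\<lambda>i. c * v i) = c * D v" "\<forall>v\<in>?V. D v \<le> q v" by blast
  note add = bspec[OF bspec[OF D(1)]] and scale = spec[OF bspec[OF D(2)]] and Dq = bspec[OF D(3)]
  show ?thesis
  proof (intro exI[of _ D] conjI D(1,2) ballI)
    fix v assume v: "v \<in> ?V"
    have "D v \<le> q v" using v by (rule Dq)
    also have "\<dots> \<le> ?N v"
      using q_le[OF v K0] by (simp add: finite_measure_on_scale(2)[OF \<sigma>, of 0, simplified])
    finally show "D v \<le> ?N v" .
  next
    fix \<Lambda> assume \<Lambda>: "\<Lambda> \<in> loads M \<sigma>"
    note \<Lambda>V = loads_in_signed_measures[OF \<Lambda>]
    \<comment> \<open>Shifting \<open>\<psi> - \<Lambda>\<close> by this element of the cone leaves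
      zero, so \<open>q\<close> is at most \<open>- \<epsilon>\<close> there.\<close>
    have k: "(1, \<Lambda>) \<in> K" using \<Lambda> by (simp add: K_def)
    have dV: "(\<lambda>A. measure \<psi> A + - \<Lambda> A) \<in> ?V" by (intro signed_measures_add signed_measures_uminus \<psi>V \<Lambda>V)
    have "D (measure \<psi>) - D \<Lambda> = D (\<lambda>A. measure \<psi> A + - \<Lambda> A)"
      using add[OF \<psi>V signed_measures_uminus[OF \<Lambda>V]] scale[OF \<Lambda>V, of "-1"] by simp
    also have "\<dots> \<le> ?N (\<lambda>A. 0) - \<epsilon>" using Dq[OF dV] q_le[OF dV k] by simp
    also have "?N (\<lambda>A. 0) \<le> 0" by (rule pos_norm_least) simp
    finally show "D (measure \<psi>) + \<epsilon> \<le> D \<Lambda>" by simp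
  qed
qed

section \<open>Routing costs\<close>

lemma loads_nonempty: "finite_measure_on (M \<Otimes>\<^sub>M M) \<alpha> \<Longrightarrow> loads M \<alpha> \<noteq> {}"
  using measure_in_loads by blast

lemma finite_measure_on_sum:
  assumes "finite_measure_on N \<alpha>" "finite_measure_on N \<beta>"
  shows "\<exists>\<gamma>. finite_measure_on N \<gamma> \<and> (\<forall>S. measure \<gamma> S = measure \<alpha> S + measure \<beta> S)"
proof -
  have "(\<lambda>S. measure \<alpha> S + measure \<beta> S) \<in> signed_measures N"
    using assms by (intro signed_measures_add measure_in_signed_measures)
  then obtain \<gamma> where "finite_measure_on N \<gamma>" "measure \<gamma> = (\<lambda>S. measure \<alpha> S + measure \<beta> S)"
    by (rule nonneg_signed_measure) simp_all
  then show ?thesis by (intro exI[of _ \<gamma>]) simp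
qed

lemma signed_measures_converse:
  assumes \<mu>: "\<mu> \<in> signed_measures (M \<Otimes>\<^sub>M M)"
  shows "(\<lambda>X. \<mu> (X\<inverse>)) \<in> signed_measures (M \<Otimes>\<^sub>M M)"
proof (rule signed_measuresI)
  fix A :: "nat \<Rightarrow> ('a \<times> 'a) set" assume A: "range A \<subseteq> sets (M \<Otimes>\<^sub>M M)" "disjoint_family A"
  have "(\<lambda>i. \<mu> ((A i)\<inverse>)) sums \<mu> (\<Union>i. (A i)\<inverse>)"
  proof (rule signed_measures_sums[OF \<mu>])
    show "range (\<lambda>i. (A i)\<inverse>) \<subseteq> sets (M \<Otimes>\<^sub>M M)" using A(1) by (auto simp: sets_converse_iff)
    show "disjoint_family (\<lambda>i. (A i)\<inverse>)" using A(2) by (fastforce simp: disjoint_family_on_def)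
  qed
  then show "(\<lambda>i. \<mu> ((A i)\<inverse>)) sums \<mu> ((\<Union>i. A i)\<inverse>)" by (simp add: converse_UNION)
qed (use \<mu> in \<open>simp_all add: signed_measures_empty signed_measures_outside sets_converse_iff\<close>)

lemma pos_norm_converse:
  assumes "\<mu> \<in> signed_measures (M \<Otimes>\<^sub>M M)"
  shows "pos_norm (M \<Otimes>\<^sub>M M) (\<lambda>X. \<mu> (X\<inverse>)) \<le> pos_norm (M \<Otimes>\<^sub>M M) \<mu>"
  by (intro pos_norm_least pos_norm_upper assms) (simp add: sets_converse_iff)

lemma symmetric_measure_converse:
  assumes "finite_measure_on (M \<Otimes>\<^sub>M M) \<mu>" "symmetric_measure \<mu>"
  shows "(\<lambda>X. measure \<mu> (X\<inverse>)) = measure \<mu>"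
proof
  fix X
  show "measure \<mu> (X\<inverse>) = measure \<mu> X"
    using assms finite_measure_onD(2)[OF assms(1)]
    by (cases "X \<in> sets (M \<Otimes>\<^sub>M M)") (auto simp: symmetric_measure_def measure_def measure_notin_sets sets_converse_iff emeasure_notin_sets)
qed

text \<open>Records what separation delivers. The bound by \<open>pos_norm\<close> is the only
  estimate on \<open>D\<close>: applied to negatives of measures it gives nonnegativity, applied to
  measures it bounds \<open>D\<close> by the mass.\<close>

locale routing_cost =
  fixes M :: "'a measure" and D :: "(('a \<times> 'a) set \<Rightarrow> real) \<Rightarrow> real"
  assumes standard: "standard_borel M" and nonempty: "space M \<noteq> {}"
    and D_add: "\<And>u v. u \<in> signed_measures (M \<Otimes>\<^sub>M M) \<Longrightarrow> v \<in> signed_measures (M \<Otimes>\<^sub>M M) \<Longrightarrow>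
      D (\<lambda>i. u i + v i) = D u + D v"
    and D_scale: "\<And>v c. v \<in> signed_measures (M \<Otimes>\<^sub>M M) \<Longrightarrow> D (\<lambda>i. c * v i) = c * D v"
    and D_le: "\<And>v. v \<in> signed_measures (M \<Otimes>\<^sub>M M) \<Longrightarrow> D v \<le> pos_norm (M \<Otimes>\<^sub>M M) v"
begin

abbreviation fin where "fin \<equiv> finite_measure_on (M \<Otimes>\<^sub>M M)"

definition cost :: "('a \<times> 'a) measure \<Rightarrow> real" where
  "cost \<alpha> = (INF \<Lambda>\<in>loads M \<alpha>. D \<Lambda>)"

lemma D_load_nonneg:
  assumes \<Lambda>: "\<Lambda> \<in> loads M \<alpha>"
  shows "0 \<le> D \<Lambda>"
proof -
  note V = loads_in_signed_measures[OF \<Lambda>]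
  have "- D \<Lambda> = D (\<lambda>i. - \<Lambda> i)" using D_scale[OF V, of "-1"] by simp
  also have "\<dots> \<le> pos_norm (M \<Otimes>\<^sub>M M) (\<lambda>i. - \<Lambda> i)" by (intro D_le signed_measures_uminus V)
  also have "\<dots> \<le> 0" using loads_nonneg[OF \<Lambda>] by (intro pos_norm_least) simp
  finally show ?thesis by simp
qed

lemma cost_le: "\<Lambda> \<in> loads M \<alpha> \<Longrightarrow> cost \<alpha> \<le> D \<Lambda>"
  unfolding cost_def by (intro cINF_lower bdd_belowI2[of _ 0] D_load_nonneg)

lemma cost_ge: "fin \<alpha> \<Longrightarrow> (\<And>\<Lambda>. \<Lambda> \<in> loads M \<alpha> \<Longrightarrow> c \<le> D \<Lambda>) \<Longrightarrow> c \<le> cost \<alpha>"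
  unfolding cost_def by (intro cINF_greatest loads_nonempty)

lemma cost_nonneg: "fin \<alpha> \<Longrightarrow> 0 \<le> cost \<alpha>"
  by (intro cost_ge D_load_nonneg)

lemma cost_le_measure:
  assumes \<alpha>: "fin \<alpha>"
  shows "cost \<alpha> \<le> D (measure \<alpha>)" "cost \<alpha> \<le> measure \<alpha> (space (M \<Otimes>\<^sub>M M))"
proof -
  show *: "cost \<alpha> \<le> D (measure \<alpha>)" by (intro cost_le measure_in_loads \<alpha>)
  interpret finite_measure \<alpha> by (rule finite_measure_onD[OF \<alpha>])
  note *
  also have "D (measure \<alpha>) \<le> pos_norm (M \<Otimes>\<^sub>M M) (measure \<alpha>)"
    by (intro D_le measure_in_signed_measures \<alpha>)
  also have "\<dots> \<le> measure \<alpha> (space (M \<Otimes>\<^sub>M M))"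
    using bounded_measure finite_measure_onD(3)[OF \<alpha>] by (intro pos_norm_least) simp
  finally show "cost \<alpha> \<le> measure \<alpha> (space (M \<Otimes>\<^sub>M M))" .
qed

text \<open>Loads of a sum of demands are exactly the sums of loads: \<open>loads_add\<close> gives
  one inequality between the infima, \<open>loads_split\<close> the other.\<close>

lemma cost_add:
  assumes \<alpha>: "fin \<alpha>" and \<beta>: "fin \<beta>" and \<gamma>: "fin \<gamma>"
    and eq: "\<And>S. measure \<gamma> S = measure \<alpha> S + measure \<beta> S"
  shows "cost \<gamma> = cost \<alpha> + cost \<beta>"
proof (rule antisym)
  have *: "cost \<gamma> \<le> D \<Lambda> + D \<Lambda>'" if "\<Lambda> \<in> loads M \<alpha>" "\<Lambda>' \<in> loads M \<beta>" for \<Lambda> \<Lambda>'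
    using cost_le[OF loads_add[OF that \<gamma> eq]] D_add[OF that[THEN loads_in_signed_measures]] by simp
  have "cost \<gamma> - D \<Lambda> \<le> cost \<beta>" if "\<Lambda> \<in> loads M \<alpha>" for \<Lambda>
    using *[OF that] by (intro cost_ge \<beta>) (auto simp: algebra_simps)
  then have "cost \<gamma> - cost \<beta> \<le> cost \<alpha>" by (intro cost_ge \<alpha>) (auto simp: algebra_simps)
  then show "cost \<gamma> \<le> cost \<alpha> + cost \<beta>" by simp
  show "cost \<alpha> + cost \<beta> \<le> cost \<gamma>"
  proof (rule cost_ge[OF \<gamma>])
    fix \<Lambda> assume "\<Lambda> \<in> loads M \<gamma>"
    then obtain \<Lambda>1 \<Lambda>2 where L: "\<Lambda>1 \<in> loads M \<alpha>" "\<Lambda>2 \<in> loads M \<beta>" "\<Lambda> = (\<lambda>S. \<Lambda>1 S + \<Lambda>2 S)"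
      by (rule loads_split[OF _ \<alpha> \<beta> eq])
    have "cost \<alpha> + cost \<beta> \<le> D \<Lambda>1 + D \<Lambda>2" by (intro add_mono cost_le L)
    also have "\<dots> = D \<Lambda>" using D_add[OF L(1,2)[THEN loads_in_signed_measures]] L(3) by simp
    finally show "cost \<alpha> + cost \<beta> \<le> D \<Lambda>" .
  qed
qed

text \<open>One inequality for every positive factor suffices, since the converse is the same
  inequality for the inverse factor. The factor 0 is settled by the zero load.\<close>

lemma cost_scale:
  assumes \<alpha>: "fin \<alpha>" and \<gamma>: "fin \<gamma>" and c: "0 \<le> c" and eq: "\<And>S. measure \<gamma> S = c * measure \<alpha> S"
  shows "cost \<gamma> = c * cost \<alpha>"
proof -
  have le: "cost \<gamma> \<le> c * D \<Lambda>" if "fin \<gamma>" "0 \<le> c" "\<And>S. measure \<gamma> S = c * measure \<alpha> S" "\<Lambda> \<in> loads M \<alpha>" for c \<alpha> \<gamma> \<Lambda>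
    using cost_le[OF loads_scale[OF that(4,1,2,3)]] D_scale[OF loads_in_signed_measures[OF that(4)]] by simp
  have le': "cost \<gamma> \<le> c * cost \<alpha>" if "fin \<alpha>" "fin \<gamma>" "0 < c" "\<And>S. measure \<gamma> S = c * measure \<alpha> S" for c \<alpha> \<gamma>
  proof -
    have "cost \<gamma> / c \<le> cost \<alpha>"
      using le[OF that(2) _ that(4)] that(1,3) by (intro cost_ge) (auto simp: field_simps)
    then show ?thesis using that(3) by (simp add: field_simps)
  qed
  show ?thesis
  proof (cases "c = 0")
    case True
    have "cost \<gamma> \<le> 0" using le[OF \<gamma> c eq measure_in_loads[OF \<alpha>]] True by simp
    then show ?thesis using cost_nonneg[OF \<gamma>] True by simp
  next
    case False
    then have "cost \<alpha> \<le> inverse c * cost \<gamma>" using c by (intro le'[OF \<gamma> \<alpha>]) (auto simp: eq)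
    then have "c * cost \<alpha> \<le> cost \<gamma>" using False c by (simp add: field_simps)
    moreover have "cost \<gamma> \<le> c * cost \<alpha>" using False c by (intro le'[OF \<alpha> \<gamma> _ eq]) simp
    ultimately show ?thesis by simp
  qed
qed

text \<open>Splicing turns any pair of loads for the two inner marginals into a load for the outer
  one; the infimum is then taken over each load separately.\<close>

lemma cost_triangle:
  assumes \<kappa>: "finite_measure_on (M \<Otimes>\<^sub>M M \<Otimes>\<^sub>M M) \<kappa>"
  shows "cost (distr \<kappa> (M \<Otimes>\<^sub>M M) (\<lambda>(x, y, z). (x, z))) \<le>
    cost (distr \<kappa> (M \<Otimes>\<^sub>M M) (\<lambda>(x, y, z). (x, y))) + cost (distr \<kappa> (M \<Otimes>\<^sub>M M) (\<lambda>(x, y, z). (y, z)))"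
    (is "cost ?\<kappa>13 \<le> cost ?\<kappa>12 + cost ?\<kappa>23")
proof -
  have fins: "fin ?\<kappa>12" "fin ?\<kappa>23"
    by (rule finite_measure_on_distr[OF \<kappa>]; measurable)+
  have *: "cost ?\<kappa>13 \<le> D \<Lambda> + D \<Lambda>'" if "\<Lambda> \<in> loads M ?\<kappa>12" "\<Lambda>' \<in> loads M ?\<kappa>23" for \<Lambda> \<Lambda>'
    using cost_le[OF loads_triangle[OF standard nonempty \<kappa> that]] D_add[OF that[THEN loads_in_signed_measures]] by simp
  have "cost ?\<kappa>13 - D \<Lambda> \<le> cost ?\<kappa>23" if "\<Lambda> \<in> loads M ?\<kappa>12" for \<Lambda>
  proof (rule cost_ge[OF fins(2)])
    fix \<Lambda>' assume "\<Lambda>' \<in> loads M ?\<kappa>23"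
    from *[OF that this] show "cost ?\<kappa>13 - D \<Lambda> \<le> D \<Lambda>'" by linarith
  qed
  then have "cost ?\<kappa>13 - cost ?\<kappa>23 \<le> cost ?\<kappa>12" by (intro cost_ge[OF fins(1)]) (simp add: algebra_simps)
  then show ?thesis by linarith
qed

section \<open>Extension of the cost to signed measures\<close>

definition signed_cost :: "(('a \<times> 'a) set \<Rightarrow> real) \<Rightarrow> real" where
  "signed_cost \<mu> = (let (\<alpha>, \<beta>) = (SOME (\<alpha>, \<beta>). fin \<alpha> \<and> fin \<beta> \<and> \<mu> = (\<lambda>A. measure \<alpha> A - measure \<beta> A))
     in cost \<alpha> - cost \<beta>)"

text \<open>Independence of the chosen representation: if two differences agree, then the crosswise
  sums agree, and additivity of \<open>cost\<close> on this common sum \<gamma> yields equal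
  differences of costs.\<close>

lemma signed_cost_eq:
  assumes \<alpha>: "fin \<alpha>" and \<beta>: "fin \<beta>" and \<mu>: "\<mu> = (\<lambda>A. measure \<alpha> A - measure \<beta> A)"
  shows "signed_cost \<mu> = cost \<alpha> - cost \<beta>"
proof -
  let ?P = "\<lambda>p. fin (fst p) \<and> fin (snd p) \<and> \<mu> = (\<lambda>A. measure (fst p) A - measure (snd p) A)"
  define p where "p = (SOME p. ?P p)"
  have "?P (\<alpha>, \<beta>)" using assms by simp
  then have p: "?P p" unfolding p_def by (rule someI)
  have eq: "signed_cost \<mu> = cost (fst p) - cost (snd p)"
    by (simp add: signed_cost_def p_def case_prod_beta' Let_def)
  obtain \<gamma> where \<gamma>: "fin \<gamma>" "\<And>S. measure \<gamma> S = measure \<alpha> S + measure (snd p) S"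
    using finite_measure_on_sum[OF \<alpha>, of "snd p"] p by blast
  have "measure \<gamma> S = measure (fst p) S + measure \<beta> S" for S
  proof -
    have "measure \<alpha> S - measure \<beta> S = measure (fst p) S - measure (snd p) S"
      using p \<mu> by (metis (no_types, lifting))
    then show ?thesis using \<gamma>(2)[of S] by linarith
  qed
  then have "cost \<gamma> = cost (fst p) + cost \<beta>" using p by (intro cost_add \<beta> \<gamma>) auto
  moreover have "cost \<gamma> = cost \<alpha> + cost (snd p)" using p by (intro cost_add \<alpha> \<gamma>) auto
  ultimately show ?thesis by (simp add: eq)
qed

lemma signed_cost_measure:
  assumes "fin \<alpha>"
  shows "signed_cost (measure \<alpha>) = cost \<alpha>"
proof -
  have z: "fin (null_measure (M \<Otimes>\<^sub>M M))" by (intro finite_measure_onI) simp_all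
  have mz: "measure (null_measure (M \<Otimes>\<^sub>M M)) S = 0" for S by (simp add: measure_def)
  have "signed_cost (measure \<alpha>) = cost \<alpha> - cost (null_measure (M \<Otimes>\<^sub>M M))"
    by (rule signed_cost_eq[OF assms z]) (simp add: mz)
  moreover have "cost (null_measure (M \<Otimes>\<^sub>M M)) = 0 * cost \<alpha>"
    by (rule cost_scale[OF assms z]) (simp_all add: mz)
  ultimately show ?thesis by simp
qed

lemma signed_cost_add:
  assumes "\<mu> \<in> signed_measures (M \<Otimes>\<^sub>M M)" "\<nu> \<in> signed_measures (M \<Otimes>\<^sub>M M)"
  shows "signed_cost (\<lambda>A. \<mu> A + \<nu> A) = signed_cost \<mu> + signed_cost \<nu>"
proof -
  obtain \<alpha> \<beta> where \<mu>: "fin \<alpha>" "fin \<beta>" "\<mu> = (\<lambda>A. measure \<alpha> A - measure \<beta> A)"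
    using assms(1) by (rule jordan_decomposition)
  obtain \<alpha>' \<beta>' where \<nu>: "fin \<alpha>'" "fin \<beta>'" "\<nu> = (\<lambda>A. measure \<alpha>' A - measure \<beta>' A)"
    using assms(2) by (rule jordan_decomposition)
  obtain \<gamma> where \<gamma>: "fin \<gamma>" "\<And>S. measure \<gamma> S = measure \<alpha> S + measure \<alpha>' S"
    using finite_measure_on_sum[OF \<mu>(1) \<nu>(1)] by blast
  obtain \<delta> where \<delta>: "fin \<delta>" "\<And>S. measure \<delta> S = measure \<beta> S + measure \<beta>' S"
    using finite_measure_on_sum[OF \<mu>(2) \<nu>(2)] by blast
  have "signed_cost (\<lambda>A. \<mu> A + \<nu> A) = cost \<gamma> - cost \<delta>"
    by (rule signed_cost_eq[OF \<gamma>(1) \<delta>(1)]) (simp add: \<mu>(3) \<nu>(3) \<gamma>(2) \<delta>(2) algebra_simps)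
  then show ?thesis
    using cost_add[OF \<mu>(1) \<nu>(1) \<gamma>] cost_add[OF \<mu>(2) \<nu>(2) \<delta>] signed_cost_eq[OF \<mu>] signed_cost_eq[OF \<nu>] by simp
qed

lemma signed_cost_scale:
  assumes "\<mu> \<in> signed_measures (M \<Otimes>\<^sub>M M)"
  shows "signed_cost (\<lambda>A. c * \<mu> A) = c * signed_cost \<mu>"
proof -
  obtain \<alpha> \<beta> where \<mu>: "fin \<alpha>" "fin \<beta>" "\<mu> = (\<lambda>A. measure \<alpha> A - measure \<beta> A)"
    using assms by (rule jordan_decomposition)
  let ?s = "scale_measure (ennreal \<bar>c\<bar>)"
  note s = finite_measure_on_scale[OF _ abs_ge_zero[of c]]
  have cs: "cost (?s \<alpha>) = \<bar>c\<bar> * cost \<alpha>" "cost (?s \<beta>) = \<bar>c\<bar> * cost \<beta>"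
    by (rule cost_scale[OF _ s(1) abs_ge_zero s(2)]; rule \<mu>)+
  show ?thesis
  proof (cases "0 \<le> c")
    case True
    have "signed_cost (\<lambda>A. c * \<mu> A) = cost (?s \<alpha>) - cost (?s \<beta>)"
      by (rule signed_cost_eq[OF s(1)[OF \<mu>(1)] s(1)[OF \<mu>(2)]])
        (simp only: \<mu>(3) s(2)[OF \<mu>(1)] s(2)[OF \<mu>(2)], simp add: True algebra_simps)
    then show ?thesis using cs True by (simp add: signed_cost_eq[OF \<mu>] right_diff_distrib)
  next
    case False
    \<comment> \<open>A negative factor exchanges the roles of the positive and the negative
      part.\<close>
    have "signed_cost (\<lambda>A. c * \<mu> A) = cost (?s \<beta>) - cost (?s \<alpha>)"
    proof (rule signed_cost_eq[OF s(1)[OF \<mu>(2)] s(1)[OF \<mu>(1)]])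
      have "\<bar>c\<bar> = - c" using False by simp
      then show "(\<lambda>A. c * \<mu> A) = (\<lambda>A. measure (?s \<beta>) A - measure (?s \<alpha>) A)"
        by (simp only: \<mu>(3) s(2)[OF \<mu>(1)] s(2)[OF \<mu>(2)]) (simp add: algebra_simps)
    qed
    then show ?thesis using cs False by (simp add: signed_cost_eq[OF \<mu>] algebra_simps)
  qed
qed

text \<open>The value can be computed from any representation; the Jordan decomposition is the
  economical one, whose masses are controlled by \<mu>.\<close>

lemma signed_cost_bound:
  assumes \<mu>: "\<mu> \<in> signed_measures (M \<Otimes>\<^sub>M M)"
  shows "\<bar>signed_cost \<mu>\<bar> \<le> pos_norm (M \<Otimes>\<^sub>M M) \<mu> + pos_norm (M \<Otimes>\<^sub>M M) (\<lambda>A. - \<mu> A)"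
proof -
  obtain \<alpha> \<beta> where ab: "fin \<alpha>" "fin \<beta>" "\<mu> = (\<lambda>A. measure \<alpha> A - measure \<beta> A)"
    "measure \<alpha> (space (M \<Otimes>\<^sub>M M)) \<le> pos_norm (M \<Otimes>\<^sub>M M) \<mu>"
    "measure \<beta> (space (M \<Otimes>\<^sub>M M)) \<le> pos_norm (M \<Otimes>\<^sub>M M) (\<lambda>A. - \<mu> A)"
    using \<mu> by (rule jordan_decomposition)
  have "signed_cost \<mu> = cost \<alpha> - cost \<beta>" by (rule signed_cost_eq[OF ab(1-3)])
  then show ?thesis
    using cost_nonneg[OF ab(1)] cost_nonneg[OF ab(2)] cost_le_measure(2)[OF ab(1)] cost_le_measure(2)[OF ab(2)] ab(4,5)
    by linarith
qed

text \<open>The real code of a standard Borel space is injective, so inequality of points is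
  inequality of two measurable real functions.\<close>

lemma offdiagonal_sets: "{p\<in>space (M \<Otimes>\<^sub>M M). fst p \<noteq> snd p} \<in> sets (M \<Otimes>\<^sub>M M)"
proof -
  obtain f :: "'a \<Rightarrow> real" and g where [measurable]: "f \<in> borel_measurable M"
    and gf: "\<And>x. x \<in> space M \<Longrightarrow> g (f x) = x"
    using standard_borel_retract[OF standard nonempty] by blast
  have "{p\<in>space (M \<Otimes>\<^sub>M M). fst p \<noteq> snd p} = {p\<in>space (M \<Otimes>\<^sub>M M). f (fst p) \<noteq> f (snd p)}"
  proof -
    have "f x \<noteq> f y" if "x \<in> space M" "y \<in> space M" "x \<noteq> y" for x y
      using gf[OF that(1)] gf[OF that(2)] that(3) by metis
    then show ?thesis by (auto simp: space_pair_measure)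
  qed
  also have "\<dots> \<in> sets (M \<Otimes>\<^sub>M M)" by measurable
  finally show ?thesis .
qed

text \<open>The representing measures of \<mu> may have mass off the diagonal that cancels.
  Restricting both to the diagonal leaves their difference unchanged, and the restricted demands are
  served by the zero load.\<close>

lemma signed_cost_diag:
  assumes \<mu>: "\<mu> \<in> signed_measures (M \<Otimes>\<^sub>M M)"
    and diag: "\<And>X. X \<in> sets (M \<Otimes>\<^sub>M M) \<Longrightarrow> X \<inter> Id = {} \<Longrightarrow> \<mu> X = 0"
  shows "signed_cost \<mu> = 0"
proof -
  let ?\<Delta> = "{p\<in>space (M \<Otimes>\<^sub>M M). fst p \<noteq> snd p}"
  obtain \<alpha> \<beta> where ab: "fin \<alpha>" "fin \<beta>" "\<mu> = (\<lambda>A. measure \<alpha> A - measure \<beta> A)"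
    using \<mu> by (rule jordan_decomposition)
  have restrict: "\<exists>\<alpha>1. fin \<alpha>1 \<and> (\<forall>S. measure \<alpha>1 S = (if S \<in> sets (M \<Otimes>\<^sub>M M) then measure \<alpha> (S - ?\<Delta>) else 0)) \<and> cost \<alpha>1 = 0"
    if \<alpha>: "fin \<alpha>" for \<alpha>
  proof -
    note D\<alpha> = finite_measure_onD[OF \<alpha>]
    interpret finite_measure \<alpha> by (rule D\<alpha>)
    let ?\<alpha>1 = "density \<alpha> (indicator (- ?\<Delta>))"
    have ind: "(indicator (- ?\<Delta>) :: _ \<Rightarrow> ennreal) \<in> borel_measurable \<alpha>"
    proof -
      have "(indicator ?\<Delta> :: _ \<Rightarrow> ennreal) \<in> borel_measurable \<alpha>"
        using offdiagonal_sets D\<alpha>(2) by simp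
      then have "(\<lambda>p. 1 - indicator ?\<Delta> p :: ennreal) \<in> borel_measurable \<alpha>" by measurable
      also have "(\<lambda>p. 1 - indicator ?\<Delta> p :: ennreal) = indicator (- ?\<Delta>)" by (auto split: split_indicator)
      finally show "(indicator (- ?\<Delta>) :: _ \<Rightarrow> ennreal) \<in> borel_measurable \<alpha>" .
    qed
    have em: "emeasure ?\<alpha>1 S = emeasure \<alpha> (S - ?\<Delta>)" if "S \<in> sets (M \<Otimes>\<^sub>M M)" for S
    proof -
      have S: "S \<in> sets \<alpha>" "S - ?\<Delta> \<in> sets \<alpha>" using that offdiagonal_sets D\<alpha>(2) by auto
      have "emeasure ?\<alpha>1 S = (\<integral>\<^sup>+p. indicator (- ?\<Delta>) p * indicator S p \<partial>\<alpha>)"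
        by (rule emeasure_density[OF ind S(1)])
      also have "\<dots> = (\<integral>\<^sup>+p. indicator (S - ?\<Delta>) p \<partial>\<alpha>)"
        by (intro nn_integral_cong) (auto split: split_indicator)
      finally show ?thesis using S(2) by simp
    qed
    have fin1: "fin ?\<alpha>1"
      using D\<alpha>(2) by (intro finite_measure_onI) (simp_all add: em emeasure_eq_measure)
    have "(\<lambda>_. 0) \<in> loads M ?\<alpha>1"
      using offdiagonal_sets by (intro zero_in_loads[OF fin1]) (simp_all add: em)
    then have "cost ?\<alpha>1 \<le> D (\<lambda>_. 0)" by (rule cost_le)
    also have "\<dots> = 0" using D_scale[OF \<mu>, of 0] by simp
    finally have "cost ?\<alpha>1 = 0" using cost_nonneg[OF fin1] by simp
    moreover have "measure ?\<alpha>1 S = (if S \<in> sets (M \<Otimes>\<^sub>M M) then measure \<alpha> (S - ?\<Delta>) else 0)" for S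
      using em[of S] D\<alpha>(2) by (auto simp: measure_def emeasure_notin_sets)
    ultimately show ?thesis using fin1 by blast
  qed
  obtain \<alpha>1 where \<alpha>1: "fin \<alpha>1" "cost \<alpha>1 = 0"
    "\<And>S. measure \<alpha>1 S = (if S \<in> sets (M \<Otimes>\<^sub>M M) then measure \<alpha> (S - ?\<Delta>) else 0)"
    using restrict[OF ab(1)] by blast
  obtain \<beta>1 where \<beta>1: "fin \<beta>1" "cost \<beta>1 = 0"
    "\<And>S. measure \<beta>1 S = (if S \<in> sets (M \<Otimes>\<^sub>M M) then measure \<beta> (S - ?\<Delta>) else 0)"
    using restrict[OF ab(2)] by blast
  have "\<mu> S = measure \<alpha>1 S - measure \<beta>1 S" for S
  proof (cases "S \<in> sets (M \<Otimes>\<^sub>M M)")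
    case True
    have sets: "S - ?\<Delta> \<in> sets (M \<Otimes>\<^sub>M M)" "S \<inter> ?\<Delta> \<in> sets (M \<Otimes>\<^sub>M M)" using True offdiagonal_sets by auto
    have "\<mu> ((S - ?\<Delta>) \<union> (S \<inter> ?\<Delta>)) = \<mu> (S - ?\<Delta>) + \<mu> (S \<inter> ?\<Delta>)"
      by (rule signed_measures_Un[OF \<mu> sets]) auto
    moreover have "(S - ?\<Delta>) \<union> (S \<inter> ?\<Delta>) = S" by auto
    moreover have "\<mu> (S \<inter> ?\<Delta>) = 0" by (rule diag[OF sets(2)]) auto
    ultimately have "\<mu> S = \<mu> (S - ?\<Delta>)" by simp
    also have "\<dots> = measure \<alpha> (S - ?\<Delta>) - measure \<beta> (S - ?\<Delta>)" by (simp only: ab(3))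
    finally show ?thesis using True by (simp only: \<alpha>1(3) \<beta>1(3) if_True)
  next
    case False
    then show ?thesis using signed_measures_outside[OF \<mu> False] by (simp only: \<alpha>1(3) \<beta>1(3)) simp
  qed
  then have "\<mu> = (\<lambda>S. measure \<alpha>1 S - measure \<beta>1 S)" by blast
  from signed_cost_eq[OF \<alpha>1(1) \<beta>1(1) this] show ?thesis by (simp add: \<alpha>1(2) \<beta>1(2))
qed

text \<open>Symmetrized by a sum instead of an average: on symmetric measures this doubles the cost,
  a factor common to both sides of the final comparison.\<close>

definition metric_cost :: "(('a \<times> 'a) set \<Rightarrow> real) \<Rightarrow> real" where
  "metric_cost \<mu> = signed_cost \<mu> + signed_cost (\<lambda>X. \<mu> (X\<inverse>))"

lemma bounded_functional_metric_cost: "bounded_functional (M \<Otimes>\<^sub>M M) metric_cost"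
  unfolding bounded_functional_def
proof (intro conjI ballI allI)
  let ?V = "signed_measures (M \<Otimes>\<^sub>M M)"
  fix \<mu> assume \<mu>: "\<mu> \<in> ?V"
  note \<mu>c = signed_measures_converse[OF \<mu>]
  show "metric_cost (\<lambda>A. \<mu> A + \<nu> A) = metric_cost \<mu> + metric_cost \<nu>" if \<nu>: "\<nu> \<in> ?V" for \<nu>
    using signed_cost_add[OF \<mu> \<nu>] signed_cost_add[OF \<mu>c signed_measures_converse[OF \<nu>]]
    by (simp add: metric_cost_def)
  show "metric_cost (\<lambda>A. c * \<mu> A) = c * metric_cost \<mu>" for c
    using signed_cost_scale[OF \<mu>] signed_cost_scale[OF \<mu>c] by (simp add: metric_cost_def distrib_left)
next
  let ?V = "signed_measures (M \<Otimes>\<^sub>M M)" and ?N = "pos_norm (M \<Otimes>\<^sub>M M)"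
  show "\<exists>C. \<forall>\<mu>\<in>?V. ereal \<bar>metric_cost \<mu>\<bar> \<le> ereal C * total_variation (M \<Otimes>\<^sub>M M) (\<lambda>A. ereal (\<mu> A))"
  proof (intro exI ballI)
    fix \<mu> assume \<mu>: "\<mu> \<in> ?V"
    note n\<mu> = signed_measures_uminus[OF \<mu>]
    have "\<bar>metric_cost \<mu>\<bar> \<le> 2 * (?N \<mu> + ?N (\<lambda>A. - \<mu> A))"
    proof -
      have "?N (\<lambda>A. - \<mu> (A\<inverse>)) \<le> ?N (\<lambda>A. - \<mu> A)" by (rule pos_norm_converse[OF n\<mu>])
      moreover have "\<bar>metric_cost \<mu>\<bar> \<le> \<bar>signed_cost \<mu>\<bar> + \<bar>signed_cost (\<lambda>X. \<mu> (X\<inverse>))\<bar>"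
        unfolding metric_cost_def by (rule abs_triangle_ineq)
      ultimately show ?thesis
        using signed_cost_bound[OF \<mu>] signed_cost_bound[OF signed_measures_converse[OF \<mu>]]
          pos_norm_converse[OF \<mu>] by argo
    qed
    moreover have "ereal (?N \<mu>) \<le> total_variation (M \<Otimes>\<^sub>M M) (\<lambda>A. ereal (\<mu> A))"
      by (rule pos_norm_le_total_variation[OF \<mu>])
    moreover have "ereal (?N (\<lambda>A. - \<mu> A)) \<le> total_variation (M \<Otimes>\<^sub>M M) (\<lambda>A. ereal (\<mu> A))"
      using pos_norm_le_total_variation[OF n\<mu>] by (simp add: total_variation_def)
    \<comment> \<open>Two orientations and two signs, each contributing at most the total variation,
      account for the constant 4.\<close>
    ultimately show "ereal \<bar>metric_cost \<mu>\<bar> \<le> ereal 4 * total_variation (M \<Otimes>\<^sub>M M) (\<lambda>A. ereal (\<mu> A))"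
      by (cases "total_variation (M \<Otimes>\<^sub>M M) (\<lambda>A. ereal (\<mu> A))") auto
  qed
qed

lemma metrical_metric_cost: "metrical M metric_cost"
  unfolding metrical_def
proof (intro conjI ballI allI impI)
  show "bounded_functional (M \<Otimes>\<^sub>M M) metric_cost" by (rule bounded_functional_metric_cost)
next
  fix \<mu> assume \<mu>: "\<mu> \<in> signed_measures (M \<Otimes>\<^sub>M M)"
    and diag: "\<forall>X\<in>sets (M \<Otimes>\<^sub>M M). X \<inter> Id = {} \<longrightarrow> \<mu> X = 0"
  have "signed_cost \<mu> = 0" using diag by (intro signed_cost_diag[OF \<mu>]) auto
  moreover have "signed_cost (\<lambda>X. \<mu> (X\<inverse>)) = 0"
  proof (rule signed_cost_diag[OF signed_measures_converse[OF \<mu>]])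
    fix X :: "('a \<times> 'a) set" assume X: "X \<in> sets (M \<Otimes>\<^sub>M M)" "X \<inter> Id = {}"
    have "X\<inverse> \<inter> Id = {}" using X(2) by auto
    then show "\<mu> (X\<inverse>) = 0" using diag X(1) by (simp add: sets_converse_iff)
  qed
  ultimately show "metric_cost \<mu> = 0" by (simp add: metric_cost_def)
next
  fix \<mu> assume "\<mu> \<in> signed_measures (M \<Otimes>\<^sub>M M)"
  show "metric_cost \<mu> = metric_cost (\<lambda>X. \<mu> (X\<inverse>))" by (simp add: metric_cost_def)
next
  fix \<kappa> assume \<kappa>: "finite_measure_on (M \<Otimes>\<^sub>M M \<Otimes>\<^sub>M M) \<kappa>"
  note [measurable_cong] = finite_measure_onD(2)[OF \<kappa>]
  let ?A2 = "M \<Otimes>\<^sub>M M"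
  let ?\<kappa>12 = "distr \<kappa> ?A2 (\<lambda>(x, y, z). (x, y))"
  let ?\<kappa>13 = "distr \<kappa> ?A2 (\<lambda>(x, y, z). (x, z))"
  let ?\<kappa>23 = "distr \<kappa> ?A2 (\<lambda>(x, y, z). (y, z))"
  \<comment> \<open>Reading triples backwards expresses the reversed marginals of \<kappa> as
    marginals of \<open>?\<kappa>'\<close>, with the two inner ones exchanged. The cost triangle for
    \<open>?\<kappa>'\<close> thus handles the reversed half of \<open>metric_cost\<close>.\<close>
  let ?\<kappa>' = "distr \<kappa> (M \<Otimes>\<^sub>M M \<Otimes>\<^sub>M M) (\<lambda>(x, y, z). (z, y, x))"
  let ?swap = "\<lambda>(x, y). (y, x)"
  have \<kappa>': "finite_measure_on (M \<Otimes>\<^sub>M M \<Otimes>\<^sub>M M) ?\<kappa>'"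
    by (rule finite_measure_on_distr[OF \<kappa>]) measurable
  have fins: "fin ?\<kappa>12" "fin ?\<kappa>13" "fin ?\<kappa>23"
    by (rule finite_measure_on_distr[OF \<kappa>]; measurable)+
  have swaps: "distr ?\<kappa>12 ?A2 ?swap = distr ?\<kappa>' ?A2 (\<lambda>(x, y, z). (y, z))"
    "distr ?\<kappa>23 ?A2 ?swap = distr ?\<kappa>' ?A2 (\<lambda>(x, y, z). (x, y))"
    "distr ?\<kappa>13 ?A2 ?swap = distr ?\<kappa>' ?A2 (\<lambda>(x, y, z). (x, z))"
    by (simp_all add: distr_distr comp_def case_prod_beta')
  have conv: "metric_cost (measure \<mu>) = cost \<mu> + cost (distr \<mu> ?A2 ?swap)" if "fin \<mu>" for \<mu>
    unfolding metric_cost_def measure_converse[OF that]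
    by (subst (1 2) signed_cost_measure) (auto intro: that finite_measure_on_distr[OF that measurable_pair_swap'])
  show "metric_cost (measure ?\<kappa>13) \<le> metric_cost (measure ?\<kappa>12) + metric_cost (measure ?\<kappa>23)"
    unfolding conv[OF fins(1)] conv[OF fins(2)] conv[OF fins(3)] swaps
    using cost_triangle[OF \<kappa>] cost_triangle[OF \<kappa>'] by linarith
qed

end

text \<open>If no flow has small overload, every load of \<sigma> is priced at least \<epsilon>
  above \<psi>, hence so is the cost of \<sigma>. The cost of \<psi> does not exceed its price, and
  by symmetry \<open>metric_cost\<close> is twice the cost on both measures, contradicting the
  assumed inequality.\<close>

lemma flows_of_metrical_le:
  assumes sb: "standard_borel M" and ne: "space M \<noteq> {}"
    and \<sigma>: "finite_measure_on (M \<Otimes>\<^sub>M M) \<sigma>" "symmetric_measure \<sigma>"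
    and \<psi>: "finite_measure_on (M \<Otimes>\<^sub>M M) \<psi>" "symmetric_measure \<psi>"
    and le: "\<And>D. metrical M D \<Longrightarrow> D (measure \<sigma>) \<le> D (measure \<psi>)" and \<epsilon>: "\<epsilon> > 0"
  shows "\<exists>\<phi>. multicommodity_flow M \<sigma> \<phi> \<and> overload \<sigma> \<phi> \<psi> < ereal \<epsilon>"
proof (rule ccontr)
  assume no_flow: "\<not> ?thesis"
  have gap: "\<epsilon> \<le> pos_norm (M \<Otimes>\<^sub>M M) (\<lambda>A. \<Lambda> A - measure \<psi> A)" if \<Lambda>: "\<Lambda> \<in> loads M \<sigma>" for \<Lambda>
  proof (rule ccontr)
    assume small: "\<not> ?thesis"
    obtain \<phi> where \<phi>: "multicommodity_flow M \<sigma> \<phi>" "finite_measure_on (M \<Otimes>\<^sub>M M) (total_load \<sigma> \<phi>)"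
      "\<Lambda> = measure (total_load \<sigma> \<phi>)"
      using loadsE[OF \<Lambda>] by metis
    have "overload \<sigma> \<phi> \<psi> \<le> ereal (pos_norm (M \<Otimes>\<^sub>M M) (\<lambda>A. \<Lambda> A - measure \<psi> A))"
      unfolding \<phi>(3) by (rule overload_le_pos_norm[OF \<phi>(2) \<psi>(1)])
    also have "\<dots> < ereal \<epsilon>" using small by simp
    finally show False using no_flow \<phi>(1) by blast
  qed
  from separating_functional[OF \<sigma>(1) \<psi>(1) gap] obtain D where
    D: "\<forall>u\<in>signed_measures (M \<Otimes>\<^sub>M M). \<forall>v\<in>signed_measures (M \<Otimes>\<^sub>M M). D (\<lambda>i. u i + v i) = D u + D v"
      "\<forall>v\<in>signed_measures (M \<Otimes>\<^sub>M M). \<forall>c. D (\<lambda>i. c * v i) = c * D v"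
      "\<forall>v\<in>signed_measures (M \<Otimes>\<^sub>M M). D v \<le> pos_norm (M \<Otimes>\<^sub>M M) v"
    and sep: "\<forall>\<Lambda>\<in>loads M \<sigma>. D (measure \<psi>) + \<epsilon> \<le> D \<Lambda>"
    by blast
  interpret routing_cost M D
    by unfold_locales (use sb ne D in simp_all)
  have cost_eq: "metric_cost (measure \<mu>) = 2 * cost \<mu>" if "fin \<mu>" "symmetric_measure \<mu>" for \<mu>
    by (simp add: metric_cost_def symmetric_measure_converse[OF that] signed_cost_measure[OF that(1)])
  have "D (measure \<psi>) + \<epsilon> \<le> cost \<sigma>" by (intro cost_ge \<sigma> bspec[OF sep])
  moreover have "cost \<psi> \<le> D (measure \<psi>)" by (rule cost_le_measure(1)[OF \<psi>(1)])
  moreover have "2 * cost \<sigma> \<le> 2 * cost \<psi>"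
    using le[OF metrical_metric_cost] by (simp only: cost_eq[OF \<sigma>] cost_eq[OF \<psi>])
  ultimately show False using \<epsilon> by linarith
qed

theorem theorem5p3:
  fixes M :: "'a measure" and \<sigma> \<psi> :: "('a \<times> 'a) measure"
  assumes "standard_borel M"
    and "finite_measure_on (M \<Otimes>\<^sub>M M) \<sigma>" and "symmetric_measure \<sigma>"
    and "finite_measure_on (M \<Otimes>\<^sub>M M) \<psi>" and "symmetric_measure \<psi>"
  shows "(\<forall>\<epsilon>::real. \<epsilon> > 0 \<longrightarrow> (\<exists>\<phi>. multicommodity_flow M \<sigma> \<phi> \<and> overload \<sigma> \<phi> \<psi> < ereal \<epsilon>)) \<longleftrightarrow>
         (\<forall>D. metrical M D \<longrightarrow> D (measure \<sigma>) \<le> D (measure \<psi>))"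
proof (cases "space M = {}")
  case False
  show ?thesis
  proof (intro iffI allI impI)
    fix D
    assume "\<forall>\<epsilon>::real. \<epsilon> > 0 \<longrightarrow> (\<exists>\<phi>. multicommodity_flow M \<sigma> \<phi> \<and> overload \<sigma> \<phi> \<psi> < ereal \<epsilon>)"
    then show "D (measure \<sigma>) \<le> D (measure \<psi>)" if "metrical M D"
      by (intro metrical_le_of_flows[OF that False assms(4)]) blast
  next
    fix \<epsilon> :: real
    assume "\<forall>D. metrical M D \<longrightarrow> D (measure \<sigma>) \<le> D (measure \<psi>)" and "\<epsilon> > 0"
    then show "\<exists>\<phi>. multicommodity_flow M \<sigma> \<phi> \<and> overload \<sigma> \<phi> \<psi> < ereal \<epsilon>"
      by (intro flows_of_metrical_le[OF assms(1) False assms(2-5)]) blast+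
  qed
next
  \<comment> \<open>Over the empty space all measures vanish: every functional gives equality, and
    direct routing has overload at most 0. This case stands apart because coding and the one-block
    partition require a point.\<close>
  case True
  have sp: "space (M \<Otimes>\<^sub>M M) = {}" using True by (simp add: space_pair_measure)
  have zero: "measure \<mu> S = 0" if "finite_measure_on (M \<Otimes>\<^sub>M M) \<mu>" for \<mu> S
  proof -
    have "space \<mu> = {}" using finite_measure_onD(3)[OF that] sp by simp
    then show ?thesis using sets.sets_into_space[of S \<mu>] by (cases "S \<in> sets \<mu>") (auto simp: measure_notin_sets)
  qed
  have eq: "measure \<sigma> = measure \<psi>" using zero[OF assms(2)] zero[OF assms(4)] by auto
  let ?\<phi> = "return (M \<Otimes>\<^sub>M M)"
  note flow = return_flow[OF assms(2)]
  have fin: "finite_measure_on (M \<Otimes>\<^sub>M M) (total_load \<sigma> ?\<phi>)"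
    using sp by (intro finite_measure_onI sets_total_load[OF flow]) simp
  have "overload \<sigma> ?\<phi> \<psi> \<le> ereal (pos_norm (M \<Otimes>\<^sub>M M) (\<lambda>A. measure (total_load \<sigma> ?\<phi>) A - measure \<psi> A))"
    by (rule overload_le_pos_norm[OF fin assms(4)])
  also have "\<dots> \<le> ereal 0"
    using zero[OF fin] zero[OF assms(4)] by (auto intro!: pos_norm_least)
  finally have "overload \<sigma> ?\<phi> \<psi> < ereal \<epsilon>" if "\<epsilon> > 0" for \<epsilon>
    using that by (auto simp: zero_ereal_def intro: le_less_trans)
  with flow eq show ?thesis by auto
qed

end
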